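(* Let $A$ be an Artin–Schelter regular algebra of global dimension 4 with 3 linear generators. Then $A$ is $\mathcal{K}_2$.
   Context: Conventions. $K$ is a field. A "graded algebra" is a connected $\mathbb{N}$-graded $K$-algebra of the form $A=T(V)/I$, where $V$ is a finite-dimensional $K$-vector space placed in degree 1, $T(V)$ is its tensor algebra, and $I$ is an ideal generated by a (minimal) finite set of homogeneous elements of degree at least 2 (not necessarily all of the same degree). The field $K$ is identified with the trivial $A$-module $A/A_+$. The bigraded Yoneda algebra is $E(A)=\bigoplus_{n,m} E^{n,m}(A)$ with $E^{n,m}(A)=\mathrm{Ext}_A^{n}(K,K)_{-m}$ ($n$ is the cohomological degree, $-m$ the internal degree; Ext is computed in the category of $\mathbb{Z}$-graded locally finite $A$-modules with graded Hom spaces), with the Yoneda (cup) product; $E^n(A)=\bigoplus_m E^{n,m}(A)$. The graded algebra $A$ is called $\mathcal{K}_2$ if $E(A)$ is generated as an algebra by $E^1(A)$ and $E^2(A)$. A graded algebra $A$ is Artin–Schelter regular of global dimension $d$ if it has finite global dimension $d$, finite Gelfand–Kirillov dimension, and satisfies the Gorenstein condition: $\mathrm{Ext}^i_A(K,A)=0$ for $i\ne d$ and $\mathrm{Ext}^d_A(K,A)\cong K(l)$ for some integer $l$. "With 3 linear generators" means $A=K\langle x_1,x_2,x_3\rangle/I$ with $\dim_K A_1=3$. Such an algebra of global dimension 4 is taken (from the literature on 4-dimensional regular algebras) to have 4 defining relations, of degrees $2,2,3,3$, and a minimal projective resolution of the left trivial module of the form $$0\to A(-5)\to A(-4)^3\to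 A(-2)^2\oplus A(-3)^2\to A(-1)^3\to A\to K\to 0.$$ Here $W(n)_k=W_{n+k}$. *)

theory Defs
  imports
    Complex_Main
    "HOL-Library.Cardinality"
    "HOL-Library.Poly_Mapping"
    "HOL-Library.Function_Algebras"
    "HOL-Library.Extended_Nat"
    "HOL-Library.Extended_Real"
    "HOL-Library.Liminf_Limsup"
begin

section \<open>Graded algebras and their presentations\<close>

text \<open>The underlying ring of a graded algebra is the whole type \<open>'a\<close>; the record carries
  the remaining structure: scalar multiplication and homogeneous components.\<close>

record ('k, 'a) gralg =
  scal :: "'k \<Rightarrow> 'a \<Rightarrow> 'a"
  gr :: "nat \<Rightarrow> 'a set"

definition decomposes :: "('i \<Rightarrow> 'm::ab_group_add set) \<Rightarrow> ('i \<Rightarrow> 'm) \<Rightarrow> 'm \<Rightarrow> bool" where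
  "decomposes C x m \<longleftrightarrow>
     (\<forall>i. x i \<in> C i) \<and> finite {i. x i \<noteq> 0} \<and> m = (\<Sum>i | x i \<noteq> 0. x i)"

definition connected_graded_algebra :: "('k::field, 'a::ring_1) gralg \<Rightarrow> bool" where
  "connected_graded_algebra A \<longleftrightarrow>
     vector_space (scal A) \<and>
     (\<forall>c a b. scal A c (a * b) = scal A c a * b \<and> scal A c (a * b) = a * scal A c b) \<and>
     (\<forall>n. module.subspace (scal A) (gr A n)) \<and>
     (\<forall>a. \<exists>!x. decomposes (gr A) x a) \<and>
     (\<forall>i j. \<forall>a\<in>gr A i. \<forall>b\<in>gr A j. a * b \<in> gr A (i + j)) \<and>
     gr A 0 = range (\<lambda>c. scal A c 1)"

definition pos_part :: "('k::field, 'a::ring_1) gralg \<Rightarrow> 'a set" where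
  "pos_part A = {a. \<exists>x. decomposes (gr A) x a \<and> x 0 = 0}"

text \<open>The projection from \<open>A\<close> to \<open>A/A\<^sub>+\<close>, the latter identified with the ground field.\<close>

definition aug :: "('k::field, 'a::ring_1) gralg \<Rightarrow> 'a \<Rightarrow> 'k" where
  "aug A a = (THE c. a - scal A c 1 \<in> pos_part A)"

text \<open>Words form a monoid, written additively because the convolution product on
  \<open>poly_mapping\<close> expects an additive monoid of exponents. Hence \<open>'x word \<Rightarrow>\<^sub>0 'k\<close>,
  with its library ring structure, is the free algebra on \<open>'x\<close>, i.e. the tensor algebra of
  the vector space with basis \<open>'x\<close>.\<close>

datatype 'x word = Word (letters: "'x list")

instantiation word :: (type) monoid_add
begin

definition "0 = Word []"
definition "u + v = Word (letters u @ letters v)"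

instance
  by standard (auto simp: zero_word_def plus_word_def)

end

definition tensor_deg :: "nat \<Rightarrow> ('x word \<Rightarrow>\<^sub>0 'k::field) set" where
  "tensor_deg n = {p. \<forall>w\<in>Poly_Mapping.keys p. length (letters w) = n}"

definition two_sided_ideal :: "'r::ring_1 set \<Rightarrow> bool" where
  "two_sided_ideal I \<longleftrightarrow>
     0 \<in> I \<and> (\<forall>a\<in>I. \<forall>b\<in>I. a + b \<in> I) \<and> (\<forall>a\<in>I. \<forall>r. r * a \<in> I \<and> a * r \<in> I)"

definition ideal_generated :: "'r::ring_1 set \<Rightarrow> 'r set" where
  "ideal_generated R = \<Inter>{I. two_sided_ideal I \<and> R \<subseteq> I}"

definition word_eval ::
  "('k::field, 'a::ring_1) gralg \<Rightarrow> ('x \<Rightarrow> 'a) \<Rightarrow> ('x word \<Rightarrow>\<^sub>0 'k) \<Rightarrow> 'a" where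
  "word_eval A x p =
     (\<Sum>w\<in>Poly_Mapping.keys p.
        scal A (Poly_Mapping.lookup p w) (prod_list (map x (letters w))))"

text \<open>\<open>A = T(V)/I\<close>, where \<open>V\<close> has the finite basis \<open>'x\<close> in degree 1 (mapped to \<open>A\<close> by
  \<open>x\<close>) and \<open>R\<close> is a minimal finite set of homogeneous generators of \<open>I\<close>, of degrees at
  least 2. The isomorphism is the one induced by the algebra homomorphism \<open>word_eval A x\<close>.\<close>

definition presentation ::
  "('k::field, 'a::ring_1) gralg \<Rightarrow> ('x::finite \<Rightarrow> 'a) \<Rightarrow> ('x word \<Rightarrow>\<^sub>0 'k) set \<Rightarrow> bool" where
  "presentation A x R \<longleftrightarrow>
     surj (word_eval A x) \<and>
     (\<forall>n. gr A n = word_eval A x ` tensor_deg n) \<and>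
     {p. word_eval A x p = 0} = ideal_generated R \<and>
     finite R \<and> (\<forall>r\<in>R. \<exists>n\<ge>2. r \<in> tensor_deg n) \<and>
     (\<forall>R'. R' \<subset> R \<longrightarrow> ideal_generated R' \<noteq> ideal_generated R)"


section \<open>Graded modules\<close>

text \<open>\<open>\<int>\<close>-graded left modules. The carrier, the direct sum of the components, may be a
  proper subset of the type, and \<open>act\<close> is only meaningful on it.\<close>

record ('a, 'm) grmod =
  act :: "'a \<Rightarrow> 'm \<Rightarrow> 'm"
  hcomp :: "int \<Rightarrow> 'm set"

definition mcarrier :: "('a, 'm::ab_group_add) grmod \<Rightarrow> 'm set" where
  "mcarrier M = {m. \<exists>x. decomposes (hcomp M) x m}"

definition graded_module ::
  "('k::field, 'a::ring_1) gralg \<Rightarrow> ('a, 'm::ab_group_add) grmod \<Rightarrow> bool" where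
  "graded_module A M \<longleftrightarrow>
     (\<forall>k. 0 \<in> hcomp M k \<and> (\<forall>u\<in>hcomp M k. \<forall>v\<in>hcomp M k. u - v \<in> hcomp M k)) \<and>
     (\<forall>m\<in>mcarrier M. \<exists>!x. decomposes (hcomp M) x m) \<and>
     (\<forall>a. \<forall>u\<in>mcarrier M. \<forall>v\<in>mcarrier M. act M a (u + v) = act M a u + act M a v) \<and>
     (\<forall>a b. \<forall>u\<in>mcarrier M. act M (a + b) u = act M a u + act M b u) \<and>
     (\<forall>a b. \<forall>u\<in>mcarrier M. act M (a * b) u = act M a (act M b u)) \<and>
     (\<forall>u\<in>mcarrier M. act M 1 u = u) \<and>
     (\<forall>i k. \<forall>a\<in>gr A i. \<forall>u\<in>hcomp M k. act M a u \<in> hcomp M (int i + k))"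

text \<open>\<open>A\<close>-linear maps that are homogeneous of degree \<open>k\<close>.\<close>

definition gr_hom ::
  "int \<Rightarrow> ('a::ring_1, 'm::ab_group_add) grmod \<Rightarrow> ('a, 'n::ab_group_add) grmod \<Rightarrow>
     ('m \<Rightarrow> 'n) \<Rightarrow> bool" where
  "gr_hom k M N f \<longleftrightarrow>
     (\<forall>u\<in>mcarrier M. \<forall>v\<in>mcarrier M. f (u + v) = f u + f v) \<and>
     (\<forall>a. \<forall>u\<in>mcarrier M. f (act M a u) = act N a (f u)) \<and>
     (\<forall>j. \<forall>u\<in>hcomp M j. f u \<in> hcomp N (j + k))"

definition shift :: "int \<Rightarrow> ('a, 'm) grmod \<Rightarrow> ('a, 'm) grmod" where
  "shift n M = M\<lparr>hcomp := \<lambda>k. hcomp M (n + k)\<rparr>"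

definition regular_module :: "('k::field, 'a::ring_1) gralg \<Rightarrow> ('a, 'a) grmod" where
  "regular_module A =
     \<lparr>act = (\<lambda>a b. a * b), hcomp = (\<lambda>k. if k \<ge> 0 then gr A (nat k) else {0})\<rparr>"

definition trivial_module :: "('k::field, 'a::ring_1) gralg \<Rightarrow> ('a, 'k) grmod" where
  "trivial_module A =
     \<lparr>act = (\<lambda>a c. aug A a * c), hcomp = (\<lambda>k. if k = 0 then UNIV else {0})\<rparr>"

text \<open>\<open>A(-e\<^sub>0) \<oplus> \<dots> \<oplus> A(-e\<^sub>r)\<close> for \<open>es = [e\<^sub>0, \<dots>, e\<^sub>r]\<close>, i.e. the graded free module with one
  basis element in each of the degrees \<open>es\<close>; elements are coordinate vectors, extended by 0.\<close>

definition free_module ::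
  "('k::field, 'a::ring_1) gralg \<Rightarrow> int list \<Rightarrow> ('a, nat \<Rightarrow> 'a) grmod" where
  "free_module A es =
     \<lparr>act = (\<lambda>a f i. a * f i),
      hcomp = (\<lambda>k. {f. (\<forall>i<length es. f i \<in> hcomp (shift (- (es ! i)) (regular_module A)) k) \<and>
                      (\<forall>i\<ge>length es. f i = 0)})\<rparr>"


section \<open>Projective resolutions\<close>

text \<open>A definition cannot quantify over types, so the test modules \<open>M\<close>, \<open>N\<close> below live on the
  type of \<open>P\<close>. This and the definitions after it are used with \<open>'m = nat \<Rightarrow> 'a\<close>. Only the
  additive group of that type matters (the action is part of the record), and as a vector
  space it is so large that it contains, up to isomorphism, every graded module of countable
  dimension (in particular every locally finite one), and a graded free cover of every graded
  module whose carrier lies in it. So nothing is lost by the restriction.\<close>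

definition projective ::
  "('k::field, 'a::ring_1) gralg \<Rightarrow> ('a, 'm::ab_group_add) grmod \<Rightarrow> bool" where
  "projective A P \<longleftrightarrow>
     graded_module A P \<and>
     (\<forall>(M :: ('a, 'm) grmod) (N :: ('a, 'm) grmod) g f.
        graded_module A M \<and> graded_module A N \<and>
        gr_hom 0 M N g \<and> g ` mcarrier M = mcarrier N \<and> gr_hom 0 P N f \<longrightarrow>
        (\<exists>h. gr_hom 0 P M h \<and> (\<forall>p\<in>mcarrier P. g (h p) = f p)))"

text \<open>\<open>\<dots> \<rightarrow> P 1 \<rightarrow> P 0 \<rightarrow> M \<rightarrow> 0\<close> with differentials \<open>d n : P (n + 1) \<rightarrow> P n\<close> and augmentation \<open>e\<close>.\<close>

definition resolution ::
  "('k::field, 'a::ring_1) gralg \<Rightarrow> ('a, 'n::ab_group_add) grmod \<Rightarrow>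
     (nat \<Rightarrow> ('a, 'm::ab_group_add) grmod) \<Rightarrow> (nat \<Rightarrow> 'm \<Rightarrow> 'm) \<Rightarrow> ('m \<Rightarrow> 'n) \<Rightarrow> bool" where
  "resolution A M P d e \<longleftrightarrow>
     (\<forall>n. projective A (P n)) \<and>
     (\<forall>n. gr_hom 0 (P (Suc n)) (P n) (d n)) \<and>
     gr_hom 0 (P 0) M e \<and>
     e ` mcarrier (P 0) = mcarrier M \<and>
     d 0 ` mcarrier (P 1) = {p \<in> mcarrier (P 0). e p = 0} \<and>
     (\<forall>n. d (Suc n) ` mcarrier (P (Suc (Suc n))) = {p \<in> mcarrier (P (Suc n)). d n p = 0})"

text \<open>Minimality: the image of each differential lies in \<open>A\<^sub>+P\<close>.\<close>

definition minimal_resolution ::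
  "('k::field, 'a::ring_1) gralg \<Rightarrow> ('a, 'n::ab_group_add) grmod \<Rightarrow>
     (nat \<Rightarrow> ('a, 'm::ab_group_add) grmod) \<Rightarrow> (nat \<Rightarrow> 'm \<Rightarrow> 'm) \<Rightarrow> ('m \<Rightarrow> 'n) \<Rightarrow> bool" where
  "minimal_resolution A M P d e \<longleftrightarrow>
     resolution A M P d e \<and>
     (\<forall>n. \<forall>p\<in>mcarrier (P (Suc n)).
        \<exists>(r::nat) a q. (\<forall>i<r. a i \<in> pos_part A \<and> q i \<in> mcarrier (P n)) \<and>
                d n p = (\<Sum>i<r. act (P n) (a i) (q i)))"


section \<open>Ext of the trivial module\<close>

text \<open>For a projective resolution \<open>P\<close> of the trivial module, \<open>Ext\<^sup>n(K, N)\<close> in internal degree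
  \<open>k\<close> is the quotient of \<open>cocycles P d N n k\<close> by \<open>coboundaries P d N n k\<close>. Ext does not depend
  on the resolution; the notions below refer to every resolution.\<close>

definition cocycles ::
  "(nat \<Rightarrow> ('a::ring_1, 'm::ab_group_add) grmod) \<Rightarrow> (nat \<Rightarrow> 'm \<Rightarrow> 'm) \<Rightarrow>
     ('a, 'n::ab_group_add) grmod \<Rightarrow> nat \<Rightarrow> int \<Rightarrow> ('m \<Rightarrow> 'n) set" where
  "cocycles P d N n k =
     {f. gr_hom k (P n) N f \<and> (\<forall>p\<in>mcarrier (P (Suc n)). f (d n p) = 0)}"

definition coboundaries ::
  "(nat \<Rightarrow> ('a::ring_1, 'm::ab_group_add) grmod) \<Rightarrow> (nat \<Rightarrow> 'm \<Rightarrow> 'm) \<Rightarrow>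
     ('a, 'n::ab_group_add) grmod \<Rightarrow> nat \<Rightarrow> int \<Rightarrow> ('m \<Rightarrow> 'n) set" where
  "coboundaries P d N n k =
     {f. gr_hom k (P n) N f \<and>
         (case n of
            0 \<Rightarrow> \<forall>p\<in>mcarrier (P 0). f p = 0
          | Suc j \<Rightarrow> \<exists>g. gr_hom k (P j) N g \<and> (\<forall>p\<in>mcarrier (P n). f p = g (d j p)))}"

text \<open>\<open>F i : P (n + i) \<rightarrow> P i\<close> is a chain map of internal degree \<open>k\<close> over a cocycle
  \<open>f : P n \<rightarrow> K\<close>. Composing a cocycle \<open>g : P n' \<rightarrow> K\<close> with \<open>F n'\<close> represents the Yoneda
  product of the classes of \<open>g\<close> and \<open>f\<close>, up to a sign that depends only on conventions.\<close>

definition chain_lift ::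
  "(nat \<Rightarrow> ('a::ring_1, 'm::ab_group_add) grmod) \<Rightarrow> (nat \<Rightarrow> 'm \<Rightarrow> 'm) \<Rightarrow>
     ('m \<Rightarrow> 'k) \<Rightarrow> nat \<Rightarrow> int \<Rightarrow> ('m \<Rightarrow> 'k) \<Rightarrow> (nat \<Rightarrow> 'm \<Rightarrow> 'm) \<Rightarrow> bool" where
  "chain_lift P d e n k f F \<longleftrightarrow>
     (\<forall>i. gr_hom k (P (n + i)) (P i) (F i)) \<and>
     (\<forall>p\<in>mcarrier (P n). e (F 0 p) = f p) \<and>
     (\<forall>i. \<forall>p\<in>mcarrier (P (Suc (n + i))). d i (F (Suc i) p) = F i (d (n + i) p))"

text \<open>The bihomogeneous elements of the subalgebra of \<open>E(A)\<close> generated by \<open>E\<^sup>1(A)\<close> and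
  \<open>E\<^sup>2(A)\<close>: \<open>yoneda_gen A P d e n m f\<close> says that the class of the cocycle \<open>f\<close> in
  \<open>E\<^sup>n\<^sup>,\<^sup>m(A) = Ext\<^sup>n(K, K)\<^sub>-\<^sub>m\<close> lies in it. As the generating spaces are bigraded, so is the
  subalgebra. The augmentation \<open>e\<close> represents the unit.\<close>

inductive yoneda_gen ::
  "('k::field, 'a::ring_1) gralg \<Rightarrow> (nat \<Rightarrow> ('a, 'm::ab_group_add) grmod) \<Rightarrow>
     (nat \<Rightarrow> 'm \<Rightarrow> 'm) \<Rightarrow> ('m \<Rightarrow> 'k) \<Rightarrow> nat \<Rightarrow> int \<Rightarrow> ('m \<Rightarrow> 'k) \<Rightarrow> bool"
  for A P d e where
  unit: "yoneda_gen A P d e 0 0 e"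
| gen: "n \<in> {1, 2} \<Longrightarrow> f \<in> cocycles P d (trivial_module A) n (- m) \<Longrightarrow>
    yoneda_gen A P d e n m f"
| zero: "yoneda_gen A P d e n m (\<lambda>_. 0)"
| add: "yoneda_gen A P d e n m f \<Longrightarrow> yoneda_gen A P d e n m g \<Longrightarrow>
    yoneda_gen A P d e n m (\<lambda>p. f p + g p)"
| scale: "yoneda_gen A P d e n m f \<Longrightarrow> yoneda_gen A P d e n m (\<lambda>p. c * f p)"
| class_eq: "yoneda_gen A P d e n m f \<Longrightarrow>
    f' \<in> cocycles P d (trivial_module A) n (- m) \<Longrightarrow>
    (\<lambda>p. f' p - f p) \<in> coboundaries P d (trivial_module A) n (- m) \<Longrightarrow>
    yoneda_gen A P d e n m f'"
| prod: "yoneda_gen A P d e n m f \<Longrightarrow> yoneda_gen A P d e n' m' g \<Longrightarrow>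
    chain_lift P d e n (- m) f F \<Longrightarrow>
    yoneda_gen A P d e (n + n') (m + m') (\<lambda>p. g (F n' p))"

definition K2_algebra :: "('k::field, 'a::ring_1) gralg \<Rightarrow> bool" where
  "K2_algebra A \<longleftrightarrow>
     (\<forall>(P :: nat \<Rightarrow> ('a, nat \<Rightarrow> 'a) grmod) d e.
        resolution A (trivial_module A) P d e \<longrightarrow>
        (\<forall>n m. \<forall>f\<in>cocycles P d (trivial_module A) n (- m). yoneda_gen A P d e n m f))"


section \<open>Artin--Schelter regularity\<close>

definition global_dim :: "('k::field, 'a::ring_1) gralg \<Rightarrow> enat" where
  "global_dim A = Inf {enat d | d.
     \<forall>M :: ('a, nat \<Rightarrow> 'a) grmod. graded_module A M \<longrightarrow>
       (\<exists>(P :: nat \<Rightarrow> ('a, nat \<Rightarrow> 'a) grmod) \<delta> e.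
          resolution A M P \<delta> e \<and> (\<forall>n>d. mcarrier (P n) = {0}))}"

text \<open>The supremum, over finite-dimensional subspaces spanned by \<open>S\<close>, of the growth exponent of
  the span of all products of at most \<open>n\<close> elements of \<open>S\<close>.\<close>

definition GK_dim :: "('k::field, 'a::ring_1) gralg \<Rightarrow> ereal" where
  "GK_dim A =
     (SUP S\<in>{S. finite S}.
        limsup (\<lambda>n. ereal (ln (real (vector_space.dim (scal A)
            {prod_list xs | xs. set xs \<subseteq> S \<and> length xs \<le> n})) / ln (real n))))"

text \<open>\<open>Ext\<^sup>i(K, A) = 0\<close> for \<open>i \<noteq> d\<close> and \<open>Ext\<^sup>d(K, A) \<cong> K(l)\<close>. The isomorphism of graded right
  modules is given by a map \<open>\<phi>\<close> on homogeneous cocycles with the coboundaries as kernel; the right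
  action on Ext is induced by right multiplication on \<open>A\<close>.\<close>

definition gorenstein_condition :: "('k::field, 'a::ring_1) gralg \<Rightarrow> nat \<Rightarrow> bool" where
  "gorenstein_condition A d \<longleftrightarrow>
     (\<forall>(P :: nat \<Rightarrow> ('a, nat \<Rightarrow> 'a) grmod) \<delta> e.
        resolution A (trivial_module A) P \<delta> e \<longrightarrow>
        (let Z = cocycles P \<delta> (regular_module A); B = coboundaries P \<delta> (regular_module A) in
          (\<forall>i k. i \<noteq> d \<longrightarrow> Z i k \<subseteq> B i k) \<and>
          (\<exists>(l::int) \<phi>. \<forall>k.
             \<phi> ` Z d k = hcomp (shift l (trivial_module A)) k \<and>
             (\<forall>f\<in>Z d k. \<forall>g\<in>Z d k. \<phi> (\<lambda>p. f p + g p) = \<phi> f + \<phi> g) \<and>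
             (\<forall>j. \<forall>a\<in>gr A j. \<forall>f\<in>Z d k. \<phi> (\<lambda>p. f p * a) = \<phi> f * aug A a) \<and>
             (\<forall>f\<in>Z d k. \<phi> f = 0 \<longleftrightarrow> f \<in> B d k))))"

definition AS_regular :: "('k::field, 'a::ring_1) gralg \<Rightarrow> nat \<Rightarrow> bool" where
  "AS_regular A d \<longleftrightarrow>
     global_dim A = enat d \<and> GK_dim A < \<infinity> \<and> gorenstein_condition A d"

end

theory Submission
  imports Defs "HOL-Analysis.Cartesian_Space"
begin

text \<open>
Let \<open>V = A\<^sub>1\<close> and let \<open>R\<^sub>2 \<subseteq> V \<otimes> V\<close> be the space of quadratic relations, of dimension 2. As \<open>E(A)\<close> can
be computed from any projective resolution, with its products (\<open>generation_independent\<close>), it suffices to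
consider the resolution \<open>P\<close>. Its differentials have no scalar entries, so \<open>E\<^sup>n(A)\<close> is dual to the space of
generators of \<open>P n\<close>: there are only \<open>E\<^sup>0\<close>, \<open>E\<^sup>1\<close>, \<open>E\<^sup>2\<close>, a three-dimensional space \<open>E\<^sup>3\<^sup>,\<^sup>4\<close> and a line \<open>E\<^sup>4\<^sup>,\<^sup>5\<close>.
The differential \<open>P 4 \<rightarrow> P 3\<close> is a nonzero row of linear forms, so some product of \<open>E\<^sup>3\<close> with \<open>E\<^sup>1\<close> is nonzero
(\<open>generated_4\<close>). The problem is \<open>E\<^sup>3\<close>.

If the products of \<open>E\<^sup>1\<close> and \<open>E\<^sup>2\<close>, in both orders, did not span \<open>E\<^sup>3\<close>, all of them would vanish on a
nonzero scalar combination \<open>c\<close> of the generators of \<open>P 3\<close> (\<open>no_invisible_syzygy\<close>). By the products in one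
order, the image of \<open>c\<close> in \<open>P 2\<close> has no linear entries: it is \<open>(q, r, 0, 0)\<close> with \<open>q, r \<in> A\<^sub>2\<close>, a syzygy of
a basis \<open>F, G\<close> of \<open>R\<^sub>2\<close>. By those in the other order, for every functional \<open>b\<close> on \<open>V\<close> the contraction
\<open>(1 \<otimes> 1 \<otimes> b) (q \<otimes> F + r \<otimes> G)\<close> lies in the image of \<open>V \<otimes> R\<^sub>2\<close> in \<open>A\<^sub>2 \<otimes> V\<close>; so cubic relations do not contribute
to this syzygy. It remains to show \<open>q = r = 0\<close> (\<open>contracts_trivial\<close>), which is linear algebra in \<open>V \<otimes> V\<close>.

Two ingredients enter. As \<open>P 3\<close> starts in degree 4, \<open>V \<otimes> R\<^sub>2\<close> and \<open>R\<^sub>2 \<otimes> V\<close> meet trivially; in particular,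
\<open>u \<otimes> u \<in> R\<^sub>2\<close> only for \<open>u = 0\<close>. By the Gorenstein condition, the entries \<open>y\<close> of \<open>P 4 \<rightarrow> P 3\<close> form a basis of
\<open>V\<close>, and \<open>y\<close> times the linear part of \<open>P 3 \<rightarrow> P 2\<close> is a basis of \<open>R\<^sub>2\<close>. Hence the combination \<open>c\<close>, whose image
has no linear entries, gives a functional \<open>a \<noteq> 0\<close> with \<open>(a \<otimes> 1) R\<^sub>2 = 0\<close>, and independent combinations of this
kind give independent functionals (\<open>annihilator\<close>). So \<open>R\<^sub>2 \<subseteq> U \<otimes> V\<close> for the plane \<open>U = ker a\<close>. The proof
distinguishes the rank of \<open>1 \<otimes> a\<close> on \<open>R\<^sub>2\<close>. In rank 2, contracting with \<open>a\<close> on both sides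
settles the matter. In rank 1 this argument still works unless \<open>R\<^sub>2\<close> contains a pure tensor of a special shape. In that case
there is a \<open>v \<in> U\<close> with \<open>v\<^sup>2 U = 0\<close> in \<open>A\<close>. In rank 0, \<open>R\<^sub>2 \<subseteq> U \<otimes> U\<close>, and \<open>R\<^sub>2 \<otimes> U\<close> and \<open>U \<otimes> R\<^sub>2\<close> fill
\<open>U \<otimes> U \<otimes> U\<close> because \<open>4 + 4 = 8\<close>; so \<open>U\<^sup>3 = 0\<close> in \<open>A\<close>. In these last two cases the square \<open>v\<^sup>2 \<noteq> 0\<close> of some \<open>v \<in> U\<close>
gives two independent syzygies \<open>(v\<^sup>2, 0, 0, 0)\<close> and \<open>(0, v\<^sup>2, 0, 0)\<close>, hence two functionals like
\<open>a\<close>, and \<open>R\<^sub>2 = z \<otimes> W\<close> for some \<open>z\<close>. This contradicts the shape of the pure tensor in rank 1, and gives \<open>z \<otimes> z \<in> R\<^sub>2\<close>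
in rank 0.
\<close>

section \<open>Contractions of tensors\<close>

text \<open>Vectors over \<open>K\<close> are functions on a finite index type, and a tensor \<open>F \<in> V \<otimes> V\<close> is the matrix of its
coefficients. A functional on \<open>V\<close> is a vector, too; \<open>contr F b\<close> is \<open>(1 \<otimes> b) F\<close> and
\<open>lcontr a F\<close> is \<open>(a \<otimes> 1) F\<close>, both elements of \<open>V\<close>.\<close>

definition dot :: "('i::finite \<Rightarrow> 'k::comm_ring_1) \<Rightarrow> ('i \<Rightarrow> 'k) \<Rightarrow> 'k" where
  "dot a u = (\<Sum>i\<in>UNIV. a i * u i)"

definition contr :: "('j \<Rightarrow> 'i::finite \<Rightarrow> 'k::comm_ring_1) \<Rightarrow> ('i \<Rightarrow> 'k) \<Rightarrow> 'j \<Rightarrow> 'k" where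
  "contr F b = (\<lambda>i. dot (F i) b)"

definition lcontr :: "('i::finite \<Rightarrow> 'k::comm_ring_1) \<Rightarrow> ('i \<Rightarrow> 'j \<Rightarrow> 'k) \<Rightarrow> 'j \<Rightarrow> 'k" where
  "lcontr a F = (\<lambda>k. \<Sum>i\<in>UNIV. a i * F i k)"

definition outer :: "('i \<Rightarrow> 'k::comm_ring_1) \<Rightarrow> ('j \<Rightarrow> 'k) \<Rightarrow> 'i \<Rightarrow> 'j \<Rightarrow> 'k" where
  "outer u w = (\<lambda>i k. u i * w k)"

lemma dot_commute: "dot a u = dot u a"
  by (simp add: dot_def mult.commute)

lemma dot_comb_left: "dot (\<lambda>i. s * a i + t * b i) u = s * dot a u + t * dot b u"
  by (simp add: dot_def algebra_simps sum.distrib sum_distrib_left)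

lemma dot_comb_right: "dot u (\<lambda>i. s * a i + t * b i) = s * dot u a + t * dot u b"
  by (simp add: dot_def algebra_simps sum.distrib sum_distrib_left)

lemma dot_zero [simp]: "dot (\<lambda>_. 0) u = 0" "dot u (\<lambda>_. 0) = 0"
  by (simp_all add: dot_def)

lemma dot_scale: "dot (\<lambda>i. s * a i) u = s * dot a u" "dot u (\<lambda>i. s * a i) = s * dot u a"
  by (simp_all add: dot_def algebra_simps sum_distrib_left)

lemma dot_contr: "dot a (contr F b) = dot (lcontr a F) b"
proof -
  have "dot a (contr F b) = (\<Sum>i\<in>UNIV. \<Sum>k\<in>UNIV. a i * F i k * b k)"
    by (simp add: dot_def contr_def sum_distrib_left mult.assoc)
  also have "\<dots> = (\<Sum>k\<in>UNIV. \<Sum>i\<in>UNIV. a i * F i k * b k)"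
    by (rule sum.swap)
  also have "\<dots> = dot (lcontr a F) b"
    by (simp add: dot_def lcontr_def sum_distrib_right)
  finally show ?thesis .
qed

lemma contr_outer: "contr (outer u w) b = (\<lambda>i. dot w b * u i)"
  by (simp add: contr_def outer_def dot_def sum_distrib_left sum_distrib_right mult.assoc mult.left_commute mult.commute)

lemma lcontr_outer: "lcontr a (outer u w) = (\<lambda>k. dot a u * w k)"
  by (simp add: lcontr_def outer_def dot_def sum_distrib_left sum_distrib_right mult.assoc mult.left_commute mult.commute)

lemma contr_comb: "contr (\<lambda>i k. s * F i k + t * G i k) b = (\<lambda>i. s * contr F b i + t * contr G b i)"
  by (simp add: contr_def dot_comb_left)

lemma lcontr_comb: "lcontr a (\<lambda>i k. s * F i k + t * G i k) = (\<lambda>i. s * lcontr a F i + t * lcontr a G i)"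
  by (simp add: lcontr_def sum.distrib sum_distrib_left algebra_simps)

lemma contr_shear: "contr (\<lambda>i k. F i k + t * G i k) b = (\<lambda>i. contr F b i + t * contr G b i)"
  using contr_comb[of 1 F t G b] by simp

lemma lcontr_shear: "lcontr a (\<lambda>i k. F i k + t * G i k) = (\<lambda>i. lcontr a F i + t * lcontr a G i)"
  using lcontr_comb[of a 1 F t G] by simp

abbreviation (input) col :: "('i \<Rightarrow> 'j \<Rightarrow> 'k) \<Rightarrow> 'j \<Rightarrow> 'i \<Rightarrow> 'k" where
  "col F k \<equiv> \<lambda>i. F i k"

definition unit_vec :: "'i \<Rightarrow> 'i \<Rightarrow> 'k::zero_neq_one" where
  "unit_vec i = (\<lambda>j. if j = i then 1 else 0)"

lemma dot_unit_vec [simp]: "dot u (unit_vec i) = u i" "dot (unit_vec i) u = u i"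
  by (simp_all add: dot_def unit_vec_def if_distrib if_distribR cong: if_cong)

lemma contr_unit_vec: "contr F (unit_vec k) = (\<lambda>i. F i k)"
  by (simp add: contr_def)

text \<open>Dependence of the family \<open>u, w\<close>, not of the set \<open>{u, w}\<close>: equal vectors are dependent.\<close>

definition lindep :: "('i \<Rightarrow> 'k::field) \<Rightarrow> ('i \<Rightarrow> 'k) \<Rightarrow> bool" where
  "lindep u w \<longleftrightarrow> (\<exists>s t. (s, t) \<noteq> (0, 0) \<and> (\<lambda>i. s * u i + t * w i) = (\<lambda>_. 0))"

text \<open>Over an arbitrary field a plane in \<open>K\<^sup>3\<close> can be isotropic, so there are no orthogonal projections; the
cross product still describes the vectors perpendicular to two given ones.\<close>

definition cross :: "(3 \<Rightarrow> 'k::comm_ring_1) \<Rightarrow> (3 \<Rightarrow> 'k) \<Rightarrow> 3 \<Rightarrow> 'k" where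
  "cross v w = (\<lambda>i. if i = 1 then v 2 * w 3 - v 3 * w 2 else
     if i = 2 then v 3 * w 1 - v 1 * w 3 else v 1 * w 2 - v 2 * w 1)"

lemma cross_simps: "cross v w 1 = v 2 * w 3 - v 3 * w 2" "cross v w 2 = v 3 * w 1 - v 1 * w 3"
  "cross v w 3 = v 1 * w 2 - v 2 * w 1"
  by (simp_all add: cross_def)

lemma cross_nonzero:
  fixes v w :: "3 \<Rightarrow> 'k::field"
  assumes "\<not> lindep v w" shows "cross v w \<noteq> (\<lambda>_. 0)"
proof
  assume "cross v w = (\<lambda>_. 0)"
  then have "cross v w 1 = 0" "cross v w 2 = 0" "cross v w 3 = 0" by simp_all
  then have minors: "v i * w j = v j * w i" for i j
    using exhaust_3[of i] exhaust_3[of j] by (auto simp: cross_simps mult.commute)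
  have "lindep v w"
  proof (cases "v = (\<lambda>_. 0)")
    case True
    then show ?thesis unfolding lindep_def by (intro exI[of _ 1] exI[of _ 0]) auto
  next
    case False
    then obtain p where "v p \<noteq> 0" by auto
    moreover have "(\<lambda>i. w p * v i + (- v p) * w i) = (\<lambda>_. 0)" using minors[of _ p] by (auto simp: mult.commute)
    ultimately show ?thesis unfolding lindep_def by (intro exI[of _ "w p"] exI[of _ "- v p"]) auto
  qed
  with assms show False by simp
qed

lemma perp_two_line:
  fixes a b z :: "3 \<Rightarrow> 'k::field"
  assumes "\<not> lindep a b" and "dot a z = 0" "dot b z = 0"
  shows "\<exists>s. z = (\<lambda>i. s * cross a b i)"
proof -
  have az: "a 1 * z 1 + a 2 * z 2 + a 3 * z 3 = 0" and bz: "b 1 * z 1 + b 2 * z 2 + b 3 * z 3 = 0"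
    using assms(2,3) by (simp_all add: dot_def sum_3)
  have "z 1 * cross a b 2 = z 2 * cross a b 1" "z 1 * cross a b 3 = z 3 * cross a b 1"
    "z 2 * cross a b 3 = z 3 * cross a b 2"
    unfolding cross_simps using az bz by algebra+
  then have minors: "z i * cross a b j = z j * cross a b i" for i j
    using exhaust_3[of i] exhaust_3[of j] by (elim disjE) (simp_all add: mult.commute)
  obtain p where p: "cross a b p \<noteq> 0" using cross_nonzero[OF assms(1)] by auto
  have "z i = z p / cross a b p * cross a b i" for i
    using minors[of i p] p by (simp add: nonzero_eq_divide_eq)
  then show ?thesis by (intro exI ext)
qed

text \<open>By Cramer's rule: \<open>cross v w\<close> is proportional to \<open>a\<close>, hence perpendicular to \<open>u\<close>, and this says that
the determinant of \<open>u, v, w\<close> vanishes.\<close>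

lemma perp_span:
  fixes a :: "3 \<Rightarrow> 'k::field"
  assumes a: "a \<noteq> (\<lambda>_. 0)" and v: "dot a v = 0" and w: "dot a w = 0" and vw: "\<not> lindep v w"
    and u: "dot a u = 0"
  shows "\<exists>s t. u = (\<lambda>i. s * v i + t * w i)"
proof -
  obtain s where s: "a = (\<lambda>i. s * cross v w i)"
    using perp_two_line[OF vw, of a] v w by (auto simp: dot_commute)
  have "s \<noteq> 0" using a s by auto
  moreover have "s * dot (cross v w) u = 0" using u unfolding s dot_scale .
  ultimately have det: "cross v w 1 * u 1 + cross v w 2 * u 2 + cross v w 3 * u 3 = 0"
    by (simp add: dot_def sum_3)
  obtain p where p: "cross v w p \<noteq> 0" using cross_nonzero[OF vw] by auto
  have
    "cross v w 1 * u 1 = cross u w 1 * v 1 + cross v u 1 * w 1" "cross v w 1 * u 2 = cross u w 1 * v 2 + cross v u 1 * w 2" "cross v w 1 * u 3 = cross u w 1 * v 3 + cross v u 1 * w 3"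
    "cross v w 2 * u 1 = cross u w 2 * v 1 + cross v u 2 * w 1" "cross v w 2 * u 2 = cross u w 2 * v 2 + cross v u 2 * w 2" "cross v w 2 * u 3 = cross u w 2 * v 3 + cross v u 2 * w 3"
    "cross v w 3 * u 1 = cross u w 3 * v 1 + cross v u 3 * w 1" "cross v w 3 * u 2 = cross u w 3 * v 2 + cross v u 3 * w 2" "cross v w 3 * u 3 = cross u w 3 * v 3 + cross v u 3 * w 3"
    using det unfolding cross_simps by - (algebra | simp add: algebra_simps)+
  then have "cross v w p * u i = cross u w p * v i + cross v u p * w i" for i
    using exhaust_3[of p] exhaust_3[of i] by (elim disjE) simp_all
  then have "u i = (cross u w p / cross v w p) * v i + (cross v u p / cross v w p) * w i" for i
    using p by (simp add: add_divide_distrib[symmetric] nonzero_eq_divide_eq mult.commute)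
  then show ?thesis by (intro exI ext)
qed

lemma perp_basis:
  fixes a :: "3 \<Rightarrow> 'k::field"
  assumes "a \<noteq> (\<lambda>_. 0)"
  obtains u w where "dot a u = 0" "dot a w = 0" "\<not> lindep u w"
proof -
  have basis: "\<exists>u w. dot a u = 0 \<and> dot a w = 0 \<and> \<not> lindep u w"
    if p: "a p \<noteq> 0" and ne: "p \<noteq> q" "p \<noteq> r" "q \<noteq> r" for p q r
  proof (intro exI conjI)
    let ?u = "\<lambda>i. a p * unit_vec q i + (- a q) * unit_vec p i"
    let ?w = "\<lambda>i. a p * unit_vec r i + (- a r) * unit_vec p i"
    show "dot a ?u = 0" "dot a ?w = 0" unfolding dot_comb_right dot_unit_vec by simp_all
    show "\<not> lindep ?u ?w"
    proof
      assume "lindep ?u ?w"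
      then obtain s t where st: "(s, t) \<noteq> (0, 0)" "\<And>i. s * ?u i + t * ?w i = 0" unfolding lindep_def by meson
      show False using st(1) st(2)[of q] st(2)[of r] p ne by (simp add: unit_vec_def)
    qed
  qed
  obtain p where p: "a p \<noteq> 0" using assms by auto
  have "\<exists>u w. dot a u = 0 \<and> dot a w = 0 \<and> \<not> lindep u w"
    using exhaust_3[of p] basis[OF p, of 1 2] basis[OF p, of 1 3] basis[OF p, of 2 3] by auto
  then show ?thesis using that by blast
qed

text \<open>A subspace of \<open>K\<^sup>I\<close> that no nonzero functional annihilates is everything. Induction on \<open>I\<close>: some vector
\<open>s0\<close> in \<open>S\<close> has a nonzero last coordinate, and a functional on the remaining coordinates extends to one
that kills \<open>s0\<close>, so the hypothesis passes to the vectors of \<open>S\<close> with last coordinate 0.\<close>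

lemma coordinates_span:
  fixes S :: "('i \<Rightarrow> 'k::field) set"
  assumes fin: "finite I"
    and add: "\<And>s t. s \<in> S \<Longrightarrow> t \<in> S \<Longrightarrow> (\<lambda>i. s i + t i) \<in> S"
    and scale: "\<And>s c. s \<in> S \<Longrightarrow> (\<lambda>i. c * s i) \<in> S"
    and zero: "(\<lambda>_. 0) \<in> S"
    and perp: "\<And>c. (\<exists>i\<in>I. c i \<noteq> 0) \<Longrightarrow> \<exists>s\<in>S. (\<Sum>i\<in>I. c i * s i) \<noteq> 0"
  shows "\<exists>s\<in>S. \<forall>i\<in>I. s i = t i"
  using fin add scale zero perp
proof (induction I arbitrary: S t)
  case empty
  then show ?case by blast
next
  case (insert n I)
  note sum_insert = sum.insert[OF insert.hyps]
  obtain s0 where s0: "s0 \<in> S" "s0 n \<noteq> 0"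
  proof -
    have "\<exists>s\<in>S. (\<Sum>i\<in>insert n I. (if i = n then 1 else 0) * s i) \<noteq> 0"
      by (rule insert.prems(4)) auto
    then obtain s where "s \<in> S" "(\<Sum>i\<in>insert n I. (if i = n then 1 else 0) * s i) \<noteq> 0" by blast
    moreover have "(\<Sum>i\<in>insert n I. (if i = n then 1 else 0) * s i) = s n"
    proof -
      have "(\<Sum>i\<in>I. (if i = n then 1 else 0) * s i) = 0"
        by (rule sum.neutral) (use insert.hyps in auto)
      then show ?thesis unfolding sum_insert by simp
    qed
    ultimately show ?thesis using that by simp
  qed
  define T where "T = {s \<in> S. s n = 0}"
  have "\<exists>s\<in>T. \<forall>i\<in>I. s i = t i - t n / s0 n * s0 i"
  proof (rule insert.IH)
    show "(\<lambda>i. s i + u i) \<in> T" if "s \<in> T" "u \<in> T" for s u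
      using that insert.prems(1) unfolding T_def by auto
    show "(\<lambda>i. c * s i) \<in> T" if "s \<in> T" for s c using that insert.prems(2) unfolding T_def by auto
    show "(\<lambda>_. 0) \<in> T" using insert.prems(3) unfolding T_def by auto
    fix c :: "'i \<Rightarrow> 'k" assume "\<exists>i\<in>I. c i \<noteq> 0"
    then obtain i where i: "i \<in> I" "c i \<noteq> 0" by blast
    define c' where "c' = c(n := - (\<Sum>i\<in>I. c i * s0 i) / s0 n)"
    have sumc': "(\<Sum>i\<in>I. c' i * s i) = (\<Sum>i\<in>I. c i * s i)" for s :: "'i \<Rightarrow> 'k"
      by (rule sum.cong) (use insert.hyps in \<open>auto simp: c'_def\<close>)
    have "i \<noteq> n" using i insert.hyps by auto
    then have "\<exists>i\<in>insert n I. c' i \<noteq> 0" using i by (intro bexI[of _ i]) (auto simp: c'_def)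
    then obtain s where s: "s \<in> S" "(\<Sum>i\<in>insert n I. c' i * s i) \<noteq> 0"
      using insert.prems(4) by blast
    define u where "u = (\<lambda>i. s i + (- s n / s0 n) * s0 i)"
    have "u \<in> S" unfolding u_def by (rule insert.prems(1)[OF s(1) insert.prems(2)[OF s0(1)]])
    moreover have "u n = 0" using s0(2) by (simp add: u_def)
    moreover have "(\<Sum>i\<in>I. c i * u i) = (\<Sum>i\<in>insert n I. c' i * s i)"
    proof -
      have "(\<Sum>i\<in>I. c i * u i) = (\<Sum>i\<in>I. c i * s i) + (- s n / s0 n) * (\<Sum>i\<in>I. c i * s0 i)"
      proof -
        have "(\<Sum>i\<in>I. c i * (s i + \<kappa> * s0 i)) = (\<Sum>i\<in>I. c i * s i) + \<kappa> * (\<Sum>i\<in>I. c i * s0 i)" for \<kappa>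
          by (simp add: algebra_simps sum.distrib sum_distrib_left)
        then show ?thesis unfolding u_def .
      qed
      also have "\<dots> = (\<Sum>i\<in>insert n I. c' i * s i)"
        unfolding sum_insert sumc' by (simp add: c'_def)
      finally show ?thesis .
    qed
    ultimately show "\<exists>s\<in>T. (\<Sum>i\<in>I. c i * s i) \<noteq> 0"
      using s(2) unfolding T_def by (intro bexI[of _ u]) auto
  qed
  then obtain s where s: "s \<in> S" "s n = 0" "\<And>i. i \<in> I \<Longrightarrow> s i = t i - t n / s0 n * s0 i"
    unfolding T_def by auto
  have "(\<lambda>i. s i + t n / s0 n * s0 i) \<in> S" by (rule insert.prems(1)[OF s(1) insert.prems(2)[OF s0(1)]])
  moreover have "\<forall>i\<in>insert n I. s i + t n / s0 n * s0 i = t i" using s(2,3) s0(2) by auto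
  ultimately show ?case by (intro bexI[of _ "\<lambda>i. s i + t n / s0 n * s0 i"])
qed

section \<open>Two quadratic relations\<close>

text \<open>The scalars of an algebra, as a homomorphism from the field to the centre.\<close>

locale central_hom =
  fixes kap :: "'k::field \<Rightarrow> 'a::ring_1"
  assumes kap_add: "kap (s + t) = kap s + kap t"
    and kap_mult: "kap (s * t) = kap s * kap t"
    and kap_one [simp]: "kap 1 = 1"
    and kap_central: "kap s * y = y * kap s"
begin

lemma kap_zero [simp]: "kap 0 = 0"
  using kap_add[of 0 0] by simp

lemma kap_uminus: "kap (- s) = - kap s"
  using kap_add[of s "- s"] by (simp add: eq_neg_iff_add_eq_0 add.commute)

lemma kap_diff: "kap (s - t) = kap s - kap t"
  using kap_add[of s "- t"] by (simp add: kap_uminus)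

lemma kap_sum: "kap (sum f I) = (\<Sum>i\<in>I. kap (f i))"
  by (induction I rule: infinite_finite_induct) (simp_all add: kap_add)

lemma kap_cancel: "kap s * y = 0 \<longleftrightarrow> s = 0 \<or> y = 0"
proof
  assume eq: "kap s * y = 0"
  show "s = 0 \<or> y = 0"
  proof (cases "s = 0")
    case False
    then have "y = kap (inverse s * s) * y" by simp
    also have "\<dots> = kap (inverse s) * (kap s * y)" by (simp only: kap_mult mult.assoc)
    finally show ?thesis using eq by simp
  qed simp
qed auto

lemma kap_left_commute: "y * (kap s * z) = kap s * (y * z)"
  by (metis kap_central mult.assoc)

end

text \<open>Given elements \<open>x i\<close> of an algebra, \<open>lin\<close> maps \<open>V = K\<^sup>I\<close> to their span and \<open>quad\<close> evaluates tensors in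
\<open>V \<otimes> V\<close>.\<close>

locale generators = central_hom kap for kap :: "'k::field \<Rightarrow> 'a::ring_1" +
  fixes x :: "'i::finite \<Rightarrow> 'a"
begin

definition lin :: "('i \<Rightarrow> 'k) \<Rightarrow> 'a" where
  "lin v = (\<Sum>i\<in>UNIV. kap (v i) * x i)"

definition quad :: "('i \<Rightarrow> 'i \<Rightarrow> 'k) \<Rightarrow> 'a" where
  "quad T = (\<Sum>i\<in>UNIV. \<Sum>l\<in>UNIV. kap (T i l) * (x i * x l))"

lemma lin_comb: "lin (\<lambda>i. s * v i + t * w i) = kap s * lin v + kap t * lin w"
  by (simp add: lin_def kap_add kap_mult sum.distrib sum_distrib_left algebra_simps)

lemma lin_scale: "lin (\<lambda>i. s * v i) = kap s * lin v"
  using lin_comb[of s v 0 v] by simp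

lemma lin_shear: "lin (\<lambda>i. v i + t * w i) = lin v + kap t * lin w"
  using lin_comb[of 1 v t w] by simp

lemma lin_zero [simp]: "lin (\<lambda>_. 0) = 0"
  by (simp add: lin_def)

lemma lin_sum: "lin (\<lambda>i. \<Sum>k\<in>K. c k * v k i) = (\<Sum>k\<in>K. kap (c k) * lin (v k))"
proof (induction K rule: infinite_finite_induct)
  case (insert k K)
  then show ?case using lin_comb[of "c k" "v k" 1] by simp
qed simp_all

lemma lin_contr: "lin (contr F b) = (\<Sum>k\<in>UNIV. kap (b k) * lin (col F k))"
  unfolding lin_sum[symmetric] contr_def dot_def by (simp add: mult.commute)

lemma quad_outer: "quad (outer u w) = lin u * lin w"
proof -
  have eq: "kap (u i) * x i * (kap (w l) * x l) = kap (u i * w l) * (x i * x l)" for i l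
    by (metis kap_central kap_mult mult.assoc)
  show ?thesis by (simp add: quad_def outer_def lin_def sum_product eq)
qed

lemma quad_comb: "quad (\<lambda>i k. s * F i k + t * G i k) = kap s * quad F + kap t * quad G"
  by (simp add: quad_def kap_add kap_mult sum.distrib sum_distrib_left algebra_simps)

end

text \<open>The quadratic relations \<open>R\<^sub>2 = ker quad\<close> have the basis \<open>F, G\<close>. The last assumption says that
\<open>V \<otimes> R\<^sub>2 \<rightarrow> A\<^sub>2 \<otimes> V\<close> is injective; equivalently \<open>V \<otimes> R\<^sub>2\<close> and \<open>R\<^sub>2 \<otimes> V\<close> meet trivially in
\<open>V \<otimes> V \<otimes> V\<close>, that is \<open>Tor\<^sub>3\<^sub>,\<^sub>3(K, K) = 0\<close>.\<close>

locale two_relations = generators kap x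
  for kap :: "'k::field \<Rightarrow> 'a::ring_1" and x :: "'i::finite \<Rightarrow> 'a" +
  fixes F G :: "'i \<Rightarrow> 'i \<Rightarrow> 'k"
  assumes indep: "(\<lambda>i k. s * F i k + t * G i k) = (\<lambda>_ _. 0) \<Longrightarrow> s = 0 \<and> t = 0"
    and relations: "quad T = 0 \<longleftrightarrow> (\<exists>s t. T = (\<lambda>i k. s * F i k + t * G i k))"
    and no_tor33: "(\<And>k. lin v * lin (col F k) + lin w * lin (col G k) = 0) \<Longrightarrow>
      v = (\<lambda>_. 0) \<and> w = (\<lambda>_. 0)"
begin

lemma quad_F: "quad F = 0" and quad_G: "quad G = 0"
proof -
  show "quad F = 0" unfolding relations by (intro exI[of _ 1] exI[of _ 0]) simp
  show "quad G = 0" unfolding relations by (intro exI[of _ 0] exI[of _ 1]) simp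
qed

lemma no_overlap:
  assumes T: "quad T = 0" and v: "\<And>k. lin v * lin (col T k) = 0"
  shows "v = (\<lambda>_. 0) \<or> T = (\<lambda>_ _. 0)"
proof -
  obtain s t where st: "T = (\<lambda>i k. s * F i k + t * G i k)" using T relations by auto
  have "lin (\<lambda>i. s * v i) * lin (col F k) + lin (\<lambda>i. t * v i) * lin (col G k) = 0" for k
    using v[of k] by (simp add: st lin_comb lin_scale algebra_simps kap_left_commute)
  from no_tor33[OF this] have "\<And>i. s * v i = 0" "\<And>i. t * v i = 0" by meson+
  then show ?thesis by (cases "s = 0 \<and> t = 0") (auto simp: st)
qed

text \<open>Otherwise \<open>u \<otimes> u \<otimes> u\<close> would lie in both \<open>V \<otimes> R\<^sub>2\<close> and \<open>R\<^sub>2 \<otimes> V\<close>.\<close>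

lemma no_square:
  assumes "quad (outer u u) = 0"
  shows "u = (\<lambda>_. 0)"
proof -
  have "lin u * lin (\<lambda>i. outer u u i k) = 0" for k
  proof -
    have "lin (\<lambda>i. outer u u i k) = kap (u k) * lin u"
      unfolding outer_def by (simp add: mult.commute[of _ "u k"] lin_scale)
    then show ?thesis using assms by (simp add: kap_left_commute quad_outer)
  qed
  from no_overlap[OF assms this] show ?thesis
    by (auto simp: outer_def fun_eq_iff)
qed

lemma swap_basis: "two_relations kap x G F"
proof unfold_locales
  show "s = 0 \<and> t = 0" if "(\<lambda>i k. s * G i k + t * F i k) = (\<lambda>_ _. 0)" for s t
    using indep[of t s] that by (simp add: add.commute)
  show "quad T = 0 \<longleftrightarrow> (\<exists>s t. T = (\<lambda>i k. s * G i k + t * F i k))" for T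
    unfolding relations by (subst ex_comm) (simp add: add.commute)
  show "v = (\<lambda>_. 0) \<and> w = (\<lambda>_. 0)"
    if "\<And>k. lin v * lin (col G k) + lin w * lin (col F k) = 0" for v w
    using no_tor33[of w v] that by (simp add: add.commute)
qed

lemma shear_basis: "two_relations kap x (\<lambda>i k. F i k + t * G i k) G"
proof unfold_locales
  have combine: "(\<lambda>i k. s * (F i k + t * G i k) + r * G i k) = (\<lambda>i k. s * F i k + (s * t + r) * G i k)" for s r
    by (simp add: algebra_simps)
  show "s = 0 \<and> r = 0" if "(\<lambda>i k. s * (F i k + t * G i k) + r * G i k) = (\<lambda>_ _. 0)" for s r
    using indep[OF that[unfolded combine]] by auto
  show "quad T = 0 \<longleftrightarrow> (\<exists>s r. T = (\<lambda>i k. s * (F i k + t * G i k) + r * G i k))" for T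
  proof
    assume "quad T = 0"
    then obtain s r where T: "T = (\<lambda>i k. s * F i k + r * G i k)" unfolding relations by (elim exE)
    have "T = (\<lambda>i k. s * F i k + (s * t + (r - s * t)) * G i k)" unfolding T by simp
    then show "\<exists>s r. T = (\<lambda>i k. s * (F i k + t * G i k) + r * G i k)" unfolding combine by (intro exI)
  next
    assume "\<exists>s r. T = (\<lambda>i k. s * (F i k + t * G i k) + r * G i k)"
    then show "quad T = 0" unfolding combine relations by (elim exE) (intro exI)
  qed
  show "v = (\<lambda>_. 0) \<and> w = (\<lambda>_. 0)"
    if vw: "\<And>k. lin v * lin (\<lambda>i. F i k + t * G i k) + lin w * lin (col G k) = 0" for v w
  proof -
    have "lin v * lin (col F k) + lin (\<lambda>i. w i + t * v i) * lin (col G k) = 0" for k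
      using vw[of k] by (simp add: lin_shear algebra_simps kap_left_commute)
    from no_tor33[OF this] show ?thesis by (auto simp: fun_eq_iff)
  qed
qed

end

lemma outer_eq_zero: "outer u w = (\<lambda>_ _. 0) \<longleftrightarrow> u = (\<lambda>_. 0) \<or> w = (\<lambda>_. (0::'k::field))"
  by (auto simp: outer_def fun_eq_iff)

lemma lindepI: "(s, t) \<noteq> (0, 0) \<Longrightarrow> (\<And>i. s * u i + t * w i = 0) \<Longrightarrow> lindep u w"
  unfolding lindep_def by blast

lemma not_lindepD:
  assumes "\<not> lindep u w" "\<And>i. s * u i + t * w i = 0"
  shows "s = 0 \<and> t = 0"
proof (rule ccontr)
  assume "\<not> ?thesis"
  then have "(s, t) \<noteq> (0, 0)" by simp
  from lindepI[of s t u w, OF this assms(2)] assms(1) show False by simp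
qed

lemma not_lindep_nonzero:
  assumes "\<not> lindep u w" shows "u \<noteq> (\<lambda>_. 0)" "w \<noteq> (\<lambda>_. 0)"
proof -
  show "u \<noteq> (\<lambda>_. 0)"
  proof
    assume "u = (\<lambda>_. 0)"
    then have "1 * u i + 0 * w i = 0" for i by simp
    from not_lindepD[OF assms this] show False by simp
  qed
  show "w \<noteq> (\<lambda>_. 0)"
  proof
    assume "w = (\<lambda>_. 0)"
    then have "0 * u i + 1 * w i = 0" for i by simp
    from not_lindepD[OF assms this] show False by simp
  qed
qed

lemma outer_if_perp:
  fixes F :: "'i::finite \<Rightarrow> 'i \<Rightarrow> 'k::field"
  assumes g: "g \<noteq> (\<lambda>_. 0)" and perp: "\<And>c. dot c g = 0 \<Longrightarrow> contr F c = (\<lambda>_. 0)"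
  shows "\<exists>h. F = outer h g"
proof -
  obtain p where p: "g p \<noteq> 0" using g by auto
  have "F i k = F i p / g p * g k" for i k
  proof -
    define c where "c = (\<lambda>j. g p * unit_vec k j + (- g k) * unit_vec p j)"
    have eq: "dot z c = g p * z k + (- g k) * z p" for z
      unfolding c_def dot_comb_right dot_unit_vec ..
    have "dot c g = 0" unfolding dot_commute[of c] eq by simp
    from perp[OF this] have "dot (F i) c = 0" by (simp add: contr_def fun_eq_iff)
    then have "g p * F i k = F i p * g k" unfolding eq by (simp add: mult.commute)
    then show ?thesis using p by (simp add: nonzero_eq_divide_eq mult.commute)
  qed
  then show ?thesis unfolding outer_def by (intro exI[of _ "\<lambda>i. F i p / g p"]) blast
qed

context two_relations
begin

text \<open>For each functional \<open>b\<close>, the element \<open>(1 \<otimes> 1 \<otimes> b) (q \<otimes> F + r \<otimes> G)\<close> of \<open>A\<^sub>2 \<otimes> V\<close> is the image of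
\<open>v \<otimes> F + w \<otimes> G \<in> V \<otimes> R\<^sub>2\<close>, for some \<open>v, w\<close>; the functional \<open>c\<close> expresses this equality in \<open>A\<^sub>2 \<otimes> V\<close>
by equalities in \<open>A\<^sub>2\<close>. The rest of this part shows that then \<open>q = r = 0\<close>.\<close>

definition contracts where
  "contracts q r \<longleftrightarrow> (\<forall>b. \<exists>v w. \<forall>c.
     kap (dot c (contr F b)) * q + kap (dot c (contr G b)) * r =
     lin v * lin (contr F c) + lin w * lin (contr G c))"

lemma contractsI:
  assumes "\<And>k. \<exists>v w. \<forall>i. kap (F i k) * q + kap (G i k) * r =
      lin v * lin (col F i) + lin w * lin (col G i)"
  shows "contracts q r"
  unfolding contracts_def
proof
  fix b :: "'i \<Rightarrow> 'k"
  obtain v w where vw: "\<And>k i. kap (F i k) * q + kap (G i k) * r =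
      lin (v k) * lin (col F i) + lin (w k) * lin (col G i)"
    using assms by metis
  have dots: "kap (dot c (contr H b)) * y = (\<Sum>i\<in>UNIV. \<Sum>k\<in>UNIV. kap (c i * b k) * (kap (H i k) * y))" for c H y
    by (simp add: dot_def contr_def sum_distrib_left kap_sum sum_distrib_right kap_mult[symmetric]
        mult.assoc[symmetric]) (simp add: mult.assoc mult.left_commute mult.commute)
  have lins: "lin (\<lambda>i. \<Sum>k\<in>UNIV. b k * z k i) * lin (contr H c) =
      (\<Sum>i\<in>UNIV. \<Sum>k\<in>UNIV. kap (c i * b k) * (lin (z k) * lin (col H i)))" for c H z
    unfolding lin_sum lin_contr sum_product
    by (subst sum.swap, intro sum.cong refl) (metis kap_left_commute kap_mult mult.assoc)
  have "kap (dot c (contr F b)) * q + kap (dot c (contr G b)) * r =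
     lin (\<lambda>i. \<Sum>k\<in>UNIV. b k * v k i) * lin (contr F c) + lin (\<lambda>i. \<Sum>k\<in>UNIV. b k * w k i) * lin (contr G c)" for c
    unfolding dots lins sum.distrib[symmetric] distrib_left[symmetric] vw ..
  then show "\<exists>v w. \<forall>c. kap (dot c (contr F b)) * q + kap (dot c (contr G b)) * r =
     lin v * lin (contr F c) + lin w * lin (contr G c)" by blast
qed

lemma F_nonzero: "F \<noteq> (\<lambda>_ _. 0)" and G_nonzero: "G \<noteq> (\<lambda>_ _. 0)"
  using indep[of 1 0] indep[of 0 1] by auto

lemma tensor_zero:
  assumes "\<And>i k. kap (F i k) * q + kap (G i k) * r = 0"
  shows "q = 0 \<and> r = 0"
proof -
  obtain i k where f: "F i k \<noteq> 0" using F_nonzero by (auto simp: fun_eq_iff)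
  define c where "c = - G i k / F i k"
  have "kap (F i k) * (q - kap c * r) = kap (F i k) * q + kap (G i k) * r"
    using f by (simp add: c_def algebra_simps kap_uminus kap_mult[symmetric] mult.assoc[symmetric])
  then have q: "q = kap c * r" using assms[of i k] f kap_cancel by auto
  have "kap (c * F j l + 1 * G j l) * r = 0" for j l
  proof -
    have "kap (c * F j l + 1 * G j l) * r = kap (F j l * c) * r + kap (G j l) * r"
      by (simp add: kap_add distrib_right mult.commute)
    then show ?thesis using assms[of j l] unfolding q by (simp add: kap_mult mult.assoc)
  qed
  moreover have "(\<lambda>j l. c * F j l + 1 * G j l) \<noteq> (\<lambda>_ _. 0)"
    using indep[of c 1] by auto
  ultimately have "r = 0" unfolding kap_cancel by (auto simp: fun_eq_iff)
  then show ?thesis using q by simp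
qed

text \<open>Take \<open>c = a\<close> in the definition of \<open>contracts\<close>: the left side vanishes, so the tensor
\<open>T = v \<otimes> F a + w \<otimes> G a\<close> is a relation. Contracting \<open>T\<close> with \<open>a\<close> once more gives 0, as \<open>F a\<close> and \<open>G a\<close>
lie in the kernel of \<open>a\<close>; since contraction with \<open>a\<close> is injective on the relations, \<open>T = 0\<close> and
\<open>v = w = 0\<close>.\<close>

lemma rank_two:
  assumes st: "contracts q r" and perp: "lcontr a F = (\<lambda>_. 0)" "lcontr a G = (\<lambda>_. 0)"
    and rank: "\<not> lindep (contr F a) (contr G a)"
  shows "q = 0 \<and> r = 0"
proof -
  have "\<exists>v w. v = (\<lambda>_. 0) \<and> w = (\<lambda>_. 0) \<and> (\<forall>c.
     kap (dot c (contr F b)) * q + kap (dot c (contr G b)) * r =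
     lin v * lin (contr F c) + lin w * lin (contr G c))" for b
  proof -
    obtain v w where vw: "\<And>c. kap (dot c (contr F b)) * q + kap (dot c (contr G b)) * r =
       lin v * lin (contr F c) + lin w * lin (contr G c)"
      using st unfolding contracts_def by metis
    define T where "T = (\<lambda>i k. 1 * outer v (contr F a) i k + 1 * outer w (contr G a) i k)"
    have "quad T = 0"
      unfolding T_def quad_comb quad_outer using vw[of a] by (simp add: dot_contr perp)
    then obtain s t where T: "T = (\<lambda>i k. s * F i k + t * G i k)" unfolding relations by blast
    have "contr T a = (\<lambda>_. 0)"
      unfolding T_def contr_comb contr_outer
      by (simp add: dot_commute[of _ a] dot_contr perp)
    then have "s * contr F a i + t * contr G a i = 0" for i
      unfolding T contr_comb by meson
    from not_lindepD[OF rank this] have "T = (\<lambda>_ _. 0)" using T by simp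
    then have "v i * contr F a k + w i * contr G a k = 0" for i k
      unfolding T_def outer_def fun_eq_iff by simp
    from not_lindepD[OF rank this] show ?thesis using vw by (intro exI[of _ v] exI[of _ w]) auto
  qed
  then have all: "kap (dot c (contr F b)) * q + kap (dot c (contr G b)) * r = 0" for b c
    by fastforce
  show ?thesis
    by (rule tensor_zero) (use all[of "unit_vec _" "unit_vec _"] in \<open>simp add: contr_unit_vec\<close>)
qed

lemma pure_relation:
  assumes F: "contr F a = (\<lambda>_. 0)" and G: "contr G a \<noteq> (\<lambda>_. 0)"
    and quad: "quad (outer v g) = 0" and g: "dot g a = 0"
  shows "\<exists>s. outer v g = (\<lambda>i k. s * F i k)"
proof -
  obtain s t where st: "outer v g = (\<lambda>i k. s * F i k + t * G i k)" using quad relations by blast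
  have "contr (outer v g) a = (\<lambda>i. s * contr F a i + t * contr G a i)"
    unfolding st by (rule contr_comb)
  then have "t * contr G a i = 0" for i by (auto simp: contr_outer g F dest: fun_cong[of _ _ i])
  moreover obtain i where "contr G a i \<noteq> 0" using G by auto
  ultimately have "t = 0" by (metis mult_eq_0_iff)
  with st show ?thesis by auto
qed

lemma no_pure_square:
  assumes "F = outer h (\<lambda>i. s * h i)" shows False
proof -
  have "quad F = kap s * quad (outer h h)"
    unfolding assms quad_outer lin_scale by (simp add: kap_left_commute)
  then have "s = 0 \<or> h = (\<lambda>_. 0)" using quad_F no_square kap_cancel by auto
  then show False using F_nonzero unfolding assms outer_def by auto
qed

text \<open>Choose \<open>c\<close> with \<open>c(g) = 0\<close> and \<open>F c \<noteq> 0\<close>. Then \<open>v \<otimes> F c\<close> is a relation killed by \<open>a\<close> on the right, hence a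
multiple of \<open>F\<close>; if \<open>v \<noteq> 0\<close> then \<open>F c\<close> is a multiple of \<open>v\<close> and \<open>F\<close> one of \<open>v \<otimes> v\<close>.\<close>

lemma rank_one_step:
  assumes F: "contr F a = (\<lambda>_. 0)" and G: "contr G a \<noteq> (\<lambda>_. 0)"
    and perp: "lcontr a F = (\<lambda>_. 0)"
    and eq: "\<And>c. kap (dot c g) * p = lin v * lin (contr F c)"
    and g: "g \<noteq> (\<lambda>_. 0)" and not_pure: "\<And>h. F \<noteq> outer h g"
  shows "p = 0"
proof -
  obtain c where c: "dot c g = 0" "contr F c \<noteq> (\<lambda>_. 0)"
    using outer_if_perp[OF g] not_pure by blast
  have "quad (outer v (contr F c)) = 0" using eq[of c] c by (simp add: quad_outer)
  moreover have "dot (contr F c) a = 0" by (simp add: dot_commute[of _ a] dot_contr perp)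
  ultimately obtain s where s: "outer v (contr F c) = (\<lambda>i k. s * F i k)"
    using pure_relation[OF F G] by blast
  have "v = (\<lambda>_. 0)"
  proof (rule ccontr)
    assume v: "v \<noteq> (\<lambda>_. 0)"
    have "s \<noteq> 0" using s v c(2) outer_eq_zero[of v "contr F c"] by auto
    define D where "D = dot (contr F c) c / s"
    have "contr (outer v (contr F c)) c = (\<lambda>i. s * contr F c i)"
      unfolding s using contr_comb[of s F 0 F c] by simp
    then have "s * contr F c i = dot (contr F c) c * v i" for i
      unfolding contr_outer by metis
    then have mu: "contr F c i = D * v i" for i
      using \<open>s \<noteq> 0\<close> by (metis D_def nonzero_mult_div_cancel_left times_divide_eq_left)
    have "F i k = outer v (\<lambda>i. D / s * v i) i k" for i k
    proof -
      have "s * F i k = v i * (D * v k)" using s unfolding outer_def mu by metis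
      then have "F i k = v i * (D * v k) / s" using \<open>s \<noteq> 0\<close> by (metis nonzero_mult_div_cancel_left)
      then show ?thesis by (simp add: outer_def)
    qed
    then have "F = outer v (\<lambda>i. D / s * v i)" by blast
    then show False by (rule no_pure_square)
  qed
  moreover obtain i where "g i \<noteq> 0" using g by auto
  ultimately show ?thesis using eq[of "unit_vec i"] kap_cancel by simp
qed

end

text \<open>The relations lie in \<open>U \<otimes> V\<close> for the plane \<open>U = ker a\<close>. The last assumption is what remains of the
Gorenstein condition for the argument: if an element \<open>u\<^sup>2\<close> of \<open>A\<^sub>2\<close> multiplies all entries of the relations
to 0, there are two syzygies \<open>(u\<^sup>2, 0)\<close> and \<open>(0, u\<^sup>2)\<close> of the relations, and they provide two independent
functionals like \<open>a\<close>.\<close>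

locale two_relations3 = two_relations kap x F G
  for kap :: "'k::field \<Rightarrow> 'a::ring_1" and x :: "3 \<Rightarrow> 'a" and F G +
  fixes a :: "3 \<Rightarrow> 'k"
  assumes a_nonzero: "a \<noteq> (\<lambda>_. 0)"
    and perp_F: "lcontr a F = (\<lambda>_. 0)" and perp_G: "lcontr a G = (\<lambda>_. 0)"
    and two_annihilators: "lin u * lin u \<noteq> 0 \<Longrightarrow>
      (\<And>k. lin u * lin u * lin (col F k) = 0) \<Longrightarrow> (\<And>k. lin u * lin u * lin (col G k) = 0) \<Longrightarrow>
      \<exists>b c. \<not> lindep b c \<and> lcontr b F = (\<lambda>_. 0) \<and> lcontr b G = (\<lambda>_. 0) \<and>
            lcontr c F = (\<lambda>_. 0) \<and> lcontr c G = (\<lambda>_. 0)"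
begin

text \<open>Two independent functionals on a 3-dimensional space have a line as common kernel.\<close>

lemma left_factor_line:
  assumes "lin u * lin u \<noteq> 0"
    "\<And>k. lin u * lin u * lin (col F k) = 0" "\<And>k. lin u * lin u * lin (col G k) = 0"
  obtains z f g where "F = outer z f" "G = outer z g"
proof -
  obtain b c where bc: "\<not> lindep b c" "lcontr b F = (\<lambda>_. 0)" "lcontr b G = (\<lambda>_. 0)"
      "lcontr c F = (\<lambda>_. 0)" "lcontr c G = (\<lambda>_. 0)"
    using two_annihilators[OF assms] by blast
  define z where "z = cross b c"
  have col: "\<exists>h. H = outer z h" if "lcontr b H = (\<lambda>_. 0)" "lcontr c H = (\<lambda>_. 0)" for H :: "3 \<Rightarrow> 3 \<Rightarrow> 'k"
  proof -
    have "\<exists>s. (\<lambda>i. H i k) = (\<lambda>i. s * z i)" for k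
      unfolding z_def by (rule perp_two_line[OF bc(1)]) (use that in \<open>simp_all add: dot_contr[of _ H "unit_vec k", unfolded contr_unit_vec]\<close>)
    then obtain h where "\<And>k. (\<lambda>i. H i k) = (\<lambda>i. h k * z i)" by metis
    then have "H = outer z h" by (simp add: outer_def fun_eq_iff mult.commute)
    then show ?thesis by blast
  qed
  show ?thesis using col[OF bc(2,4)] col[OF bc(3,5)] that by blast
qed

lemma dot_col: "lcontr b (H :: 3 \<Rightarrow> 3 \<Rightarrow> 'k) = (\<lambda>_. 0) \<Longrightarrow> dot b (contr H c) = 0"
  by (simp add: dot_contr)

lemma columns_comb:
  fixes H :: "3 \<Rightarrow> 3 \<Rightarrow> 'k"
  assumes H: "H = (\<lambda>i k. s k * v i + t k * u i)"
  shows "lin (col H k) = kap (s k) * lin v + kap (t k) * lin u"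
  unfolding H by (rule lin_comb)

lemma split_columns:
  fixes H :: "3 \<Rightarrow> 3 \<Rightarrow> 'k"
  assumes vu: "\<not> lindep v u" "dot a v = 0" "dot a u = 0" and H: "lcontr a H = (\<lambda>_. 0)"
  obtains s t where "H = (\<lambda>i k. s k * v i + t k * u i)"
proof -
  have "\<exists>s t. (\<lambda>i. H i k) = (\<lambda>i. s * v i + t * u i)" for k
    using perp_span[OF a_nonzero vu(2,3,1), of "\<lambda>i. H i k"] dot_col[OF H, of "unit_vec k"]
    by (simp add: contr_unit_vec)
  then obtain s t where "\<And>k. (\<lambda>i. H i k) = (\<lambda>i. s k * v i + t k * u i)" by metis
  then have "H = (\<lambda>i k. s k * v i + t k * u i)" by (simp add: fun_eq_iff)
  then show ?thesis by (rule that)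
qed

text \<open>The vectors \<open>v\<close> and \<open>u\<close> form a basis of the plane \<open>ker a\<close>, because \<open>v \<otimes> v\<close> is not a relation. Modulo
\<open>F\<close>, the other relation has the form \<open>G = s1 v \<otimes> v + u \<otimes> t\<close>, where \<open>s1 \<noteq> 0\<close> since otherwise \<open>v \<otimes> u \<otimes> t\<close>
would be an overlap. Hence \<open>v\<^sup>3\<close> is a multiple of \<open>v u t = 0\<close>, so that \<open>v\<^sup>2\<close> kills the whole plane on the right,
and \<open>F\<close>, \<open>G\<close> have a common left factor. This is absurd, as the left factors include \<open>v\<close> and
\<open>G a = u\<close>.\<close>

lemma pure_relation_contradiction:
  assumes F: "F = outer v u" and u: "contr G a = u" "u \<noteq> (\<lambda>_. 0)"
  shows False
proof -
  have v: "v \<noteq> (\<lambda>_. 0)" using F_nonzero F outer_eq_zero by metis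
  have av: "dot a v = 0"
  proof -
    have "(\<lambda>k. dot a v * u k) = (\<lambda>_. 0)" using perp_F unfolding F lcontr_outer .
    moreover obtain k where "u k \<noteq> 0" using u by auto
    ultimately show ?thesis by (metis mult_eq_0_iff)
  qed
  have au: "dot a u = 0" using dot_col[OF perp_G, of a] u by simp
  have vu: "\<not> lindep v u"
  proof
    assume "lindep v u"
    then obtain s t where st: "(s, t) \<noteq> (0, 0)" "\<And>i. s * v i + t * u i = 0"
      unfolding lindep_def by meson
    obtain i where i: "v i \<noteq> 0" using v by auto
    have "t \<noteq> 0" using st(1) st(2)[of i] i by auto
    have "u k = - s / t * v k" for k
    proof -
      have "t * u k = - s * v k" using st(2)[of k] by (simp add: eq_neg_iff_add_eq_0 add.commute)
      then have "u k = (- s * v k) / t" using \<open>t \<noteq> 0\<close> by (metis nonzero_mult_div_cancel_left)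
      then show ?thesis by simp
    qed
    then have "F = outer v (\<lambda>i. - s / t * v i)" unfolding F by (metis ext)
    then show False by (rule no_pure_square)
  qed
  obtain s t where G: "G = (\<lambda>i k. s k * v i + t k * u i)"
    by (rule split_columns[OF vu av au perp_G])
  have G': "G = (\<lambda>i k. 1 * outer v s i k + 1 * outer u t i k)"
    by (simp add: G outer_def mult.commute)
  have "dot s a * v i + (dot t a - 1) * u i = 0" for i
  proof -
    have "contr G a i = dot s a * v i + dot t a * u i"
      unfolding G' contr_comb contr_outer by simp
    then show ?thesis using u(1) by (simp add: algebra_simps)
  qed
  from not_lindepD[OF vu this] have sa: "dot s a = 0" and ta: "dot t a = 1" by auto
  obtain s1 s2 where s: "s = (\<lambda>i. s1 * v i + s2 * u i)"
    using perp_span[OF a_nonzero av au vu, of s] sa by (auto simp: dot_commute)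
  have vu0: "lin v * lin u = 0" using quad_F unfolding F quad_outer .
  have rel: "kap s1 * (lin v * lin v) + lin u * lin t = 0"
  proof -
    have "lin v * lin s + lin u * lin t = 0"
      using quad_G unfolding G' quad_comb quad_outer by simp
    moreover have "lin v * lin s = kap s1 * (lin v * lin v)"
      unfolding s lin_comb by (simp add: distrib_left kap_left_commute vu0)
    ultimately show ?thesis by simp
  qed
  have t0: "t \<noteq> (\<lambda>_. 0)" using ta by auto
  have s1: "s1 \<noteq> 0"
  proof
    assume "s1 = 0"
    then have "quad (outer u t) = 0" using rel by (simp add: quad_outer)
    moreover have "lin v * lin (\<lambda>i. outer u t i k) = 0" for k
    proof -
      have "lin (\<lambda>i. outer u t i k) = kap (t k) * lin u"
        unfolding outer_def by (simp add: mult.commute[of _ "t k"] lin_scale)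
      then show ?thesis by (simp add: kap_left_commute vu0)
    qed
    ultimately have "v = (\<lambda>_. 0) \<or> outer u t = (\<lambda>_ _. 0)" by (rule no_overlap)
    then show False using v u(2) t0 outer_eq_zero by metis
  qed
  have vvu: "lin v * lin v * lin u = 0" by (simp add: mult.assoc vu0)
  have vvv: "lin v * lin v * lin v = 0"
  proof -
    have "kap s1 * (lin v * lin v * lin v) = lin v * (kap s1 * (lin v * lin v) + lin u * lin t) - (lin v * lin u) * lin t"
      by (simp add: distrib_left kap_left_commute mult.assoc)
    also have "\<dots> = 0" by (simp add: rel vu0)
    finally show ?thesis using s1 kap_cancel by simp
  qed
  have nz: "lin v * lin v \<noteq> 0" using no_square[of v] v by (auto simp: quad_outer)
  have colF: "lin v * lin v * lin (col F k) = 0" for k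
  proof -
    have "lin (col F k) = kap (u k) * lin v"
      unfolding F outer_def by (simp add: mult.commute[of _ "u k"] lin_scale)
    then show ?thesis by (simp add: kap_left_commute vvv)
  qed
  have colG: "lin v * lin v * lin (col G k) = 0" for k
    unfolding columns_comb[OF G] by (simp add: distrib_left kap_left_commute vvv vvu)
  obtain z f g where z: "F = outer z f" "G = outer z g"
    by (rule left_factor_line[OF nz colF colG])
  obtain k where k: "u k \<noteq> 0" using u by auto
  have "v i * u k = z i * f k" for i using F z(1) unfolding outer_def by metis
  then have v': "v i = f k / u k * z i" for i
    using k by (simp add: nonzero_eq_divide_eq mult.commute)
  have u': "u i = dot g a * z i" for i
    using u(1) unfolding z(2) contr_outer by metis
  obtain j where "u j \<noteq> 0" using u by auto
  then have "dot g a \<noteq> 0" using u' by auto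
  have "dot g a * v i + (- (f k / u k)) * u i = 0" for i by (simp add: v' u')
  from not_lindepD[OF vu this] \<open>dot g a \<noteq> 0\<close> show False by simp
qed

text \<open>With \<open>c = a\<close> the definition of \<open>contracts\<close> shows that \<open>w \<otimes> G a\<close> is a relation, hence a multiple of \<open>F\<close>, and so
\<open>w = 0\<close>, for every \<open>b\<close>. What remains is \<open>rank_one_step\<close>: first for \<open>b = a\<close>, where \<open>F\<close> disappears from
the left side, and then for any \<open>b\<close> with \<open>F b \<noteq> 0\<close>.\<close>

lemma rank_one:
  assumes st: "contracts q r" and F: "contr F a = (\<lambda>_. 0)" and G: "contr G a \<noteq> (\<lambda>_. 0)"
  shows "q = 0 \<and> r = 0"
proof -
  have not_pure: "F \<noteq> outer h (contr G a)" for h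
    using pure_relation_contradiction[of h "contr G a"] G by auto
  have au: "dot (contr G a) a = 0" using dot_col[OF perp_G, of a] by (simp add: dot_commute)
  have one: "\<exists>v. \<forall>c. kap (dot c (contr F b)) * q + kap (dot c (contr G b)) * r = lin v * lin (contr F c)" for b
  proof -
    obtain v w where vw: "\<And>c. kap (dot c (contr F b)) * q + kap (dot c (contr G b)) * r =
       lin v * lin (contr F c) + lin w * lin (contr G c)"
      using st unfolding contracts_def by metis
    have "quad (outer w (contr G a)) = 0"
      using vw[of a] by (simp add: quad_outer F dot_col perp_F perp_G)
    from pure_relation[OF F G this au] obtain s where s: "outer w (contr G a) = (\<lambda>i k. s * F i k)" by blast
    have "w = (\<lambda>_. 0)"
    proof (rule ccontr)
      assume w: "w \<noteq> (\<lambda>_. 0)"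
      then have "s \<noteq> 0" using G s outer_eq_zero[of w "contr G a"] by auto
      have "F i k = outer (\<lambda>i. w i / s) (contr G a) i k" for i k
      proof -
        have "s * F i k = w i * contr G a k" using s unfolding outer_def by metis
        then have "F i k = w i * contr G a k / s" using \<open>s \<noteq> 0\<close> by (metis nonzero_mult_div_cancel_left)
        then show ?thesis by (simp add: outer_def)
      qed
      then have "F = outer (\<lambda>i. w i / s) (contr G a)" by blast
      then show False using not_pure by blast
    qed
    then show ?thesis using vw by auto
  qed
  have r: "r = 0"
  proof -
    obtain v where v: "\<And>c. kap (dot c (contr F a)) * q + kap (dot c (contr G a)) * r = lin v * lin (contr F c)"
      using one by blast
    show ?thesis
      by (rule rank_one_step[OF F G perp_F _ G not_pure, of r v]) (use v F in simp)
  qed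
  obtain k where k: "contr F (unit_vec k) \<noteq> (\<lambda>_. 0)"
  proof (rule ccontr)
    assume "\<not> thesis"
    then have "contr F (unit_vec k) = (\<lambda>_. 0)" for k using that by blast
    then have "F = (\<lambda>_ _. 0)" unfolding contr_unit_vec by (simp add: fun_eq_iff)
    with F_nonzero show False by simp
  qed
  define g where "g = contr F (unit_vec k)"
  obtain v where v: "\<And>c. kap (dot c g) * q + kap (dot c (contr G (unit_vec k))) * r = lin v * lin (contr F c)"
    using one unfolding g_def by blast
  have g_not_pure: "F \<noteq> outer h g" for h
  proof
    assume Fh: "F = outer h g"
    have "g i = g k * h i" for i
      using g_def unfolding contr_unit_vec Fh outer_def by (metis mult.commute)
    then have "F = outer h (\<lambda>i. g k * h i)" using Fh by (metis ext)
    then show False by (rule no_pure_square)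
  qed
  have "q = 0"
    by (rule rank_one_step[OF F G perp_F _ _ g_not_pure, of q v]) (use v r k in \<open>simp_all add: g_def\<close>)
  with r show ?thesis by simp
qed

end

context two_relations3
begin

text \<open>All relations lie in \<open>U \<otimes> U\<close> for a plane \<open>U\<close>. The subspaces \<open>R\<^sub>2 \<otimes> U\<close> and \<open>U \<otimes> R\<^sub>2\<close> of \<open>U \<otimes> U \<otimes> U\<close> have
dimension 4 and meet trivially, so they fill this 8-dimensional space, and every product of three
elements of \<open>U\<close> vanishes. The map \<open>\<Psi>\<close> is the sum map \<open>R\<^sub>2 \<otimes> U \<oplus> U \<otimes> R\<^sub>2 \<rightarrow> U \<otimes> U \<otimes> U\<close> in coordinates: an index
\<open>(False, j, t)\<close> stands for \<open>c j \<otimes> u t\<close> and \<open>(True, j, r)\<close> for \<open>u r \<otimes> c j\<close>.\<close>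

lemma cube_zero:
  fixes u :: "bool \<Rightarrow> 3 \<Rightarrow> 'k" and cF cG :: "bool \<Rightarrow> bool \<Rightarrow> 'k"
  assumes u: "\<not> lindep (u False) (u True)"
    and F: "F = (\<lambda>i k. \<Sum>s\<in>UNIV. \<Sum>t\<in>UNIV. cF s t * u s i * u t k)"
    and G: "G = (\<lambda>i k. \<Sum>s\<in>UNIV. \<Sum>t\<in>UNIV. cG s t * u s i * u t k)"
  shows "lin (u r) * lin (u s) * lin (u t) = 0"
proof -
  define c where "c j = (if j then cG else cF)" for j
  define m where "m s = lin (u s)" for s
  have quad: "(\<Sum>s\<in>UNIV. \<Sum>t\<in>UNIV. kap (c j s t) * (m s * m t)) = 0" for j
  proof -
    have eq: "quad (\<lambda>i k. \<Sum>s\<in>UNIV. \<Sum>t\<in>UNIV. d s t * u s i * u t k) =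
        (\<Sum>s\<in>UNIV. \<Sum>t\<in>UNIV. kap (d s t) * (m s * m t))" for d :: "bool \<Rightarrow> bool \<Rightarrow> 'k"
    proof -
      have split: "(\<lambda>i k. \<Sum>s\<in>UNIV. \<Sum>t\<in>UNIV. d s t * u s i * u t k) =
         (\<lambda>i k. 1 * (\<lambda>i k. d False False * outer (u False) (u False) i k + d False True * outer (u False) (u True) i k) i k
          + 1 * (\<lambda>i k. d True False * outer (u True) (u False) i k + d True True * outer (u True) (u True) i k) i k)"
        by (simp add: UNIV_bool outer_def algebra_simps)
      show ?thesis unfolding split quad_comb quad_outer by (simp add: UNIV_bool m_def algebra_simps)
    qed
    show ?thesis using eq[of cF] eq[of cG] quad_F quad_G unfolding F[symmetric] G[symmetric] c_def by simp
  qed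
  define \<Psi> :: "'k ^ (bool \<times> bool \<times> bool) \<Rightarrow> 'k ^ (bool \<times> bool \<times> bool)" where
    "\<Psi> y = (\<chi> p. case p of (r, s, t) \<Rightarrow>
       (\<Sum>j\<in>UNIV. y $ (False, j, t) * c j r s) + (\<Sum>j\<in>UNIV. y $ (True, j, r) * c j s t))" for y
  have \<Psi>: "\<Psi> y $ (r, s, t) =
     (\<Sum>j\<in>UNIV. y $ (False, j, t) * c j r s) + (\<Sum>j\<in>UNIV. y $ (True, j, r) * c j s t)" for y r s t
    by (simp add: \<Psi>_def)
  have lin\<Psi>: "Vector_Spaces.linear (*s) (*s) \<Psi>"
    by unfold_locales (simp_all add: vec_eq_iff \<Psi> UNIV_bool algebra_simps split_paired_all)
  have expand: "(\<Sum>r\<in>UNIV. \<Sum>s\<in>UNIV. kap (\<Psi> y $ (r, s, t)) * (m r * m s)) =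
      (\<Sum>j\<in>UNIV. lin (\<lambda>i. \<Sum>r\<in>UNIV. y $ (True, j, r) * u r i) * (\<Sum>s\<in>UNIV. kap (c j s t) * m s))"
    for y t
  proof -
    have "(\<Sum>r\<in>UNIV. \<Sum>s\<in>UNIV. kap (\<Psi> y $ (r, s, t)) * (m r * m s)) =
       (\<Sum>j\<in>UNIV. kap (y $ (False, j, t)) * (\<Sum>r\<in>UNIV. \<Sum>s\<in>UNIV. kap (c j r s) * (m r * m s)))
      + (\<Sum>r\<in>UNIV. \<Sum>s\<in>UNIV. \<Sum>j\<in>UNIV. kap (y $ (True, j, r)) * (kap (c j s t) * (m r * m s)))"
      by (simp add: \<Psi> UNIV_bool kap_add kap_mult distrib_left distrib_right mult.assoc add.assoc add.commute add.left_commute)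
    also have "\<dots> = (\<Sum>r\<in>UNIV. \<Sum>s\<in>UNIV. \<Sum>j\<in>UNIV. kap (y $ (True, j, r)) * (kap (c j s t) * (m r * m s)))"
      by (simp add: quad)
    also have "\<dots> = (\<Sum>j\<in>UNIV. lin (\<lambda>i. \<Sum>r\<in>UNIV. y $ (True, j, r) * u r i) * (\<Sum>s\<in>UNIV. kap (c j s t) * m s))"
      unfolding lin_sum m_def[symmetric]
      by (simp add: UNIV_bool distrib_left distrib_right kap_left_commute[of "m r" for r] mult.assoc
          add.assoc add.commute add.left_commute)
    finally show ?thesis .
  qed
  have "inj \<Psi>"
    unfolding vec.linear_inj_iff_eq_0[OF lin\<Psi>]
  proof (intro allI impI)
    fix y assume y: "\<Psi> y = 0"
    define v where "v j = (\<lambda>i. \<Sum>r\<in>UNIV. y $ (True, j, r) * u r i)" for j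
    have 0: "(\<Sum>j\<in>UNIV. lin (v j) * (\<Sum>s\<in>UNIV. kap (c j s t) * m s)) = 0" for t
      using expand[of y t] unfolding y v_def by simp
    have cols: "lin (col F k) = (\<Sum>t\<in>UNIV. kap (u t k) * (\<Sum>s\<in>UNIV. kap (cF s t) * m s))"
      "lin (col G k) = (\<Sum>t\<in>UNIV. kap (u t k) * (\<Sum>s\<in>UNIV. kap (cG s t) * m s))" for k
    proof -
      have eq: "lin (\<lambda>i. \<Sum>s\<in>UNIV. \<Sum>t\<in>UNIV. d s t * u s i * u t k) =
         (\<Sum>t\<in>UNIV. kap (u t k) * (\<Sum>s\<in>UNIV. kap (d s t) * m s))" for d :: "bool \<Rightarrow> bool \<Rightarrow> 'k"
      proof -
        have split: "(\<lambda>i. \<Sum>s\<in>UNIV. \<Sum>t\<in>UNIV. d s t * u s i * u t k) =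
          (\<lambda>i. \<Sum>s\<in>UNIV. (\<Sum>t\<in>UNIV. u t k * d s t) * u s i)"
          by (simp add: UNIV_bool algebra_simps)
        show ?thesis unfolding split lin_sum
          by (simp add: m_def UNIV_bool kap_add kap_mult distrib_left distrib_right mult.assoc add.assoc add.commute add.left_commute)
      qed
      show "lin (col F k) = (\<Sum>t\<in>UNIV. kap (u t k) * (\<Sum>s\<in>UNIV. kap (cF s t) * m s))"
        "lin (col G k) = (\<Sum>t\<in>UNIV. kap (u t k) * (\<Sum>s\<in>UNIV. kap (cG s t) * m s))"
        by (subst F G, rule eq)+
    qed
    have "lin (v False) * lin (col F k) + lin (v True) * lin (col G k) =
      (\<Sum>t\<in>UNIV. kap (u t k) * (\<Sum>j\<in>UNIV. lin (v j) * (\<Sum>s\<in>UNIV. kap (c j s t) * m s)))" for k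
      unfolding cols by (simp add: UNIV_bool c_def distrib_left kap_left_commute[of "lin v" for v]
          add.assoc add.commute add.left_commute)
    then have "lin (v False) * lin (col F k) + lin (v True) * lin (col G k) = 0" for k
      by (simp add: 0)
    from no_tor33[OF this] have v0: "v j = (\<lambda>_. 0)" for j by (cases j) auto
    have yT: "y $ (True, j, r) = 0" for j r
    proof -
      have "y $ (True, j, False) * u False i + y $ (True, j, True) * u True i = 0" for i
        using v0[of j] unfolding v_def by (simp add: UNIV_bool fun_eq_iff add.commute)
      from not_lindepD[OF u this] show ?thesis by (cases r) auto
    qed
    have yF: "y $ (False, j, t) = 0" for j t
    proof -
      have cc: "y $ (False, False, t) * cF r s + y $ (False, True, t) * cG r s = 0" for r s
        using \<Psi>[of y r s t] unfolding y by (simp add: yT UNIV_bool c_def add.commute)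
      have "(\<lambda>i k. y $ (False, False, t) * F i k + y $ (False, True, t) * G i k) =
        (\<lambda>i k. \<Sum>r\<in>UNIV. \<Sum>s\<in>UNIV. (y $ (False, False, t) * cF r s + y $ (False, True, t) * cG r s) * u r i * u s k)"
        unfolding F G by (simp add: UNIV_bool algebra_simps)
      also have "\<dots> = (\<lambda>_ _. 0)" unfolding cc by simp
      finally show ?thesis using indep by (cases j) auto
    qed
    show "y = 0"
      unfolding vec_eq_iff
    proof
      fix p :: "bool \<times> bool \<times> bool"
      show "y $ p = 0 $ p" using yT yF by (cases p; cases "fst p") auto
    qed
  qed
  then have "surj \<Psi>" by (rule vec.linear_inj_imp_surj[OF lin\<Psi>])
  then obtain y where y: "\<Psi> y = axis (r, s, t) 1" by (metis surjD)
  have "m r * m s * m t =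
     (\<Sum>t'\<in>UNIV. (\<Sum>r'\<in>UNIV. \<Sum>s'\<in>UNIV. kap (\<Psi> y $ (r', s', t')) * (m r' * m s')) * m t')"
    unfolding y axis_def by (cases r; cases s; cases t) (simp_all add: UNIV_bool)
  also have "\<dots> = (\<Sum>j\<in>UNIV. lin (\<lambda>i. \<Sum>r\<in>UNIV. y $ (True, j, r) * u r i) *
      (\<Sum>s\<in>UNIV. \<Sum>t\<in>UNIV. kap (c j s t) * (m s * m t)))"
    unfolding expand by (simp add: UNIV_bool distrib_left distrib_right mult.assoc add.assoc add.commute add.left_commute)
  also have "\<dots> = 0" by (simp add: quad)
  finally show ?thesis unfolding m_def .
qed

text \<open>By the previous lemma \<open>u\<^sup>2\<close> kills \<open>ker a\<close> for \<open>u \<in> ker a\<close>, so the relations are \<open>z \<otimes> f\<close> and \<open>z \<otimes> g\<close>. Here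
\<open>f\<close>, \<open>g\<close> span \<open>ker a\<close>, which contains \<open>z\<close>; thus \<open>z \<otimes> z\<close> is a relation.\<close>

lemma rank_zero:
  assumes Fa: "contr F a = (\<lambda>_. 0)" and Ga: "contr G a = (\<lambda>_. 0)"
  shows False
proof -
  obtain u1 u2 where uu: "dot a u1 = 0" "dot a u2 = 0" "\<not> lindep u1 u2"
    by (rule perp_basis[OF a_nonzero]) blast
  note uu_span = perp_span[OF a_nonzero uu]
  define u where "u b = (if b then u2 else u1)" for b
  have two_sided: "\<exists>c. H = (\<lambda>i k. \<Sum>s\<in>UNIV. \<Sum>t\<in>UNIV. c s t * u s i * u t k)"
    if H: "lcontr a H = (\<lambda>_. 0)" "contr H a = (\<lambda>_. 0)" for H :: "3 \<Rightarrow> 3 \<Rightarrow> 'k"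
  proof -
    obtain s t where st: "H = (\<lambda>i k. s k * u1 i + t k * u2 i)"
      by (rule split_columns[OF uu(3,1,2) H(1)])
    then have st': "H = (\<lambda>i k. 1 * outer u1 s i k + 1 * outer u2 t i k)"
      by (simp add: outer_def mult.commute)
    have "dot s a * u1 i + dot t a * u2 i = 0" for i
      using H(2) unfolding st' contr_comb contr_outer by (simp add: fun_eq_iff)
    from not_lindepD[OF uu(3) this] have "dot a s = 0" "dot a t = 0" by (simp_all add: dot_commute)
    then obtain s1 s2 t1 t2 where "s = (\<lambda>i. s1 * u1 i + s2 * u2 i)" "t = (\<lambda>i. t1 * u1 i + t2 * u2 i)"
      using uu_span by metis
    then have "H = (\<lambda>i k. \<Sum>r\<in>UNIV. \<Sum>q\<in>UNIV.
       (if r then (if q then t2 else t1) else (if q then s2 else s1)) * u r i * u q k)"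
      unfolding st by (simp add: UNIV_bool u_def algebra_simps)
    then show ?thesis by (intro exI)
  qed
  obtain cF where cF: "F = (\<lambda>i k. \<Sum>s\<in>UNIV. \<Sum>t\<in>UNIV. cF s t * u s i * u t k)"
    using two_sided[OF perp_F Fa] by blast
  obtain cG where cG: "G = (\<lambda>i k. \<Sum>s\<in>UNIV. \<Sum>t\<in>UNIV. cG s t * u s i * u t k)"
    using two_sided[OF perp_G Ga] by blast
  have u: "\<not> lindep (u False) (u True)" using uu(3) by (simp add: u_def)
  note cube = cube_zero[OF u cF cG]
  have nz: "lin u1 * lin u1 \<noteq> 0"
    using no_square[of u1] not_lindep_nonzero(1)[OF uu(3)] by (auto simp: quad_outer)
  have kills: "lin u1 * lin u1 * lin (col H k) = 0" if H: "lcontr a H = (\<lambda>_. 0)"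
    for H :: "3 \<Rightarrow> 3 \<Rightarrow> 'k" and k
  proof -
    obtain s t where st: "H = (\<lambda>i k. s k * u1 i + t k * u2 i)"
      by (rule split_columns[OF uu(3,1,2) H])
    show ?thesis
      unfolding columns_comb[OF st] using cube[of False False False] cube[of False False True]
      by (simp add: u_def distrib_left kap_left_commute)
  qed
  obtain z f g where z: "F = outer z f" "G = outer z g"
    by (rule left_factor_line[OF nz kills[OF perp_F] kills[OF perp_G]])
  have z0: "z \<noteq> (\<lambda>_. 0)" using F_nonzero z(1) outer_eq_zero by metis
  have f0: "f \<noteq> (\<lambda>_. 0)" using F_nonzero z(1) outer_eq_zero by metis
  obtain i where i: "z i \<noteq> 0" using z0 by auto
  have "dot f a * z i = 0" using Fa unfolding z(1) contr_outer by metis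
  then have af: "dot a f = 0" using i by (simp add: dot_commute)
  have "dot g a * z i = 0" using Ga unfolding z(2) contr_outer by metis
  then have ag: "dot a g = 0" using i by (simp add: dot_commute)
  obtain k where k: "f k \<noteq> 0" using f0 by auto
  have "dot a z * f k = 0" using perp_F unfolding z(1) lcontr_outer by metis
  then have az: "dot a z = 0" using k by simp
  have fg: "\<not> lindep f g"
  proof
    assume "lindep f g"
    then obtain s t where st: "(s, t) \<noteq> (0, 0)" "\<And>i. s * f i + t * g i = 0"
      unfolding lindep_def by meson
    have "s * F i k + t * G i k = z i * (s * f k + t * g k)" for i k
      by (simp add: z outer_def algebra_simps)
    then have "(\<lambda>i k. s * F i k + t * G i k) = (\<lambda>_ _. 0)" by (simp add: st(2))
    from indep[OF this] st(1) show False by simp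
  qed
  obtain s t where st: "z = (\<lambda>i. s * f i + t * g i)"
    using perp_span[OF a_nonzero af ag fg az] by blast
  have "z i * z k = s * F i k + t * G i k" for i k
  proof -
    have "z i * z k = z i * (s * f k + t * g k)" using fun_cong[OF st, of k] by simp
    then show ?thesis by (simp add: z outer_def algebra_simps)
  qed
  then have "outer z z = (\<lambda>i k. s * F i k + t * G i k)"
    unfolding outer_def by blast
  then have "quad (outer z z) = 0" unfolding relations by blast
  from no_square[OF this] z0 show False by simp
qed

lemma low_rank:
  assumes "contracts q r" "contr F a = (\<lambda>_. 0)"
  shows "q = 0 \<and> r = 0"
  using rank_zero[OF assms(2)] rank_one[OF assms] by (cases "contr G a = (\<lambda>_. 0)") auto

text \<open>Exchanging \<open>F\<close> and \<open>G\<close>, or adding a multiple of \<open>G\<close> to \<open>F\<close>, turns any dependence between the contractions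
with \<open>a\<close> into \<open>contr F a = 0\<close>.\<close>

lemma swap3: "two_relations3 kap x G F a"
proof -
  interpret N: two_relations kap x G F by (rule swap_basis)
  show ?thesis
    by unfold_locales (use a_nonzero perp_F perp_G two_annihilators in blast)+
qed

lemma shear3: "two_relations3 kap x (\<lambda>i k. F i k + t * G i k) G a"
proof -
  interpret N: two_relations kap x "\<lambda>i k. F i k + t * G i k" G by (rule shear_basis)
  show ?thesis
  proof unfold_locales
    show "lcontr a (\<lambda>i k. F i k + t * G i k) = (\<lambda>_. 0)" by (simp add: lcontr_shear perp_F perp_G)
    fix u assume nz: "lin u * lin u \<noteq> 0"
      and F': "\<And>k. lin u * lin u * lin (\<lambda>i. F i k + t * G i k) = 0"
      and G: "\<And>k. lin u * lin u * lin (col G k) = 0"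
    have "lin u * lin u * lin (col F k) = 0" for k
      using F'[of k] G[of k] by (simp add: lin_shear distrib_left kap_left_commute)
    from two_annihilators[OF nz this G] obtain b c where
      "\<not> lindep b c" "lcontr b F = (\<lambda>_. 0)" "lcontr b G = (\<lambda>_. 0)" "lcontr c F = (\<lambda>_. 0)" "lcontr c G = (\<lambda>_. 0)"
      by (elim exE conjE)
    then show "\<exists>b c. \<not> lindep b c \<and> lcontr b (\<lambda>i k. F i k + t * G i k) = (\<lambda>_. 0) \<and> lcontr b G = (\<lambda>_. 0) \<and>
        lcontr c (\<lambda>i k. F i k + t * G i k) = (\<lambda>_. 0) \<and> lcontr c G = (\<lambda>_. 0)"
      by (intro exI[of _ b] exI[of _ c]) (simp add: lcontr_shear)
  qed (rule a_nonzero perp_G)+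
qed

lemma contracts_swap:
  assumes "contracts q r" shows "two_relations.contracts kap x G F r q"
proof -
  interpret N: two_relations kap x G F by (rule swap_basis)
  show ?thesis
    unfolding N.contracts_def
  proof
    fix b
    obtain v w where vw: "\<And>c. kap (dot c (contr F b)) * q + kap (dot c (contr G b)) * r =
        lin v * lin (contr F c) + lin w * lin (contr G c)"
      using assms unfolding contracts_def by blast
    show "\<exists>v w. \<forall>c. kap (dot c (contr G b)) * r + kap (dot c (contr F b)) * q =
        lin v * lin (contr G c) + lin w * lin (contr F c)"
      by (intro exI[of _ w] exI[of _ v]) (simp add: vw add.commute)
  qed
qed

lemma contracts_shear:
  assumes "contracts q r"
  shows "two_relations.contracts kap x (\<lambda>i k. F i k + t * G i k) G q (r - kap t * q)"
proof -
  interpret N: two_relations kap x "\<lambda>i k. F i k + t * G i k" G by (rule shear_basis)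
  show ?thesis
    unfolding N.contracts_def
  proof
    fix b
    obtain v w where vw: "\<And>c. kap (dot c (contr F b)) * q + kap (dot c (contr G b)) * r =
        lin v * lin (contr F c) + lin w * lin (contr G c)"
      using assms unfolding contracts_def by blast
    have "kap (dot c (contr (\<lambda>i k. F i k + t * G i k) b)) * q + kap (dot c (contr G b)) * (r - kap t * q) =
        lin v * lin (contr (\<lambda>i k. F i k + t * G i k) c) + lin (\<lambda>i. w i + (- t) * v i) * lin (contr G c)" for c
    proof -
      have "dot c (\<lambda>i. contr F b i + t * contr G b i) = dot c (contr F b) + dot c (contr G b) * t"
        using dot_comb_right[of c 1 "contr F b" t] by (simp add: mult.commute)
      then show ?thesis
        using vw[of c]
        by (simp only: contr_shear lin_shear kap_add kap_mult kap_uminus)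
          (simp add: algebra_simps kap_left_commute[of "lin v"])
    qed
    then show "\<exists>v w. \<forall>c. kap (dot c (contr (\<lambda>i k. F i k + t * G i k) b)) * q + kap (dot c (contr G b)) * (r - kap t * q) =
        lin v * lin (contr (\<lambda>i k. F i k + t * G i k) c) + lin w * lin (contr G c)" by blast
  qed
qed

theorem contracts_trivial:
  assumes st: "contracts q r"
  shows "q = 0 \<and> r = 0"
proof (cases "lindep (contr F a) (contr G a)")
  case False
  then show ?thesis using rank_two[OF st perp_F perp_G] by blast
next
  case True
  then obtain s t where s_t: "(s, t) \<noteq> (0, 0)" "\<And>i. s * contr F a i + t * contr G a i = 0"
    unfolding lindep_def by meson
  show ?thesis
  proof (cases "s = 0")
    case True
    then have "contr G a = (\<lambda>_. 0)" using s_t by auto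
    then show ?thesis using two_relations3.low_rank[OF swap3 contracts_swap[OF st]] by blast
  next
    case False
    have "contr F a i + t / s * contr G a i = (s * contr F a i + t * contr G a i) / s" for i
      using False by (simp add: add_divide_distrib)
    then have "contr (\<lambda>i k. F i k + t / s * G i k) a = (\<lambda>_. 0)" unfolding contr_shear s_t(2) by simp
    from two_relations3.low_rank[OF shear3 contracts_shear[OF st] this] show ?thesis by auto
  qed
qed

end

section \<open>Graded modules and projective lifting\<close>

text \<open>In the definition of \<open>decomposes\<close> the sum is over the exact support. Any finite set that
contains the support is more convenient.\<close>

lemma decomposesI:
  assumes "\<And>i. x i \<in> C i" "finite S" "\<And>i. i \<notin> S \<Longrightarrow> x i = 0" "m = (\<Sum>i\<in>S. x i)"
  shows "decomposes C x m"
proof -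
  have sub: "{i. x i \<noteq> 0} \<subseteq> S" using assms(3) by auto
  then have "m = (\<Sum>i | x i \<noteq> 0. x i)"
    unfolding assms(4) using assms(2) by (intro sum.mono_neutral_right) auto
  with sub assms(1,2) show ?thesis unfolding decomposes_def by (auto intro: finite_subset)
qed

lemma decomposesD:
  assumes "decomposes C x m"
  shows "x i \<in> C i" "finite {i. x i \<noteq> 0}" "m = (\<Sum>i | x i \<noteq> 0. x i)"
  using assms unfolding decomposes_def by auto

lemma decomposes_single:
  assumes "\<And>i. 0 \<in> C i" "u \<in> C k"
  shows "decomposes C (\<lambda>i. if i = k then u else 0) u"
  by (rule decomposesI[of _ _ "{k}"]) (use assms in auto)

lemma decomposes_add:
  assumes closed: "\<And>i u v. u \<in> C i \<Longrightarrow> v \<in> C i \<Longrightarrow> u + v \<in> C i"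
    and x: "decomposes C x u" and y: "decomposes C y v"
  shows "decomposes C (\<lambda>i. x i + y i) (u + v)"
proof -
  let ?S = "{i. x i \<noteq> 0} \<union> {i. y i \<noteq> 0}"
  have fin: "finite ?S" using decomposesD(2)[OF x] decomposesD(2)[OF y] by simp
  have "u = sum x ?S"
    by (subst decomposesD(3)[OF x], rule sum.mono_neutral_left[OF fin]) auto
  moreover have "v = sum y ?S"
    by (subst decomposesD(3)[OF y], rule sum.mono_neutral_left[OF fin]) auto
  ultimately show ?thesis
    using fin decomposesD(1)[OF x] decomposesD(1)[OF y]
    by (intro decomposesI[of _ _ ?S]) (auto intro: closed simp: sum.distrib)
qed

lemma graded_hcomp:
  assumes "graded_module A M"
  shows "0 \<in> hcomp M k" "u \<in> hcomp M k \<Longrightarrow> v \<in> hcomp M k \<Longrightarrow> u - v \<in> hcomp M k"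
    "u \<in> hcomp M k \<Longrightarrow> v \<in> hcomp M k \<Longrightarrow> u + v \<in> hcomp M k"
    "u \<in> hcomp M k \<Longrightarrow> - u \<in> hcomp M k"
proof -
  have z: "0 \<in> hcomp M k" for k using assms unfolding graded_module_def by blast
  have d: "u \<in> hcomp M k \<Longrightarrow> v \<in> hcomp M k \<Longrightarrow> u - v \<in> hcomp M k" for u v
    using assms unfolding graded_module_def by blast
  show "0 \<in> hcomp M k" by (rule z)
  show "u \<in> hcomp M k \<Longrightarrow> v \<in> hcomp M k \<Longrightarrow> u - v \<in> hcomp M k" by (rule d)
  have m: "u \<in> hcomp M k \<Longrightarrow> - u \<in> hcomp M k" for u using d[OF z, of u] by simp
  then show "u \<in> hcomp M k \<Longrightarrow> - u \<in> hcomp M k" .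
  show "u \<in> hcomp M k \<Longrightarrow> v \<in> hcomp M k \<Longrightarrow> u + v \<in> hcomp M k"
    using d[of u "- v"] m[of v] by simp
qed

lemma hcomp_carrier: "graded_module A M \<Longrightarrow> u \<in> hcomp M k \<Longrightarrow> u \<in> mcarrier M"
proof -
  assume "graded_module A M" "u \<in> hcomp M k"
  then have "decomposes (hcomp M) (\<lambda>i. if i = k then u else 0) u"
    by (intro decomposes_single graded_hcomp(1))
  then show ?thesis unfolding mcarrier_def by (intro CollectI exI)
qed

lemma mcarrier_zero: "graded_module A M \<Longrightarrow> 0 \<in> mcarrier M"
  by (rule hcomp_carrier[of A M 0 0]) (auto intro: graded_hcomp(1))

lemma mcarrier_add: "graded_module A M \<Longrightarrow> u \<in> mcarrier M \<Longrightarrow> v \<in> mcarrier M \<Longrightarrow> u + v \<in> mcarrier M"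
proof -
  assume M: "graded_module A M" and "u \<in> mcarrier M" "v \<in> mcarrier M"
  then obtain x y where "decomposes (hcomp M) x u" "decomposes (hcomp M) y v" unfolding mcarrier_def by auto
  then have "decomposes (hcomp M) (\<lambda>i. x i + y i) (u + v)"
    by (rule decomposes_add[rotated]) (rule graded_hcomp(3)[OF M])
  then show ?thesis unfolding mcarrier_def by (intro CollectI exI)
qed

lemma mcarrier_sum:
  assumes "graded_module A M" "\<And>i. i \<in> I \<Longrightarrow> f i \<in> mcarrier M"
  shows "sum f I \<in> mcarrier M"
  using assms(2) by (induction I rule: infinite_finite_induct)
    (auto intro: mcarrier_zero[OF assms(1)] mcarrier_add[OF assms(1)])

lemma mcarrier_induct [consumes 2, case_names hom add]:
  assumes gm: "graded_module A M" and m: "m \<in> mcarrier M"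
    and hom: "\<And>k u. u \<in> hcomp M k \<Longrightarrow> Q u"
    and add: "\<And>u v. u \<in> mcarrier M \<Longrightarrow> v \<in> mcarrier M \<Longrightarrow> Q u \<Longrightarrow> Q v \<Longrightarrow> Q (u + v)"
  shows "Q m"
proof -
  obtain x where x: "decomposes (hcomp M) x m" using m unfolding mcarrier_def by blast
  have "Q (sum x S) \<and> sum x S \<in> mcarrier M" if "finite S" for S
    using that
  proof induction
    case empty
    then show ?case using hom[of 0 0] graded_hcomp(1)[OF gm] mcarrier_zero[OF gm] by simp
  next
    case (insert i S)
    have "x i \<in> hcomp M i" using decomposesD(1)[OF x] .
    then show ?case using insert hom add hcomp_carrier[OF gm] mcarrier_add[OF gm] by simp
  qed
  then show ?thesis using decomposesD[OF x] by simp
qed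

lemma mcarrier_uminus:
  assumes "graded_module A M" "u \<in> mcarrier M" shows "- u \<in> mcarrier M"
  using assms
proof (induction rule: mcarrier_induct)
  case (hom k u)
  then show ?case using graded_hcomp(4)[OF assms(1)] hcomp_carrier[OF assms(1)] by blast
next
  case (add u v)
  then show ?case using mcarrier_add[OF assms(1), of "- u" "- v"] by simp
qed

lemma mcarrier_diff:
  "graded_module A M \<Longrightarrow> u \<in> mcarrier M \<Longrightarrow> v \<in> mcarrier M \<Longrightarrow> u - v \<in> mcarrier M"
  using mcarrier_add[of A M u "- v"] mcarrier_uminus[of A M v] by simp

lemma decomposes_unique:
  assumes "graded_module A M" "decomposes (hcomp M) x m" "decomposes (hcomp M) y m"
  shows "x = y"
proof -
  have "m \<in> mcarrier M" using assms(2) unfolding mcarrier_def by blast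
  moreover have "\<forall>m\<in>mcarrier M. \<exists>!x. decomposes (hcomp M) x m"
    using assms(1) unfolding graded_module_def by (elim conjE)
  ultimately show ?thesis using assms(2,3) by auto
qed

lemma act_add:
  "graded_module A M \<Longrightarrow> u \<in> mcarrier M \<Longrightarrow> v \<in> mcarrier M \<Longrightarrow> act M a (u + v) = act M a u + act M a v"
  unfolding graded_module_def by blast

lemma act_zero: "graded_module A M \<Longrightarrow> act M a 0 = 0"
  using act_add[of A M 0 0 a] mcarrier_zero[of A M] by simp

lemma act_diff:
  assumes "graded_module A M" "u \<in> mcarrier M" "v \<in> mcarrier M"
  shows "act M a (u - v) = act M a u - act M a v"
  using act_add[OF assms(1) mcarrier_diff[OF assms] assms(3), of a] by (simp add: eq_diff_eq)

lemma gr_hom_add: "gr_hom k M N f \<Longrightarrow> u \<in> mcarrier M \<Longrightarrow> v \<in> mcarrier M \<Longrightarrow> f (u + v) = f u + f v"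
  and gr_hom_act: "gr_hom k M N f \<Longrightarrow> u \<in> mcarrier M \<Longrightarrow> f (act M a u) = act N a (f u)"
  and gr_hom_deg: "gr_hom k M N f \<Longrightarrow> u \<in> hcomp M j \<Longrightarrow> f u \<in> hcomp N (j + k)"
  unfolding gr_hom_def by blast+

lemma gr_hom_zero:
  assumes "graded_module A M" "gr_hom k M N f" shows "f 0 = 0"
  using gr_hom_add[OF assms(2) mcarrier_zero[OF assms(1)] mcarrier_zero[OF assms(1)]] by simp

lemma gr_hom_diff:
  assumes "graded_module A M" "gr_hom k M N f" "u \<in> mcarrier M" "v \<in> mcarrier M"
  shows "f (u - v) = f u - f v"
  using gr_hom_add[OF assms(2) mcarrier_diff[OF assms(1,3,4)] assms(4)] by (simp add: eq_diff_eq)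

lemma gr_hom_sum:
  assumes "graded_module A M" "gr_hom k M N f" "\<And>i. i \<in> I \<Longrightarrow> g i \<in> mcarrier M"
  shows "f (sum g I) = (\<Sum>i\<in>I. f (g i))"
  using assms(3)
proof (induction I rule: infinite_finite_induct)
  case (insert i I)
  then show ?case using gr_hom_add[OF assms(2), of "g i" "sum g I"] mcarrier_sum[OF assms(1), of I g] by simp
qed (use gr_hom_zero[OF assms(1,2)] in auto)

lemma gr_hom_carrier:
  assumes M: "graded_module A M" and N: "graded_module A N" and f: "gr_hom k M N f" and u: "u \<in> mcarrier M"
  shows "f u \<in> mcarrier N"
  using M u
proof (induction rule: mcarrier_induct)
  case (hom j u)
  then show ?case using gr_hom_deg[OF f] hcomp_carrier[OF N] by blast
next
  case (add u v)
  then show ?case using gr_hom_add[OF f] mcarrier_add[OF N] by simp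
qed

lemma gr_hom_comp:
  assumes M: "graded_module A M" and N: "graded_module A N" and f: "gr_hom k M N f" and g: "gr_hom l N Q g"
  shows "gr_hom (k + l) M Q (\<lambda>p. g (f p))"
  unfolding gr_hom_def
proof (intro conjI ballI allI)
  note c = gr_hom_carrier[OF M N f]
  fix u v assume "u \<in> mcarrier M" "v \<in> mcarrier M"
  then show "g (f (u + v)) = g (f u) + g (f v)" using gr_hom_add[OF f] gr_hom_add[OF g] c by simp
next
  note c = gr_hom_carrier[OF M N f]
  fix a u assume "u \<in> mcarrier M"
  then show "g (f (act M a u)) = act Q a (g (f u))" using gr_hom_act[OF f] gr_hom_act[OF g] c by simp
next
  fix j u assume "u \<in> hcomp M j"
  then show "g (f u) \<in> hcomp Q (j + (k + l))"
    using gr_hom_deg[OF g gr_hom_deg[OF f]] by (simp add: add.assoc)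
qed

lemma gr_hom_minus:
  assumes M: "graded_module A M" and N: "graded_module A N" and f: "gr_hom k M N f" and g: "gr_hom k M N g"
  shows "gr_hom k M N (\<lambda>p. f p - g p)"
  unfolding gr_hom_def
proof (intro conjI ballI allI)
  fix u v assume "u \<in> mcarrier M" "v \<in> mcarrier M"
  then show "f (u + v) - g (u + v) = f u - g u + (f v - g v)"
    using gr_hom_add[OF f] gr_hom_add[OF g] by simp
next
  fix a u assume u: "u \<in> mcarrier M"
  show "f (act M a u) - g (act M a u) = act N a (f u - g u)"
    using gr_hom_act[OF f u] gr_hom_act[OF g u] act_diff[OF N gr_hom_carrier[OF M N f u] gr_hom_carrier[OF M N g u]]
    by simp
next
  fix j u assume "u \<in> hcomp M j"
  then show "f u - g u \<in> hcomp N (j + k)"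
    using gr_hom_deg[OF f] gr_hom_deg[OF g] graded_hcomp(2)[OF N] by blast
qed

lemma gr_hom_const_zero: "graded_module A N \<Longrightarrow> gr_hom k M N (\<lambda>_. 0)"
  unfolding gr_hom_def using act_zero[of A N] graded_hcomp(1)[of A N] by simp

text \<open>Take the component of degree \<open>j\<close> of any preimage.\<close>

lemma homogeneous_preimage:
  assumes M: "graded_module A M" and N: "graded_module A N" and g: "gr_hom 0 M N g"
    and y: "y \<in> hcomp N j" "y \<in> g ` mcarrier M"
  shows "\<exists>m\<in>hcomp M j. g m = y"
proof -
  obtain m where m: "m \<in> mcarrier M" "y = g m" using y(2) by blast
  obtain x where x: "decomposes (hcomp M) x m" using m(1) unfolding mcarrier_def by blast
  have xc: "x i \<in> mcarrier M" for i using decomposesD(1)[OF x] hcomp_carrier[OF M] by blast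
  have "y = (\<Sum>i | x i \<noteq> 0. g (x i))"
    unfolding m(2) by (subst decomposesD(3)[OF x]) (rule gr_hom_sum[OF M g xc])
  then have "decomposes (hcomp N) (\<lambda>i. g (x i)) y"
    using gr_hom_deg[OF g decomposesD(1)[OF x]] decomposesD(2)[OF x] gr_hom_zero[OF M g]
    by (intro decomposesI[of _ _ "{i. x i \<noteq> 0}"]) auto
  moreover have "decomposes (hcomp N) (\<lambda>i. if i = j then y else 0) y"
    by (rule decomposes_single) (use y graded_hcomp(1)[OF N] in auto)
  ultimately have "(\<lambda>i. g (x i)) = (\<lambda>i. if i = j then y else 0)" by (rule decomposes_unique[OF N])
  from fun_cong[OF this, of j] have "g (x j) = y" by simp
  then show ?thesis using decomposesD(1)[OF x] by blast
qed

lemma graded_submodule: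
  assumes N: "graded_module A N" and sub: "\<And>j. C j \<subseteq> hcomp N j" and zero: "\<And>j. 0 \<in> C j"
    and diff: "\<And>j u v. u \<in> C j \<Longrightarrow> v \<in> C j \<Longrightarrow> u - v \<in> C j"
    and act: "\<And>i j a u. a \<in> gr A i \<Longrightarrow> u \<in> C j \<Longrightarrow> act N a u \<in> C (int i + j)"
  shows "graded_module A (N\<lparr>hcomp := C\<rparr>)"
proof -
  have dec: "decomposes (hcomp N) x m" if "decomposes C x m" for x m
    using that sub unfolding decomposes_def by blast
  then have car: "m \<in> mcarrier N" if "m \<in> mcarrier (N\<lparr>hcomp := C\<rparr>)" for m
    using that unfolding mcarrier_def by auto
  have uniq: "\<exists>!x. decomposes C x m" if "m \<in> mcarrier (N\<lparr>hcomp := C\<rparr>)" for m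
  proof (rule ex_ex1I)
    show "\<exists>x. decomposes C x m" using that unfolding mcarrier_def by simp
    show "x = y" if "decomposes C x m" "decomposes C y m" for x y
      by (rule decomposes_unique[OF N dec dec]) (rule that)+
  qed
  show ?thesis
    using N zero diff act uniq car unfolding graded_module_def by simp
qed

lemma decomposes_shift:
  fixes x :: "int \<Rightarrow> 'm::ab_group_add"
  assumes "decomposes C x m" shows "decomposes (\<lambda>k. C (n + k)) (\<lambda>k. x (n + k)) m"
proof -
  have inj: "inj_on (\<lambda>i. i - n) S" for S by (auto simp: inj_on_def)
  show ?thesis
  proof (rule decomposesI[of _ _ "(\<lambda>i. i - n) ` {i. x i \<noteq> 0}"])
    show "x (n + i) \<in> C (n + i)" for i using decomposesD(1)[OF assms] .
    show "finite ((\<lambda>i. i - n) ` {i. x i \<noteq> 0})" using decomposesD(2)[OF assms] by simp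
    show "x (n + i) = 0" if "i \<notin> (\<lambda>i. i - n) ` {i. x i \<noteq> 0}" for i
      using that by (force simp: image_iff)
    show "m = (\<Sum>i\<in>(\<lambda>i. i - n) ` {i. x i \<noteq> 0}. x (n + i))"
      using decomposesD(3)[OF assms] by (simp add: sum.reindex[OF inj])
  qed
qed

lemma decomposes_shift_iff:
  fixes x :: "int \<Rightarrow> 'm::ab_group_add"
  shows "decomposes (\<lambda>k. C (n + k)) x m \<longleftrightarrow> decomposes C (\<lambda>k. x (k - n)) m"
  using decomposes_shift[of "\<lambda>k. C (n + k)" x m "- n"] decomposes_shift[of C "\<lambda>k. x (k - n)" m n]
  by (auto simp: algebra_simps)

lemma mcarrier_shift: "mcarrier (shift n M) = mcarrier M"
proof -
  have "(\<exists>x. decomposes (\<lambda>k. hcomp M (n + k)) x m) \<longleftrightarrow> (\<exists>x. decomposes (hcomp M) x m)" for m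
    using decomposes_shift_iff[of "hcomp M" n _ m] decomposes_shift[of "hcomp M" _ m n] by blast
  then show ?thesis unfolding mcarrier_def shift_def by simp
qed

lemma graded_shift:
  assumes "graded_module A M" shows "graded_module A (shift n M)"
proof -
  have uniq: "\<exists>!x. decomposes (\<lambda>k. hcomp M (n + k)) x m" if m: "m \<in> mcarrier M" for m
  proof (rule ex_ex1I)
    show "\<exists>x. decomposes (\<lambda>k. hcomp M (n + k)) x m"
      using m decomposes_shift unfolding mcarrier_def by blast
    fix x y assume "decomposes (\<lambda>k. hcomp M (n + k)) x m" "decomposes (\<lambda>k. hcomp M (n + k)) y m"
    then have "(\<lambda>k. x (k - n)) = (\<lambda>k. y (k - n))"
      unfolding decomposes_shift_iff by (rule decomposes_unique[OF assms])
    then have "x (k + n - n) = y (k + n - n)" for k by meson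
    then show "x = y" by auto
  qed
  show ?thesis
    unfolding graded_module_def mcarrier_shift
  proof (intro conjI)
    show "\<forall>i k. \<forall>a\<in>gr A i. \<forall>u\<in>hcomp (shift n M) k. act (shift n M) a u \<in> hcomp (shift n M) (int i + k)"
    proof (intro allI ballI)
      fix i k a u assume "a \<in> gr A i" "u \<in> hcomp (shift n M) k"
      then have "act M a u \<in> hcomp M (int i + (n + k))"
        using assms unfolding graded_module_def shift_def by simp
      then show "act (shift n M) a u \<in> hcomp (shift n M) (int i + k)"
        unfolding shift_def by (simp add: add.left_commute)
    qed
  qed (use assms uniq in \<open>auto simp: graded_module_def shift_def\<close>)
qed

lemma projectiveD:
  fixes P M N :: "('a::ring_1, 'm::ab_group_add) grmod" and A :: "('k::field, 'a) gralg"
  assumes "projective A P" "graded_module A M" "graded_module A N" "gr_hom 0 M N g"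
    "g ` mcarrier M = mcarrier N" "gr_hom 0 P N f"
  shows "\<exists>h. gr_hom 0 P M h \<and> (\<forall>p\<in>mcarrier P. g (h p) = f p)"
  using assms unfolding projective_def by blast

text \<open>Projectivity speaks of maps of degree 0 onto the whole target. Shifting both modules reduces a
map of degree \<open>k\<close> to this case, and the target is replaced by the image of \<open>g\<close>, a graded submodule
in which \<open>f\<close> takes its values.\<close>

lemma projective_lift:
  fixes Q M N :: "('a::ring_1, 'm::ab_group_add) grmod" and A :: "('k::field, 'a) gralg"
  assumes Q: "projective A Q" and M: "graded_module A M" and N: "graded_module A N"
    and f: "gr_hom k Q N f" and g: "gr_hom 0 M N g"
    and im: "\<And>p. p \<in> mcarrier Q \<Longrightarrow> f p \<in> g ` mcarrier M"
  shows "\<exists>h. gr_hom k Q M h \<and> (\<forall>p\<in>mcarrier Q. g (h p) = f p)"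
proof -
  have Qg: "graded_module A Q" using Q unfolding projective_def by blast
  define I where "I = N\<lparr>hcomp := \<lambda>j. g ` hcomp M j\<rparr>"
  have gI: "graded_module A I"
    unfolding I_def
  proof (rule graded_submodule[OF N])
    show "g ` hcomp M j \<subseteq> hcomp N j" for j using gr_hom_deg[OF g] by auto
    show "0 \<in> g ` hcomp M j" for j
      using gr_hom_zero[OF M g] graded_hcomp(1)[OF M] by force
    show "u - v \<in> g ` hcomp M j" if uv: "u \<in> g ` hcomp M j" "v \<in> g ` hcomp M j" for u v j
    proof -
      obtain u' v' where "u' \<in> hcomp M j" "v' \<in> hcomp M j" "u = g u'" "v = g v'" using uv by blast
      then show ?thesis
        using gr_hom_diff[OF M g, of u' v'] graded_hcomp(2)[OF M, of u' j v'] hcomp_carrier[OF M] by force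
    qed
    show "act N a u \<in> g ` hcomp M (int i + j)" if a: "a \<in> gr A i" and u: "u \<in> g ` hcomp M j" for a u i j
    proof -
      obtain u' where u': "u' \<in> hcomp M j" "u = g u'" using u by blast
      then have "act M a u' \<in> hcomp M (int i + j)" using M a unfolding graded_module_def by blast
      moreover have "act N a u = g (act M a u')" using gr_hom_act[OF g hcomp_carrier[OF M u'(1)]] u'(2) by simp
      ultimately show ?thesis by blast
    qed
  qed
  have cI: "mcarrier I = g ` mcarrier M"
  proof
    show "g ` mcarrier M \<subseteq> mcarrier I"
    proof
      fix y assume "y \<in> g ` mcarrier M"
      then obtain m where m: "m \<in> mcarrier M" "y = g m" by blast
      have "g m \<in> mcarrier I" using M m(1)
      proof (induction rule: mcarrier_induct)
        case (hom j u)
        then show ?case by (intro hcomp_carrier[OF gI, of _ j]) (auto simp: I_def)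
      next
        case (add u v)
        then show ?case using gr_hom_add[OF g] mcarrier_add[OF gI] by simp
      qed
      then show "y \<in> mcarrier I" using m by simp
    qed
    show "mcarrier I \<subseteq> g ` mcarrier M"
    proof
      fix y assume "y \<in> mcarrier I"
      with gI show "y \<in> g ` mcarrier M"
      proof (induction rule: mcarrier_induct)
        case (hom j u)
        then show ?case using hcomp_carrier[OF M] by (auto simp: I_def)
      next
        case (add u v)
        then obtain u' v' where "u' \<in> mcarrier M" "v' \<in> mcarrier M" "u = g u'" "v = g v'" by blast
        then show ?case using gr_hom_add[OF g, of u' v'] mcarrier_add[OF M, of u' v'] by force
      qed
    qed
  qed
  have fI: "gr_hom 0 Q (shift k I) f"
    unfolding gr_hom_def
  proof (intro conjI ballI allI)
    fix j u assume u: "u \<in> hcomp Q j"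
    have "f u \<in> hcomp N (j + k)" by (rule gr_hom_deg[OF f u])
    then have "\<exists>m\<in>hcomp M (j + k). g m = f u"
      by (rule homogeneous_preimage[OF M N g]) (use im hcomp_carrier[OF Qg u] in auto)
    then have "f u \<in> g ` hcomp M (k + j)" by (force simp: add.commute)
    then show "f u \<in> hcomp (shift k I) (j + 0)" by (simp add: shift_def I_def)
  qed (use gr_hom_add[OF f] gr_hom_act[OF f] in \<open>auto simp: shift_def I_def\<close>)
  have gS: "gr_hom 0 (shift k M) (shift k I) g"
    unfolding gr_hom_def mcarrier_shift
    using gr_hom_add[OF g] gr_hom_act[OF g] by (auto simp: shift_def I_def)
  have "\<exists>h. gr_hom 0 Q (shift k M) h \<and> (\<forall>p\<in>mcarrier Q. g (h p) = f p)"
    by (rule projectiveD[OF Q graded_shift[OF M] graded_shift[OF gI] gS _ fI])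
      (simp add: mcarrier_shift cI)
  moreover have "gr_hom k Q M h" if "gr_hom 0 Q (shift k M) h" for h
    using that unfolding gr_hom_def shift_def by (simp add: add.commute)
  ultimately show ?thesis by blast
qed

section \<open>Connected graded algebras and the trivial module\<close>

locale connected_algebra =
  fixes A :: "('k::field, 'a::ring_1) gralg"
  assumes alg: "connected_graded_algebra A"
begin

definition kap :: "'k \<Rightarrow> 'a" where "kap c = scal A c 1"

lemma vector_space: "vector_space (scal A)"
  using alg unfolding connected_graded_algebra_def by blast

lemma scal_kap: "scal A c a = kap c * a"
proof -
  have "scal A c (1 * a) = scal A c 1 * a" using alg unfolding connected_graded_algebra_def by blast
  then show ?thesis by (simp add: kap_def)
qed

sublocale central_hom kap
proof
  interpret vector_space "scal A" by (rule vector_space)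
  show "kap (s + t) = kap s + kap t" for s t unfolding kap_def by (rule scale_left_distrib)
  show "kap (s * t) = kap s * kap t" for s t
    unfolding scal_kap[symmetric] by (simp add: kap_def)
  show "kap 1 = 1" unfolding kap_def by simp
  show "kap s * y = y * kap s" for s y
  proof -
    have "scal A s (y * 1) = y * scal A s 1" using alg unfolding connected_graded_algebra_def by blast
    then show ?thesis by (simp add: scal_kap)
  qed
qed

lemma gr_subspace: "module.subspace (scal A) (gr A n)"
  using alg unfolding connected_graded_algebra_def by blast

lemma gr_zero: "0 \<in> gr A n" and gr_add: "a \<in> gr A n \<Longrightarrow> b \<in> gr A n \<Longrightarrow> a + b \<in> gr A n"
  and gr_diff: "a \<in> gr A n \<Longrightarrow> b \<in> gr A n \<Longrightarrow> a - b \<in> gr A n"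
  and gr_kap: "a \<in> gr A n \<Longrightarrow> kap c * a \<in> gr A n"
proof -
  interpret vector_space "scal A" by (rule vector_space)
  show "0 \<in> gr A n" by (rule subspace_0[OF gr_subspace])
  show "a \<in> gr A n \<Longrightarrow> b \<in> gr A n \<Longrightarrow> a + b \<in> gr A n" by (rule subspace_add[OF gr_subspace])
  show "a \<in> gr A n \<Longrightarrow> b \<in> gr A n \<Longrightarrow> a - b \<in> gr A n" by (rule subspace_diff[OF gr_subspace])
  show "a \<in> gr A n \<Longrightarrow> kap c * a \<in> gr A n"
    unfolding scal_kap[symmetric] by (rule subspace_scale[OF gr_subspace])
qed

lemma gr_sum: "(\<And>i. i \<in> I \<Longrightarrow> f i \<in> gr A n) \<Longrightarrow> sum f I \<in> gr A n"
  by (induction I rule: infinite_finite_induct) (auto intro: gr_zero gr_add)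

lemma gr_mult: "a \<in> gr A i \<Longrightarrow> b \<in> gr A j \<Longrightarrow> a * b \<in> gr A (i + j)"
  using alg unfolding connected_graded_algebra_def by blast

lemma gr_0: "gr A 0 = range kap"
proof -
  have "gr A 0 = range (\<lambda>c. scal A c 1)" using alg unfolding connected_graded_algebra_def by blast
  then show ?thesis by (simp add: kap_def)
qed

lemma decompose: "\<exists>!x. decomposes (gr A) x a"
  using alg unfolding connected_graded_algebra_def by blast

lemma decompose_unique: "decomposes (gr A) x a \<Longrightarrow> decomposes (gr A) y a \<Longrightarrow> x = y"
  using decompose by blast

lemma gr_decomposes: "a \<in> gr A n \<Longrightarrow> decomposes (gr A) (\<lambda>i. if i = n then a else 0) a"
  by (rule decomposes_single) (auto intro: gr_zero)

lemma pos_partI: "decomposes (gr A) x a \<Longrightarrow> x 0 = 0 \<Longrightarrow> a \<in> pos_part A"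
  unfolding pos_part_def by blast

lemma pos_part_gr: "a \<in> gr A n \<Longrightarrow> n > 0 \<Longrightarrow> a \<in> pos_part A"
  by (rule pos_partI[OF gr_decomposes]) auto

lemma pos_part_add:
  assumes "a \<in> pos_part A" "b \<in> pos_part A" shows "a + b \<in> pos_part A"
proof -
  obtain x y where x: "decomposes (gr A) x a" "x 0 = 0" and y: "decomposes (gr A) y b" "y 0 = 0"
    using assms unfolding pos_part_def by auto
  have "decomposes (gr A) (\<lambda>i. x i + y i) (a + b)"
    by (rule decomposes_add[OF gr_add x(1) y(1)])
  then show ?thesis by (rule pos_partI) (simp add: x(2) y(2))
qed

lemma pos_part_zero: "0 \<in> pos_part A"
  using pos_part_gr[OF gr_zero, of 1] by simp

lemma pos_part_sum: "(\<And>i. i \<in> I \<Longrightarrow> f i \<in> pos_part A) \<Longrightarrow> sum f I \<in> pos_part A"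
  by (induction I rule: infinite_finite_induct) (auto intro: pos_part_add pos_part_zero)

lemma pos_part_induct_sum:
  assumes "a \<in> pos_part A"
  obtains x S where "finite S" "\<And>i. i \<in> S \<Longrightarrow> x i \<in> gr A i \<and> i > 0" "a = sum x S"
proof -
  obtain x where x: "decomposes (gr A) x a" "x 0 = 0" using assms unfolding pos_part_def by auto
  show ?thesis
  proof (rule that[of "{i. x i \<noteq> 0}" x])
    fix i assume i: "i \<in> {i. x i \<noteq> 0}"
    then have "i \<noteq> 0" using x(2) by (intro notI) simp
    then show "x i \<in> gr A i \<and> i > 0" using decomposesD(1)[OF x(1)] by simp
  qed (use decomposesD[OF x(1)] in auto)
qed

text \<open>The augmentation ideal is two-sided; hence \<open>aug\<close> is multiplicative.\<close>

lemma pos_part_mult: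
  assumes "b \<in> pos_part A" shows "a * b \<in> pos_part A" "b * a \<in> pos_part A"
proof -
  obtain y where y: "decomposes (gr A) y a" using decompose by blast
  obtain x S where x: "finite S" "\<And>i. i \<in> S \<Longrightarrow> x i \<in> gr A i \<and> i > 0" "b = sum x S"
    by (rule pos_part_induct_sum[OF assms]) blast
  have y': "a = sum y {i. y i \<noteq> 0}" "\<And>i. y i \<in> gr A i" using decomposesD[OF y] by auto
  show "a * b \<in> pos_part A"
    unfolding x(3) by (subst y'(1), unfold sum_product)
      (intro pos_part_sum pos_part_gr[OF gr_mult[OF y'(2)]], use x(2) in auto)
  show "b * a \<in> pos_part A"
    unfolding x(3) by (subst y'(1), unfold sum_product)
      (intro pos_part_sum pos_part_gr[OF gr_mult[OF _ y'(2)]], use x(2) in auto)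
qed

lemma pos_part_kap: "kap c \<in> pos_part A \<Longrightarrow> c = 0"
proof -
  assume "kap c \<in> pos_part A"
  then obtain x where x: "decomposes (gr A) x (kap c)" "x 0 = 0" unfolding pos_part_def by auto
  have "kap c \<in> gr A 0" by (simp add: gr_0)
  from decompose_unique[OF x(1) gr_decomposes[OF this]] x(2) have "kap c = 0" by (metis (full_types))
  then show "c = 0" using kap_cancel[of c 1] by simp
qed

lemma augI:
  assumes "a - kap c \<in> pos_part A" shows "aug A a = c"
  unfolding aug_def kap_def[symmetric]
proof (rule the_equality[where P = "\<lambda>c. a - kap c \<in> pos_part A", OF assms])
  fix c' assume "a - kap c' \<in> pos_part A"
  then have "- 1 * (a - kap c') + (a - kap c) \<in> pos_part A"
    using assms by (intro pos_part_add pos_part_mult)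
  then have "kap (c' - c) \<in> pos_part A" by (simp add: kap_diff)
  from pos_part_kap[OF this] show "c' = c" by simp
qed

lemma aug_pos: "a - kap (aug A a) \<in> pos_part A"
proof -
  obtain x where x: "decomposes (gr A) x a" using decompose by blast
  obtain c where c: "x 0 = kap c" using decomposesD(1)[OF x, of 0] gr_0 by auto
  have "decomposes (gr A) (\<lambda>i. x i + (if i = 0 then - kap c else 0)) (a + - kap c)"
  proof (rule decomposes_add[OF gr_add x])
    have "- kap c \<in> gr A 0" using gr_0 kap_uminus[of c] by (metis rangeI)
    then show "decomposes (gr A) (\<lambda>i. if i = 0 then - kap c else 0) (- kap c)" by (rule gr_decomposes)
  qed
  then have "a + - kap c \<in> pos_part A" by (rule pos_partI) (simp add: c)
  then have "a - kap c \<in> pos_part A" by simp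
  moreover from augI[OF this] have "aug A a = c" .
  ultimately show ?thesis by simp
qed

lemma aug_kap [simp]: "aug A (kap c) = c"
  by (rule augI) (simp add: pos_part_zero)

lemma aug_zero [simp]: "aug A 0 = 0" and aug_one [simp]: "aug A 1 = 1"
  using aug_kap[of 0] aug_kap[of 1] by simp_all

lemma aug_add: "aug A (a + b) = aug A a + aug A b"
proof (rule augI)
  have "a + b - kap (aug A a + aug A b) = (a - kap (aug A a)) + (b - kap (aug A b))" by (simp add: kap_add)
  then show "a + b - kap (aug A a + aug A b) \<in> pos_part A" by (simp only: pos_part_add[OF aug_pos aug_pos])
qed

lemma aug_mult: "aug A (a * b) = aug A a * aug A b"
proof (rule augI)
  have "a * b - kap (aug A a * aug A b) = a * (b - kap (aug A b)) + (a - kap (aug A a)) * kap (aug A b)"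
    by (simp add: kap_mult algebra_simps)
  then show "a * b - kap (aug A a * aug A b) \<in> pos_part A"
    using pos_part_add[OF pos_part_mult(1)[OF aug_pos] pos_part_mult(2)[OF aug_pos]] by simp
qed

lemma aug_gr_pos: "a \<in> gr A n \<Longrightarrow> n > 0 \<Longrightarrow> aug A a = 0"
  by (rule augI) (simp add: pos_part_gr)

lemma gr_0_aug: "a \<in> gr A 0 \<Longrightarrow> a = kap (aug A a)"
  using gr_0 by auto

lemma graded_trivial: "graded_module A (trivial_module A)"
proof -
  have uniq: "\<exists>!x. decomposes (\<lambda>k::int. if k = 0 then UNIV else {0}) x (c::'k)" for c
  proof (rule ex_ex1I)
    show "\<exists>x. decomposes (\<lambda>k::int. if k = 0 then UNIV else {0}) x c"
      by (rule exI, rule decomposes_single[of _ _ 0]) auto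
    fix x y :: "int \<Rightarrow> 'k"
    have *: "x = (\<lambda>i. if i = 0 then c else 0)"
      if x: "decomposes (\<lambda>k::int. if k = 0 then UNIV else {0}) x c" for x :: "int \<Rightarrow> 'k"
    proof -
      have x0: "x i = 0" if "i \<noteq> 0" for i using decomposesD(1)[OF x, of i] that by simp
      have "c = sum x {0}"
        by (subst decomposesD(3)[OF x], rule sum.mono_neutral_left) (use x0 in auto)
      then show ?thesis using x0 by auto
    qed
    assume "decomposes (\<lambda>k::int. if k = 0 then UNIV else {0}) x c"
      "decomposes (\<lambda>k::int. if k = 0 then UNIV else {0}) y c"
    then show "x = y" using * by metis
  qed
  have deg: "aug A a * u \<in> (if int i + k = 0 then UNIV else {0})"
    if "a \<in> gr A i" "u \<in> (if k = 0 then UNIV else {0})" for a i k and u :: 'k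
  proof (cases "k = 0 \<and> i > 0")
    case True
    then show ?thesis using aug_gr_pos[OF that(1)] by simp
  next
    case False
    then show ?thesis using that(2) by (cases "k = 0") auto
  qed
  show ?thesis
    unfolding graded_module_def trivial_module_def
    using uniq deg by (auto simp: aug_add aug_mult algebra_simps)
qed

lemma hcomp_trivial: "c \<in> hcomp (trivial_module A) k \<longleftrightarrow> k = 0 \<or> c = 0"
  by (auto simp: trivial_module_def)

lemma act_trivial: "act (trivial_module A) a c = aug A a * c"
  by (simp add: trivial_module_def)

text \<open>The modules in the definition of \<open>projective\<close> live on the type \<open>nat \<Rightarrow> 'a\<close>. A copy of the trivial module
on this type makes it possible to lift maps to \<open>K\<close>.\<close>

definition emb :: "'k \<Rightarrow> nat \<Rightarrow> 'a" where "emb c = (\<lambda>i. if i = 0 then kap c else 0)"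

definition emb_module :: "('a, nat \<Rightarrow> 'a) grmod" where
  "emb_module = \<lparr>act = \<lambda>a u i. kap (aug A a) * u i, hcomp = \<lambda>k. if k = 0 then range emb else {0}\<rparr>"

lemma emb_inject: "emb c = emb c' \<longleftrightarrow> c = c'"
proof
  assume "emb c = emb c'"
  then have "kap c = kap c'" unfolding emb_def by (metis (full_types))
  then show "c = c'" using aug_kap by metis
qed simp

lemma emb_add: "emb (c + c') = emb c + emb c'" and emb_diff: "emb (c - c') = emb c - emb c'"
  and emb_zero: "emb 0 = 0" and emb_act: "act emb_module a (emb c) = emb (aug A a * c)"
  by (auto simp: emb_def fun_eq_iff kap_add kap_diff emb_module_def kap_mult)

lemma graded_emb: "graded_module A emb_module" and mcarrier_emb: "mcarrier emb_module = range emb"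
proof -
  let ?C = "\<lambda>k::int. if k = 0 then range emb else {0}"
  have C0: "0 \<in> ?C k" for k using emb_zero by (auto intro: range_eqI[of _ _ 0])
  have form: "x = (\<lambda>i. if i = 0 then m else 0)" "m \<in> range emb"
    if x: "decomposes ?C x m" for x and m
  proof -
    have x0: "x i = 0" if "i \<noteq> 0" for i using decomposesD(1)[OF x, of i] that by simp
    have m: "m = sum x {0}"
      by (subst decomposesD(3)[OF x], rule sum.mono_neutral_left) (use x0 in auto)
    then show "x = (\<lambda>i. if i = 0 then m else 0)" using x0 by auto
    show "m \<in> range emb" using decomposesD(1)[OF x, of 0] m by simp
  qed
  have ex: "decomposes ?C (\<lambda>i. if i = 0 then m else 0) m" if "m \<in> range emb" for m
    by (rule decomposes_single) (use C0 that in auto)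
  show car: "mcarrier emb_module = range emb"
  proof
    show "mcarrier emb_module \<subseteq> range emb"
      unfolding mcarrier_def emb_module_def using form(2) by auto
    show "range emb \<subseteq> mcarrier emb_module"
    proof
      fix m assume "m \<in> range emb"
      from ex[OF this] show "m \<in> mcarrier emb_module"
        unfolding mcarrier_def emb_module_def by (intro CollectI exI) simp
    qed
  qed
  have uniq: "\<exists>!x. decomposes ?C x m" if "m \<in> range emb" for m
    by (rule ex1I[of _ "\<lambda>i. if i = 0 then m else 0"], rule ex[OF that], rule form(1))
  have act: "act emb_module a u \<in> ?C (int i + k)" if a: "a \<in> gr A i" and u: "u \<in> ?C k" for a i k u
  proof (cases "u = 0")
    case True
    then show ?thesis using emb_act[of a 0] C0 by (simp add: emb_zero)
  next
    case False
    then obtain c where c: "u = emb c" "k = 0" using u by (auto split: if_splits)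
    then show ?thesis using aug_gr_pos[OF a] by (cases "i = 0") (auto simp: emb_act emb_zero)
  qed
  have diff: "u - v \<in> ?C k" if "u \<in> ?C k" "v \<in> ?C k" for u v k
    using that by (auto split: if_splits simp: emb_diff[symmetric])
  show "graded_module A emb_module"
    unfolding graded_module_def car
  proof (intro conjI allI ballI)
    show "0 \<in> hcomp emb_module k" for k using C0 by (simp add: emb_module_def)
    show "u - v \<in> hcomp emb_module k" if "u \<in> hcomp emb_module k" "v \<in> hcomp emb_module k" for u v k
      using diff[of u k v] that by (simp add: emb_module_def)
    show "\<exists>!x. decomposes (hcomp emb_module) x m" if "m \<in> range emb" for m
      using uniq[OF that] by (simp add: emb_module_def)
    show "act emb_module a (u + v) = act emb_module a u + act emb_module a v" for a u v
      by (auto simp: emb_module_def fun_eq_iff distrib_left)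
    show "act emb_module (a + b) u = act emb_module a u + act emb_module b u" for a b u
      by (auto simp: emb_module_def fun_eq_iff aug_add kap_add distrib_right)
    show "act emb_module (a * b) u = act emb_module a (act emb_module b u)" for a b u
      by (auto simp: emb_module_def fun_eq_iff aug_mult kap_mult mult.assoc)
    show "act emb_module 1 u = u" for u by (simp add: emb_module_def)
    show "act emb_module a u \<in> hcomp emb_module (int i + k)"
      if "a \<in> gr A i" "u \<in> hcomp emb_module k" for i k a u
      using act[of a i u k] that by (simp add: emb_module_def)
  qed
qed

lemma gr_hom_emb:
  assumes f: "gr_hom k M (trivial_module A) f" shows "gr_hom k M emb_module (\<lambda>p. emb (f p))"
  unfolding gr_hom_def
proof (intro conjI ballI allI)
  show "emb (f (u + v)) = emb (f u) + emb (f v)" if "u \<in> mcarrier M" "v \<in> mcarrier M" for u v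
    using gr_hom_add[OF f that] by (simp add: emb_add)
  show "emb (f (act M a u)) = act emb_module a (emb (f u))" if "u \<in> mcarrier M" for a u
    using gr_hom_act[OF f that] by (simp add: emb_act act_trivial)
  show "emb (f u) \<in> hcomp emb_module (j + k)" if "u \<in> hcomp M j" for j u
    using gr_hom_deg[OF f that] by (auto simp: hcomp_trivial emb_module_def emb_zero)
qed

end

section \<open>Chain maps between projective resolutions\<close>

lemma cocyclesD:
  assumes "f \<in> cocycles P d N n k"
  shows "gr_hom k (P n) N f" "\<And>p. p \<in> mcarrier (P (Suc n)) \<Longrightarrow> f (d n p) = 0"
  using assms unfolding cocycles_def by auto

context connected_algebra
begin

abbreviation K :: "('a, 'k) grmod" where "K \<equiv> trivial_module A"

lemma resolutionD:
  fixes P :: "nat \<Rightarrow> ('a, nat \<Rightarrow> 'a) grmod"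
  assumes "resolution A K P d e"
  shows "projective A (P n)" "graded_module A (P n)" "gr_hom 0 (P (Suc n)) (P n) (d n)"
    "gr_hom 0 (P 0) K e" "e ` mcarrier (P 0) = mcarrier K"
    "d 0 ` mcarrier (P 1) = {p \<in> mcarrier (P 0). e p = 0}"
    "d (Suc n) ` mcarrier (P (Suc (Suc n))) = {p \<in> mcarrier (P (Suc n)). d n p = 0}"
proof -
  from assms show p: "projective A (P n)" unfolding resolution_def by simp
  then show "graded_module A (P n)" unfolding projective_def by (elim conjE)
qed (use assms in \<open>simp_all add: resolution_def\<close>)

text \<open>Exactness at \<open>P 0\<close> involves the augmentation, exactness elsewhere a differential; this predicate
treats both cases alike.\<close>

definition cycle :: "(nat \<Rightarrow> (nat \<Rightarrow> 'a) \<Rightarrow> (nat \<Rightarrow> 'a)) \<Rightarrow> ((nat \<Rightarrow> 'a) \<Rightarrow> 'k) \<Rightarrow> nat \<Rightarrow> (nat \<Rightarrow> 'a) \<Rightarrow> bool" where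
  "cycle d e n p \<longleftrightarrow> (case n of 0 \<Rightarrow> e p = 0 | Suc m \<Rightarrow> d m p = 0)"

lemma image_eq_cycles:
  fixes P :: "nat \<Rightarrow> ('a, nat \<Rightarrow> 'a) grmod"
  assumes "resolution A K P d e"
  shows "d n ` mcarrier (P (Suc n)) = {p \<in> mcarrier (P n). cycle d e n p}"
  using resolutionD[OF assms] by (cases n) (simp_all add: cycle_def)

lemma d_carrier:
  fixes P :: "nat \<Rightarrow> ('a, nat \<Rightarrow> 'a) grmod"
  assumes "resolution A K P d e" "p \<in> mcarrier (P (Suc n))"
  shows "d n p \<in> mcarrier (P n)"
  using image_eq_cycles[OF assms(1), of n] assms(2) by blast

lemma d_cycle:
  fixes P :: "nat \<Rightarrow> ('a, nat \<Rightarrow> 'a) grmod"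
  assumes "resolution A K P d e" "p \<in> mcarrier (P (Suc n))"
  shows "cycle d e n (d n p)"
  using image_eq_cycles[OF assms(1), of n] assms(2) by blast

lemma dd_zero:
  fixes P :: "nat \<Rightarrow> ('a, nat \<Rightarrow> 'a) grmod"
  assumes "resolution A K P d e" "p \<in> mcarrier (P (Suc (Suc n)))"
  shows "d n (d (Suc n) p) = 0"
  using d_cycle[OF assms] by (simp add: cycle_def)

lemma ed_zero:
  fixes P :: "nat \<Rightarrow> ('a, nat \<Rightarrow> 'a) grmod"
  assumes "resolution A K P d e" "p \<in> mcarrier (P (Suc 0))"
  shows "e (d 0 p) = 0"
  using d_cycle[OF assms] by (simp add: cycle_def)

lemma exact_homogeneous:
  fixes P :: "nat \<Rightarrow> ('a, nat \<Rightarrow> 'a) grmod"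
  assumes res: "resolution A K P d e" and p: "p \<in> hcomp (P n) j" "cycle d e n p"
  shows "\<exists>q\<in>hcomp (P (Suc n)) j. d n q = p"
proof (rule homogeneous_preimage)
  note r = resolutionD[OF res]
  show "graded_module A (P (Suc n))" "graded_module A (P n)" "gr_hom 0 (P (Suc n)) (P n) (d n)"
    by (rule r)+
  show "p \<in> hcomp (P n) j" by (rule p)
  have "p \<in> mcarrier (P n)" by (rule hcomp_carrier[OF r(2) p(1)])
  then show "p \<in> d n ` mcarrier (P (Suc n))" unfolding image_eq_cycles[OF res] using p(2) by simp
qed

lemma lift_to_start:
  fixes P :: "nat \<Rightarrow> ('a, nat \<Rightarrow> 'a) grmod" and Q :: "('a, nat \<Rightarrow> 'a) grmod"
  assumes res: "resolution A K P d e" and Q: "projective A Q" and f: "gr_hom k Q K f"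
  shows "\<exists>h. gr_hom k Q (P 0) h \<and> (\<forall>p\<in>mcarrier Q. e (h p) = f p)"
proof -
  note r = resolutionD[OF res]
  have Qg: "graded_module A Q" using Q unfolding projective_def by (elim conjE)
  have "\<exists>h. gr_hom k Q (P 0) h \<and> (\<forall>p\<in>mcarrier Q. emb (e (h p)) = emb (f p))"
  proof (rule projective_lift[OF Q r(2) graded_emb gr_hom_emb[OF f] gr_hom_emb[OF r(4)]])
    fix p assume "p \<in> mcarrier Q"
    then have "f p \<in> mcarrier K" by (rule gr_hom_carrier[OF Qg graded_trivial f])
    then have "f p \<in> e ` mcarrier (P 0)" by (simp only: r(5))
    then show "emb (f p) \<in> (\<lambda>p. emb (e p)) ` mcarrier (P 0)" by auto
  qed
  then show ?thesis by (simp add: emb_inject)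
qed

lemma lift_cycles:
  fixes P :: "nat \<Rightarrow> ('a, nat \<Rightarrow> 'a) grmod" and Q :: "('a, nat \<Rightarrow> 'a) grmod"
  assumes res: "resolution A K P d e" and Q: "projective A Q" and f: "gr_hom k Q (P n) f"
    and cyc: "\<And>p. p \<in> mcarrier Q \<Longrightarrow> cycle d e n (f p)"
  shows "\<exists>h. gr_hom k Q (P (Suc n)) h \<and> (\<forall>p\<in>mcarrier Q. d n (h p) = f p)"
proof -
  note r = resolutionD[OF res]
  have Qg: "graded_module A Q" using Q unfolding projective_def by (elim conjE)
  show ?thesis
  proof (rule projective_lift[OF Q r(2) r(2) f r(3)])
    fix p assume p: "p \<in> mcarrier Q"
    then have "f p \<in> mcarrier (P n)" by (rule gr_hom_carrier[OF Qg r(2) f])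
    then show "f p \<in> d n ` mcarrier (P (Suc n))" unfolding image_eq_cycles[OF res] using cyc[OF p] by simp
  qed
qed

text \<open>The case \<open>n = 0\<close>, \<open>f = e\<close> is the comparison theorem for resolutions; the case \<open>P' = P\<close> gives the chain
maps that define Yoneda products.\<close>

lemma chain_map_exists:
  fixes P P' :: "nat \<Rightarrow> ('a, nat \<Rightarrow> 'a) grmod"
  assumes res: "resolution A K P d e" and res': "resolution A K P' d' e'"
    and f: "f \<in> cocycles P d K n k"
  obtains F where "\<And>i. gr_hom k (P (n + i)) (P' i) (F i)"
    "\<And>p. p \<in> mcarrier (P n) \<Longrightarrow> e' (F 0 p) = f p"
    "\<And>i p. p \<in> mcarrier (P (Suc (n + i))) \<Longrightarrow> d' i (F (Suc i) p) = F i (d (n + i) p)"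
proof -
  note r = resolutionD[OF res] and r' = resolutionD[OF res']
  define good where "good i h \<longleftrightarrow> gr_hom k (P (n + i)) (P' i) h \<and>
     (\<forall>p\<in>mcarrier (P (Suc (n + i))). cycle d' e' i (h (d (n + i) p))) \<and>
     (i = 0 \<longrightarrow> (\<forall>p\<in>mcarrier (P n). e' (h p) = f p))" for i h
  define step where "step i h h' \<longleftrightarrow> (\<forall>p\<in>mcarrier (P (Suc (n + i))). d' i (h' p) = h (d (n + i) p))" for i h h'
  have "\<exists>h. good 0 h"
  proof -
    obtain h where h: "gr_hom k (P n) (P' 0) h" "\<forall>p\<in>mcarrier (P n). e' (h p) = f p"
      using lift_to_start[OF res' r(1) cocyclesD(1)[OF f]] by blast
    have "e' (h (d n p)) = 0" if "p \<in> mcarrier (P (Suc n))" for p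
      using h(2) d_carrier[OF res that] cocyclesD(2)[OF f that] by simp
    then show ?thesis using h unfolding good_def by (auto simp: cycle_def)
  qed
  moreover have "\<exists>h'. good (Suc i) h' \<and> step i h h'" if h: "good i h" for i h
  proof -
    have hh: "gr_hom k (P (n + i)) (P' i) h" using h unfolding good_def by blast
    have hd: "gr_hom k (P (Suc (n + i))) (P' i) (\<lambda>p. h (d (n + i) p))"
      using gr_hom_comp[OF r(2) r(2) r(3) hh] by simp
    obtain h' where h': "gr_hom k (P (Suc (n + i))) (P' (Suc i)) h'"
      "\<And>p. p \<in> mcarrier (P (Suc (n + i))) \<Longrightarrow> d' i (h' p) = h (d (n + i) p)"
      using lift_cycles[OF res' r(1) hd] h unfolding good_def by blast
    have "d' i (h' (d (Suc (n + i)) p)) = 0" if p: "p \<in> mcarrier (P (Suc (Suc (n + i))))" for p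
      using h'(2)[OF d_carrier[OF res p]] dd_zero[OF res p] gr_hom_zero[OF r(2) hh] by simp
    then have "good (Suc i) h'" using h'(1) unfolding good_def by (simp add: cycle_def)
    then show ?thesis using h'(2) unfolding step_def by blast
  qed
  ultimately obtain F where F: "\<And>i. good i (F i)" "\<And>i. step i (F i) (F (Suc i))"
    using dependent_nat_choice[of good step] by blast
  show ?thesis
    by (rule that[of F]) (use F in \<open>auto simp: good_def step_def\<close>)
qed

text \<open>Uniqueness of lifts up to homotopy, stated for a chain map over 0. The homotopy satisfies
\<open>d h = G - h d\<close>; the values of \<open>G - h d\<close> are cycles by the preceding step, which is why the
invariant \<open>good\<close> records the equation on the image of \<open>d\<close>.\<close>

lemma null_homotopy:
  fixes P :: "nat \<Rightarrow> ('a, nat \<Rightarrow> 'a) grmod"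
  assumes res: "resolution A K P d e"
    and G: "\<And>i. gr_hom 0 (P i) (P i) (G i)"
    and G0: "\<And>p. p \<in> mcarrier (P 0) \<Longrightarrow> e (G 0 p) = 0"
    and Gd: "\<And>i p. p \<in> mcarrier (P (Suc i)) \<Longrightarrow> d i (G (Suc i) p) = G i (d i p)"
  obtains h where "\<And>i. gr_hom 0 (P i) (P (Suc i)) (h i)"
    "\<And>p. p \<in> mcarrier (P 0) \<Longrightarrow> d 0 (h 0 p) = G 0 p"
    "\<And>i p. p \<in> mcarrier (P (Suc i)) \<Longrightarrow> d (Suc i) (h (Suc i) p) = G (Suc i) p - h i (d i p)"
proof -
  note r = resolutionD[OF res]
  define good where "good i h \<longleftrightarrow> gr_hom 0 (P i) (P (Suc i)) h \<and>
     (\<forall>p\<in>mcarrier (P (Suc i)). d i (h (d i p)) = G i (d i p)) \<and>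
     (i = 0 \<longrightarrow> (\<forall>p\<in>mcarrier (P 0). d 0 (h p) = G 0 p))" for i h
  define step where "step i h h' \<longleftrightarrow>
     (\<forall>p\<in>mcarrier (P (Suc i)). d (Suc i) (h' p) = G (Suc i) p - h (d i p))" for i h h'
  have "\<exists>h. good 0 h"
  proof -
    obtain h where "gr_hom 0 (P 0) (P (Suc 0)) h" "\<forall>p\<in>mcarrier (P 0). d 0 (h p) = G 0 p"
      using lift_cycles[OF res r(1) G, of 0] G0 by (auto simp: cycle_def)
    then show ?thesis unfolding good_def using d_carrier[OF res] by blast
  qed
  moreover have "\<exists>h'. good (Suc i) h' \<and> step i h h'" if h: "good i h" for i h
  proof -
    have hh: "gr_hom 0 (P i) (P (Suc i)) h" using h unfolding good_def by blast
    have hd: "gr_hom 0 (P (Suc i)) (P (Suc i)) (\<lambda>p. h (d i p))"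
      using gr_hom_comp[OF r(2) r(2) r(3) hh] by simp
    have hdc: "h (d i p) \<in> mcarrier (P (Suc i))" if "p \<in> mcarrier (P (Suc i))" for p
      by (rule gr_hom_carrier[OF r(2) r(2) hd that])
    have Gc: "G (Suc i) p \<in> mcarrier (P (Suc i))" if "p \<in> mcarrier (P (Suc i))" for p
      by (rule gr_hom_carrier[OF r(2) r(2) G that])
    have cyc: "cycle d e (Suc i) (G (Suc i) p - h (d i p))" if p: "p \<in> mcarrier (P (Suc i))" for p
      using gr_hom_diff[OF r(2) r(3) Gc[OF p] hdc[OF p]] Gd[OF p] h p
      unfolding good_def cycle_def by simp
    obtain h' where h': "gr_hom 0 (P (Suc i)) (P (Suc (Suc i))) h'"
      "\<And>p. p \<in> mcarrier (P (Suc i)) \<Longrightarrow> d (Suc i) (h' p) = G (Suc i) p - h (d i p)"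
      using lift_cycles[OF res r(1) gr_hom_minus[OF r(2) r(2) G hd] cyc] by blast
    have "d (Suc i) (h' (d (Suc i) p)) = G (Suc i) (d (Suc i) p)" if p: "p \<in> mcarrier (P (Suc (Suc i)))" for p
      using h'(2)[OF d_carrier[OF res p]] dd_zero[OF res p] gr_hom_zero[OF r(2) hh] by simp
    then have "good (Suc i) h'" using h'(1) unfolding good_def by simp
    then show ?thesis using h'(2) unfolding step_def by blast
  qed
  ultimately obtain h where h: "\<And>i. good i (h i)" "\<And>i. step i (h i) (h (Suc i))"
    using dependent_nat_choice[of good step] by blast
  show ?thesis
    by (rule that[of h]) (use h in \<open>auto simp: good_def step_def\<close>)
qed

lemma coboundary_zero:
  assumes "gr_hom k (P n) K f" "\<And>p. p \<in> mcarrier (P n) \<Longrightarrow> f p = 0"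
  shows "f \<in> coboundaries P d K n k"
proof (cases n)
  case 0
  then show ?thesis using assms by (simp add: coboundaries_def)
next
  case (Suc j)
  have "gr_hom k (P j) K (\<lambda>_. 0)" by (rule gr_hom_const_zero[OF graded_trivial])
  then show ?thesis using assms Suc by (auto simp: coboundaries_def intro!: exI[of _ "\<lambda>_. 0"])
qed

lemma coboundaries_cong:
  assumes f: "f \<in> coboundaries P d K n k" and g: "gr_hom k (P n) K g"
    and eq: "\<And>p. p \<in> mcarrier (P n) \<Longrightarrow> g p = f p"
  shows "g \<in> coboundaries P d K n k"
proof (cases n)
  case 0
  then show ?thesis using assms by (simp add: coboundaries_def)
next
  case (Suc j)
  then obtain h where "gr_hom k (P j) K h" "\<And>p. p \<in> mcarrier (P n) \<Longrightarrow> f p = h (d j p)"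
    using f by (auto simp: coboundaries_def)
  then show ?thesis using g eq Suc by (auto simp: coboundaries_def intro!: exI[of _ h])
qed

lemma null_homotopic_coboundary:
  fixes P :: "nat \<Rightarrow> ('a, nat \<Rightarrow> 'a) grmod"
  assumes res: "resolution A K P d e"
    and G: "\<And>i. gr_hom 0 (P i) (P i) (G i)"
    and G0: "\<And>p. p \<in> mcarrier (P 0) \<Longrightarrow> e (G 0 p) = 0"
    and Gd: "\<And>i p. p \<in> mcarrier (P (Suc i)) \<Longrightarrow> d i (G (Suc i) p) = G i (d i p)"
    and f: "f \<in> cocycles P d K n k"
  shows "(\<lambda>p. f (G n p)) \<in> coboundaries P d K n k"
proof -
  note r = resolutionD[OF res]
  obtain h where h: "\<And>i. gr_hom 0 (P i) (P (Suc i)) (h i)"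
    "\<And>p. p \<in> mcarrier (P 0) \<Longrightarrow> d 0 (h 0 p) = G 0 p"
    "\<And>i p. p \<in> mcarrier (P (Suc i)) \<Longrightarrow> d (Suc i) (h (Suc i) p) = G (Suc i) p - h i (d i p)"
    by (rule null_homotopy[OF res G G0 Gd]) blast+
  have fG: "gr_hom k (P n) K (\<lambda>p. f (G n p))"
    using gr_hom_comp[OF r(2) r(2) G cocyclesD(1)[OF f]] by simp
  have hc: "h i p \<in> mcarrier (P (Suc i))" if "p \<in> mcarrier (P i)" for i p
    by (rule gr_hom_carrier[OF r(2) r(2) h(1) that])
  show ?thesis
  proof (cases n)
    case 0
    have "f (G n p) = 0" if "p \<in> mcarrier (P n)" for p
      using h(2)[of p] cocyclesD(2)[OF f, of "h 0 p"] hc[of p 0] that 0 by simp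
    then show ?thesis by (intro coboundary_zero fG)
  next
    case (Suc j)
    have fj: "gr_hom k (P (Suc j)) K f" using cocyclesD(1)[OF f] Suc by simp
    have "f (G (Suc j) p) = f (h j (d j p))" if p: "p \<in> mcarrier (P (Suc j))" for p
    proof -
      have "f (d (Suc j) (h (Suc j) p)) = 0" using cocyclesD(2)[OF f] hc[OF p] Suc by simp
      then have "f (G (Suc j) p - h j (d j p)) = 0" using h(3)[OF p] by simp
      moreover have "f (G (Suc j) p - h j (d j p)) = f (G (Suc j) p) - f (h j (d j p))"
        by (rule gr_hom_diff[OF r(2) fj gr_hom_carrier[OF r(2) r(2) G p] hc[OF d_carrier[OF res p]]])
      ultimately show ?thesis by simp
    qed
    moreover have "gr_hom k (P j) K (\<lambda>p. f (h j p))"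
      using gr_hom_comp[OF r(2) r(2) h(1) fj] by simp
    ultimately show ?thesis using fG Suc
      by (auto simp: coboundaries_def intro!: exI[of _ "\<lambda>p. f (h j p)"])
  qed
qed

text \<open>The chain map \<open>H\<close> raises the homological degree by \<open>s\<close>, as lifts of cocycles of degree \<open>s\<close> do.\<close>

lemma coboundary_comp:
  fixes P P' :: "nat \<Rightarrow> ('a, nat \<Rightarrow> 'a) grmod"
  assumes res: "resolution A K P d e" and res': "resolution A K P' d' e'"
    and H: "\<And>i. gr_hom l (P' (s + i)) (P i) (H i)"
    and Hd: "\<And>i p. p \<in> mcarrier (P' (Suc (s + i))) \<Longrightarrow> d i (H (Suc i) p) = H i (d' (s + i) p)"
    and b: "b \<in> coboundaries P d K n k"
  shows "(\<lambda>p. b (H n p)) \<in> coboundaries P' d' K (s + n) (l + k)"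
proof -
  note r = resolutionD[OF res] and r' = resolutionD[OF res']
  have bh: "gr_hom k (P n) K b" using b by (simp add: coboundaries_def)
  have bH: "gr_hom (l + k) (P' (s + n)) K (\<lambda>p. b (H n p))" by (rule gr_hom_comp[OF r'(2) r(2) H bh])
  have Hc: "H i p \<in> mcarrier (P i)" if "p \<in> mcarrier (P' (s + i))" for i p
    by (rule gr_hom_carrier[OF r'(2) r(2) H that])
  show ?thesis
  proof (cases n)
    case 0
    have "b (H n p) = 0" if "p \<in> mcarrier (P' (s + n))" for p
      using b Hc[OF that] 0 by (simp add: coboundaries_def)
    then show ?thesis by (rule coboundary_zero[where P = P' and n = "s + n", OF bH])
  next
    case (Suc j)
    then obtain g where g: "gr_hom k (P j) K g" "\<And>p. p \<in> mcarrier (P n) \<Longrightarrow> b p = g (d j p)"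
      using b by (auto simp: coboundaries_def)
    have "b (H n p) = g (H j (d' (s + j) p))" if p: "p \<in> mcarrier (P' (s + n))" for p
      using g(2)[OF Hc[OF p]] Hd[of p j] p Suc by simp
    moreover have "gr_hom (l + k) (P' (s + j)) K (\<lambda>p. g (H j p))" by (rule gr_hom_comp[OF r'(2) r(2) H g(1)])
    ultimately show ?thesis using bH Suc
      by (auto simp: coboundaries_def intro!: exI[of _ "\<lambda>p. g (H j p)"])
  qed
qed

lemma cocycle_comp:
  fixes P P' :: "nat \<Rightarrow> ('a, nat \<Rightarrow> 'a) grmod"
  assumes res: "resolution A K P d e" and res': "resolution A K P' d' e'"
    and H: "\<And>i. gr_hom l (P' (s + i)) (P i) (H i)"
    and Hd: "\<And>i p. p \<in> mcarrier (P' (Suc (s + i))) \<Longrightarrow> d i (H (Suc i) p) = H i (d' (s + i) p)"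
    and b: "b \<in> cocycles P d K n k"
  shows "(\<lambda>p. b (H n p)) \<in> cocycles P' d' K (s + n) (l + k)"
proof -
  note r = resolutionD[OF res] and r' = resolutionD[OF res']
  have "b (H n (d' (s + n) p)) = 0" if p: "p \<in> mcarrier (P' (Suc (s + n)))" for p
  proof -
    have "H (Suc n) p \<in> mcarrier (P (Suc n))"
      by (rule gr_hom_carrier[OF r'(2) r(2) H]) (use p in simp)
    then show ?thesis using cocyclesD(2)[OF b] Hd[OF p] by metis
  qed
  then show ?thesis using gr_hom_comp[OF r'(2) r(2) H cocyclesD(1)[OF b]] by (simp add: cocycles_def)
qed

section \<open>Independence of the resolution\<close>

lemma gr_hom_K_add:
  assumes f: "gr_hom k M K f" and g: "gr_hom k M K g"
  shows "gr_hom k M K (\<lambda>p. f p + g p)"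
proof -
  have "f u + g u \<in> hcomp K (j + k)" if u: "u \<in> hcomp M j" for j u
    by (rule graded_hcomp(3)[OF graded_trivial gr_hom_deg[OF f u] gr_hom_deg[OF g u]])
  then show ?thesis
    unfolding gr_hom_def
    using gr_hom_add[OF f] gr_hom_add[OF g] gr_hom_act[OF f] gr_hom_act[OF g]
    by (auto simp: act_trivial distrib_left)
qed

lemma gr_hom_K_scale:
  assumes f: "gr_hom k M K f"
  shows "gr_hom k M K (\<lambda>p. c * f p)"
proof -
  have "c * f u \<in> hcomp K (j + k)" if u: "u \<in> hcomp M j" for j u
    using gr_hom_deg[OF f u] unfolding hcomp_trivial by auto
  then show ?thesis
    unfolding gr_hom_def
    using gr_hom_add[OF f] gr_hom_act[OF f]
    by (auto simp: act_trivial distrib_left)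
qed

lemma yoneda_gen_cocycle:
  fixes P :: "nat \<Rightarrow> ('a, nat \<Rightarrow> 'a) grmod"
  assumes res: "resolution A K P d e" and y: "yoneda_gen A P d e n m f"
  shows "f \<in> cocycles P d K n (- m)"
  using y
proof induction
  case unit
  then show ?case using resolutionD(4)[OF res] ed_zero[OF res] by (simp add: cocycles_def)
next
  case (zero n m)
  then show ?case using gr_hom_const_zero[OF graded_trivial] by (simp add: cocycles_def)
next
  case (add n m f g)
  then show ?case by (auto simp: cocycles_def intro: gr_hom_K_add)
next
  case (scale n m f c)
  then show ?case by (auto simp: cocycles_def intro: gr_hom_K_scale)
next
  case (prod n m f n' m' g F)
  then have "(\<lambda>p. g (F n' p)) \<in> cocycles P d K (n + n') (- m + - m')"
    by (intro cocycle_comp[OF res res]) (auto simp: chain_lift_def)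
  then show ?case by (simp add: add.commute)
qed

lemma yoneda_gen_cong:
  fixes P :: "nat \<Rightarrow> ('a, nat \<Rightarrow> 'a) grmod"
  assumes res: "resolution A K P d e" and y: "yoneda_gen A P d e n m f"
    and f': "f' \<in> cocycles P d K n (- m)" and eq: "\<And>p. p \<in> mcarrier (P n) \<Longrightarrow> f' p = f p"
  shows "yoneda_gen A P d e n m f'"
proof (rule class_eq[OF y f'])
  show "(\<lambda>p. f' p - f p) \<in> coboundaries P d K n (- m)"
    by (rule coboundary_zero)
      (use eq gr_hom_minus[OF resolutionD(2)[OF res] graded_trivial cocyclesD(1)[OF f']
          cocyclesD(1)[OF yoneda_gen_cocycle[OF res y]]] in auto)
qed

text \<open>The round trip through another resolution is homotopic to the identity.\<close>

lemma comparison_coboundary: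
  fixes P P' :: "nat \<Rightarrow> ('a, nat \<Rightarrow> 'a) grmod"
  assumes res: "resolution A K P d e" and res': "resolution A K P' d' e'"
    and \<phi>: "\<And>i. gr_hom 0 (P i) (P' i) (\<phi> i)" "\<And>p. p \<in> mcarrier (P 0) \<Longrightarrow> e' (\<phi> 0 p) = e p"
      "\<And>i p. p \<in> mcarrier (P (Suc i)) \<Longrightarrow> d' i (\<phi> (Suc i) p) = \<phi> i (d i p)"
    and \<psi>: "\<And>i. gr_hom 0 (P' i) (P i) (\<psi> i)" "\<And>p. p \<in> mcarrier (P' 0) \<Longrightarrow> e (\<psi> 0 p) = e' p"
      "\<And>i p. p \<in> mcarrier (P' (Suc i)) \<Longrightarrow> d i (\<psi> (Suc i) p) = \<psi> i (d' i p)"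
    and f: "f \<in> cocycles P d K n k"
  shows "(\<lambda>p. f p - f (\<psi> n (\<phi> n p))) \<in> coboundaries P d K n k"
proof -
  note r = resolutionD[OF res] and r' = resolutionD[OF res']
  have \<psi>c: "\<psi> i p \<in> mcarrier (P i)" if "p \<in> mcarrier (P' i)" for i p
    by (rule gr_hom_carrier[OF r'(2) r(2) \<psi>(1) that])
  have \<phi>c: "\<phi> i p \<in> mcarrier (P' i)" if "p \<in> mcarrier (P i)" for i p
    by (rule gr_hom_carrier[OF r(2) r'(2) \<phi>(1) that])
  define G where "G i p = p - \<psi> i (\<phi> i p)" for i and p :: "nat \<Rightarrow> 'a"
  have idh: "gr_hom 0 (P i) (P i) (\<lambda>p. p)" for i by (simp add: gr_hom_def)
  have \<psi>\<phi>: "gr_hom 0 (P i) (P i) (\<lambda>p. \<psi> i (\<phi> i p))" for i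
    using gr_hom_comp[OF r(2) r'(2) \<phi>(1) \<psi>(1), of i] by simp
  have G: "gr_hom 0 (P i) (P i) (G i)" for i
    unfolding G_def by (rule gr_hom_minus[OF r(2) r(2) idh \<psi>\<phi>])
  have G0: "e (G 0 p) = 0" if p: "p \<in> mcarrier (P 0)" for p
    unfolding G_def using gr_hom_diff[OF r(2) r(4) p \<psi>c[OF \<phi>c[OF p]]] \<psi>(2)[OF \<phi>c[OF p]] \<phi>(2)[OF p] by simp
  have Gd: "d i (G (Suc i) p) = G i (d i p)" if p: "p \<in> mcarrier (P (Suc i))" for i p
    unfolding G_def using gr_hom_diff[OF r(2) r(3) p \<psi>c[OF \<phi>c[OF p]]] \<psi>(3)[OF \<phi>c[OF p]] \<phi>(3)[OF p] by simp
  show ?thesis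
  proof (rule coboundaries_cong[OF null_homotopic_coboundary[OF res G G0 Gd f]])
    have "gr_hom (0 + k) (P n) K (\<lambda>p. f (\<psi> n (\<phi> n p)))"
      by (rule gr_hom_comp[OF r(2) r(2) \<psi>\<phi> cocyclesD(1)[OF f]])
    then show "gr_hom k (P n) K (\<lambda>p. f p - f (\<psi> n (\<phi> n p)))"
      by (intro gr_hom_minus[OF r(2) graded_trivial cocyclesD(1)[OF f]]) simp
    show "f p - f (\<psi> n (\<phi> n p)) = f (G n p)" if p: "p \<in> mcarrier (P n)" for p
      unfolding G_def by (rule gr_hom_diff[OF r(2) cocyclesD(1)[OF f] p \<psi>c[OF \<phi>c[OF p]], symmetric])
  qed
qed

text \<open>For a product of \<open>g\<close> and \<open>f\<close> with lift \<open>F\<close> of \<open>f\<close>, the maps \<open>\<phi> F \<psi>\<close> lift \<open>f \<psi>\<close> on the other resolution. The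
product formed there is \<open>g \<psi> \<phi> F \<psi>\<close>, and it differs from \<open>g F \<psi>\<close> by a coboundary.\<close>

lemma yoneda_gen_transfer:
  fixes P P' :: "nat \<Rightarrow> ('a, nat \<Rightarrow> 'a) grmod"
  assumes res: "resolution A K P d e" and res': "resolution A K P' d' e'"
    and \<phi>: "\<And>i. gr_hom 0 (P i) (P' i) (\<phi> i)" "\<And>p. p \<in> mcarrier (P 0) \<Longrightarrow> e' (\<phi> 0 p) = e p"
      "\<And>i p. p \<in> mcarrier (P (Suc i)) \<Longrightarrow> d' i (\<phi> (Suc i) p) = \<phi> i (d i p)"
    and \<psi>: "\<And>i. gr_hom 0 (P' i) (P i) (\<psi> i)" "\<And>p. p \<in> mcarrier (P' 0) \<Longrightarrow> e (\<psi> 0 p) = e' p"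
      "\<And>i p. p \<in> mcarrier (P' (Suc i)) \<Longrightarrow> d i (\<psi> (Suc i) p) = \<psi> i (d' i p)"
    and y: "yoneda_gen A P d e n m g"
  shows "yoneda_gen A P' d' e' n m (\<lambda>p. g (\<psi> n p))"
  using y
proof induction
  note r = resolutionD[OF res] and r' = resolutionD[OF res']
  have cc: "(\<lambda>p. f (\<psi> n p)) \<in> cocycles P' d' K n k" if "f \<in> cocycles P d K n k" for f n k
    using cocycle_comp[OF res res', of 0 0 \<psi> f n k] \<psi> that by simp
  have cb: "(\<lambda>p. f (\<psi> n p)) \<in> coboundaries P' d' K n k" if "f \<in> coboundaries P d K n k" for f n k
    using coboundary_comp[OF res res', of 0 0 \<psi> f n k] \<psi> that by simp
  {
    case unit
    have "e \<in> cocycles P d K 0 (- 0)" using r(4) ed_zero[OF res] by (simp add: cocycles_def)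
    then show ?case
      by (intro yoneda_gen_cong[OF res' yoneda_gen.unit]) (use cc[of e 0 0] \<psi>(2) in auto)
  next
    case (gen n f m)
    then show ?case by (intro yoneda_gen.gen cc)
  next
    case (zero n m)
    then show ?case by (rule yoneda_gen.zero)
  next
    case (add n m f g)
    then show ?case by (intro yoneda_gen.add)
  next
    case (scale n m f c)
    then show ?case by (intro yoneda_gen.scale)
  next
    case (class_eq n m f f')
    show ?case
      by (rule yoneda_gen.class_eq[OF class_eq.IH cc[OF class_eq.hyps(2)]]) (use cb[OF class_eq.hyps(3)] in simp)
  next
    case (prod n m f n' m' g F)
    have F: "\<And>i. gr_hom (- m) (P (n + i)) (P i) (F i)" "\<And>p. p \<in> mcarrier (P n) \<Longrightarrow> e (F 0 p) = f p"
      "\<And>i p. p \<in> mcarrier (P (Suc (n + i))) \<Longrightarrow> d i (F (Suc i) p) = F i (d (n + i) p)"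
      using prod.hyps unfolding chain_lift_def by auto
    have \<psi>c: "\<psi> i p \<in> mcarrier (P i)" if "p \<in> mcarrier (P' i)" for i p
      by (rule gr_hom_carrier[OF r'(2) r(2) \<psi>(1) that])
    have \<phi>c: "\<phi> i p \<in> mcarrier (P' i)" if "p \<in> mcarrier (P i)" for i p
      by (rule gr_hom_carrier[OF r(2) r'(2) \<phi>(1) that])
    have Fc: "F i p \<in> mcarrier (P i)" if "p \<in> mcarrier (P (n + i))" for i p
      by (rule gr_hom_carrier[OF r(2) r(2) F(1) that])
    define H where "H i p = F i (\<psi> (n + i) p)" for i p
    have H: "gr_hom (- m) (P' (n + i)) (P i) (H i)" for i
      using gr_hom_comp[OF r'(2) r(2) \<psi>(1) F(1), of i] unfolding H_def by simp
    have Hd: "d i (H (Suc i) p) = H i (d' (n + i) p)" if p: "p \<in> mcarrier (P' (Suc (n + i)))" for i p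
      using F(3)[OF \<psi>c[OF p]] \<psi>(3)[OF p] unfolding H_def by simp
    have Hc: "H i p \<in> mcarrier (P i)" if "p \<in> mcarrier (P' (n + i))" for i p
      by (rule gr_hom_carrier[OF r'(2) r(2) H that])
    have lift: "chain_lift P' d' e' n (- m) (\<lambda>p. f (\<psi> n p)) (\<lambda>i p. \<phi> i (H i p))"
      unfolding chain_lift_def
    proof (intro conjI allI ballI)
      show "gr_hom (- m) (P' (n + i)) (P' i) (\<lambda>p. \<phi> i (H i p))" for i
        using gr_hom_comp[OF r'(2) r(2) H \<phi>(1), of i] by simp
      show "e' (\<phi> 0 (H 0 p)) = f (\<psi> n p)" if p: "p \<in> mcarrier (P' n)" for p
        using \<phi>(2)[of "H 0 p"] Hc[of p 0] F(2)[OF \<psi>c[OF p]] p by (simp add: H_def)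
      show "d' i (\<phi> (Suc i) (H (Suc i) p)) = \<phi> i (H i (d' (n + i) p))" if p: "p \<in> mcarrier (P' (Suc (n + i)))" for i p
        using \<phi>(3)[of "H (Suc i) p" i] Hc[of p "Suc i"] Hd[OF p] p by simp
    qed
    have yp: "yoneda_gen A P' d' e' (n + n') (m + m') (\<lambda>p. g (\<psi> n' (\<phi> n' (H n' p))))"
      by (rule yoneda_gen.prod[OF prod.IH lift])
    have gc: "g \<in> cocycles P d K n' (- m')" by (rule yoneda_gen_cocycle[OF res prod.hyps(2)])
    have goal: "(\<lambda>p. g (H n' p)) \<in> cocycles P' d' K (n + n') (- (m + m'))"
      using cocycle_comp[OF res res' H Hd gc] by (simp add: add.commute)
    have "yoneda_gen A P' d' e' (n + n') (m + m') (\<lambda>p. g (H n' p))"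
    proof (rule yoneda_gen.class_eq[OF yp goal])
      show "(\<lambda>p. g (H n' p) - g (\<psi> n' (\<phi> n' (H n' p)))) \<in> coboundaries P' d' K (n + n') (- (m + m'))"
        using coboundary_comp[OF res res' H Hd comparison_coboundary[OF res res' \<phi> \<psi> gc]]
        by (simp add: add.commute)
    qed
    then show ?case by (simp add: H_def)
  }
qed

lemma generation_independent:
  fixes P P' :: "nat \<Rightarrow> ('a, nat \<Rightarrow> 'a) grmod"
  assumes res: "resolution A K P d e" and res': "resolution A K P' d' e'"
    and gen: "\<And>n m f. f \<in> cocycles P d K n (- m) \<Longrightarrow> yoneda_gen A P d e n m f"
    and f: "f \<in> cocycles P' d' K n (- m)"
  shows "yoneda_gen A P' d' e' n m f"
proof -
  note r = resolutionD[OF res] and r' = resolutionD[OF res']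
  have ec: "e \<in> cocycles P d K 0 0" using r(4) ed_zero[OF res] by (simp add: cocycles_def)
  have ec': "e' \<in> cocycles P' d' K 0 0" using r'(4) ed_zero[OF res'] by (simp add: cocycles_def)
  obtain \<phi> where \<phi>: "\<And>i. gr_hom 0 (P i) (P' i) (\<phi> i)" "\<And>p. p \<in> mcarrier (P 0) \<Longrightarrow> e' (\<phi> 0 p) = e p"
      "\<And>i p. p \<in> mcarrier (P (Suc i)) \<Longrightarrow> d' i (\<phi> (Suc i) p) = \<phi> i (d i p)"
    using chain_map_exists[OF res res' ec] by auto
  obtain \<psi> where \<psi>: "\<And>i. gr_hom 0 (P' i) (P i) (\<psi> i)" "\<And>p. p \<in> mcarrier (P' 0) \<Longrightarrow> e (\<psi> 0 p) = e' p"
      "\<And>i p. p \<in> mcarrier (P' (Suc i)) \<Longrightarrow> d i (\<psi> (Suc i) p) = \<psi> i (d' i p)"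
    using chain_map_exists[OF res' res ec'] by auto
  have "(\<lambda>p. f (\<phi> n p)) \<in> cocycles P d K n (- m)"
    using cocycle_comp[OF res' res, of 0 0 \<phi> f n "- m"] \<phi> f by simp
  then have y0: "yoneda_gen A P d e n m (\<lambda>p. f (\<phi> n p))" by (rule gen)
  have y: "yoneda_gen A P' d' e' n m (\<lambda>p. f (\<phi> n (\<psi> n p)))"
    using yoneda_gen_transfer[where P = P and d = d and e = e and P' = P' and d' = d' and e' = e' and
        \<phi> = \<phi> and \<psi> = \<psi> and n = n and m = m and g = "\<lambda>p. f (\<phi> n p)"] res res' \<phi> \<psi> y0 by blast
  show ?thesis
    by (rule yoneda_gen.class_eq[OF y f comparison_coboundary[OF res' res \<psi> \<phi> f]])
qed

end

section \<open>Free modules\<close>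

lemma sum_fun_apply: "(\<Sum>i\<in>I. f i) j = (\<Sum>i\<in>I. (f i j :: 'b::comm_monoid_add))"
  by (induction I rule: infinite_finite_induct) simp_all

context connected_algebra
begin

text \<open>The components of \<open>A\<close>, indexed by all integers, so that degrees of matrix entries can be computed
without case distinctions.\<close>

definition gri :: "int \<Rightarrow> 'a set" where "gri k = (if k \<ge> 0 then gr A (nat k) else {0})"

lemma gri_neg: "k < 0 \<Longrightarrow> gri k = {0}"
  by (simp add: gri_def)

lemma gri_0: "gri 0 = gr A 0" and gri_1: "gri 1 = gr A 1" and gri_2: "gri 2 = gr A 2"
  by (simp_all add: gri_def nat_eq_iff)

lemma gri_zero [simp]: "0 \<in> gri k"
  by (simp add: gri_def gr_zero)

lemma gri_mult: "a \<in> gri i \<Longrightarrow> b \<in> gri j \<Longrightarrow> a * b \<in> gri (i + j)"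
  using gr_mult[of a "nat i" b "nat j"] gr_zero
  by (cases "i \<ge> 0"; cases "j \<ge> 0") (auto simp: gri_def nat_add_distrib)

lemma aug_gri: "a \<in> gri k \<Longrightarrow> k \<noteq> 0 \<Longrightarrow> aug A a = 0"
  using aug_gr_pos[of a "nat k"] by (auto simp: gri_def split: if_splits)

lemma gri_0_aug: "a \<in> gri 0 \<Longrightarrow> a = kap (aug A a)"
  by (rule gr_0_aug) (simp add: gri_0)

lemma gri_sum: "(\<And>i. i \<in> I \<Longrightarrow> f i \<in> gri n) \<Longrightarrow> sum f I \<in> gri n"
  by (cases "n \<ge> 0") (auto simp: gri_def intro: gr_sum)

lemma kap_gri_0 [simp]: "kap c \<in> gri 0"
  by (simp add: gri_0 gr_0)

lemma one_gri_0 [simp]: "1 \<in> gri 0"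
  using kap_gri_0[of 1] by simp

lemma hcomp_regular: "hcomp (regular_module A) k = gri k"
  by (simp add: regular_module_def gri_def)

lemma act_regular: "act (regular_module A) a b = a * b"
  by (simp add: regular_module_def)

lemma hcomp_free: "f \<in> hcomp (free_module A es) k \<longleftrightarrow>
    (\<forall>i<length es. f i \<in> gri (k - es ! i)) \<and> (\<forall>i\<ge>length es. f i = 0)"
  by (simp add: free_module_def shift_def hcomp_regular algebra_simps)

lemma act_free: "act (free_module A es) a f = (\<lambda>i. a * f i)"
  by (simp add: free_module_def)

lemma free_support: "f \<in> mcarrier (free_module A es) \<Longrightarrow> i \<ge> length es \<Longrightarrow> f i = 0"
proof -
  assume "f \<in> mcarrier (free_module A es)" and i: "i \<ge> length es"
  then obtain x where x: "decomposes (hcomp (free_module A es)) x f" unfolding mcarrier_def by blast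
  have "x k i = 0" for k using decomposesD(1)[OF x, of k] i unfolding hcomp_free by blast
  moreover have "f i = (\<Sum>k | x k \<noteq> 0. x k i)"
    by (subst decomposesD(3)[OF x]) (rule sum_fun_apply)
  ultimately show "f i = 0" by simp
qed

lemma act_carrier:
  assumes M: "graded_module A M" and u: "u \<in> mcarrier M"
  shows "act M a u \<in> mcarrier M"
proof -
  obtain x where x: "decomposes (gr A) x a" using decompose by blast
  have add: "act M (b + c) u = act M b u + act M c u" for b c
    using M u unfolding graded_module_def by blast
  have zero: "act M 0 u = 0" using add[of 0 0] by simp
  have sums: "act M (sum x S) u = (\<Sum>i\<in>S. act M (x i) u)" if "finite S" for S
    using that by induction (simp_all add: add zero)
  have hom: "act M b u \<in> mcarrier M" if b: "b \<in> gr A i" for b i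
    using M u
  proof (induction rule: mcarrier_induct)
    case (hom k u)
    then have "act M b u \<in> hcomp M (int i + k)" using M b unfolding graded_module_def by blast
    then show ?case by (rule hcomp_carrier[OF M])
  next
    case (add u v)
    then show ?case using act_add[OF M] mcarrier_add[OF M] by simp
  qed
  have "act M a u = (\<Sum>i | x i \<noteq> 0. act M (x i) u)"
    by (subst decomposesD(3)[OF x]) (rule sums[OF decomposesD(2)[OF x]])
  then show ?thesis using hom[OF decomposesD(1)[OF x]] by (simp add: mcarrier_sum[OF M])
qed

abbreviation \<epsilon> :: "nat \<Rightarrow> nat \<Rightarrow> 'a" where "\<epsilon> \<equiv> unit_vec"

lemma basis_hcomp: "i < length es \<Longrightarrow> \<epsilon> i \<in> hcomp (free_module A es) (es ! i)"
  by (auto simp: hcomp_free unit_vec_def)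

lemma free_hom_expand:
  assumes M: "graded_module A (free_module A es)" and f: "gr_hom k (free_module A es) N f"
    and p: "p \<in> mcarrier (free_module A es)"
  shows "f p = (\<Sum>i<length es. act N (p i) (f (\<epsilon> i)))"
proof -
  let ?M = "free_module A es"
  have \<epsilon>: "\<epsilon> i \<in> mcarrier ?M" if "i < length es" for i by (rule hcomp_carrier[OF M basis_hcomp[OF that]])
  have "p = (\<Sum>i<length es. act ?M (p i) (\<epsilon> i))"
  proof
    fix j
    have "(\<Sum>i<length es. act ?M (p i) (\<epsilon> i)) j = (\<Sum>i<length es. if i = j then p i else 0)"
      unfolding sum_fun_apply act_free by (rule sum.cong) (auto simp: unit_vec_def)
    also have "\<dots> = p j" using free_support[OF p, of j] by (cases "j < length es") auto
    finally show "p j = (\<Sum>i<length es. act ?M (p i) (\<epsilon> i)) j" ..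
  qed
  then have "f p = f (\<Sum>i<length es. act ?M (p i) (\<epsilon> i))" by simp
  also have "\<dots> = (\<Sum>i<length es. f (act ?M (p i) (\<epsilon> i)))"
    by (rule gr_hom_sum[OF M f]) (use act_carrier[OF M] \<epsilon> in auto)
  also have "\<dots> = (\<Sum>i<length es. act N (p i) (f (\<epsilon> i)))"
    by (rule sum.cong) (use gr_hom_act[OF f] \<epsilon> in auto)
  finally show ?thesis .
qed

text \<open>The coordinates on a graded free module followed by the augmentation; on a minimal resolution
they form the basis of \<open>E(A)\<close> dual to the free generators.\<close>

lemma coordinate_hom:
  assumes "j < length es"
  shows "gr_hom (- (es ! j)) (free_module A es) K (\<lambda>p. aug A (p j))"
  unfolding gr_hom_def
proof (intro conjI ballI allI)
  show "aug A ((u + v) j) = aug A (u j) + aug A (v j)" for u v :: "nat \<Rightarrow> 'a" by (simp add: aug_add)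
  show "aug A (act (free_module A es) a u j) = act K a (aug A (u j))" for a and u :: "nat \<Rightarrow> 'a"
    by (simp add: act_free act_trivial aug_mult)
  show "aug A (u j) \<in> hcomp K (l + - (es ! j))" if "u \<in> hcomp (free_module A es) l" for u l
    using that assms aug_gri[of "u j" "l - es ! j"] unfolding hcomp_free hcomp_trivial by auto
qed

lemma row_hom:
  assumes "\<And>i. i < length es \<Longrightarrow> b i \<in> gri (es ! i + k)"
  shows "gr_hom k (free_module A es) (regular_module A) (\<lambda>p. \<Sum>i<length es. p i * b i)"
  unfolding gr_hom_def
proof (intro conjI ballI allI)
  show "(\<Sum>i<length es. (u + v) i * b i) = (\<Sum>i<length es. u i * b i) + (\<Sum>i<length es. v i * b i)"
    for u v :: "nat \<Rightarrow> 'a"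
    by (simp add: distrib_right sum.distrib)
  show "(\<Sum>i<length es. act (free_module A es) a u i * b i) = act (regular_module A) a (\<Sum>i<length es. u i * b i)"
    for a and u :: "nat \<Rightarrow> 'a"
    by (simp add: act_free act_regular sum_distrib_left mult.assoc)
  show "(\<Sum>i<length es. u i * b i) \<in> hcomp (regular_module A) (l + k)"
    if u: "u \<in> hcomp (free_module A es) l" for u l
  proof -
    have "u i * b i \<in> gri (l + k)" if "i < length es" for i
      using gri_mult[of "u i" "l - es ! i" "b i" "es ! i + k"] u assms[OF that] that
      unfolding hcomp_free by simp
    then show ?thesis unfolding hcomp_regular by (intro gri_sum) simp
  qed
qed

end

section \<open>A resolution of type (1,3,4,3,1)\<close>

text \<open>The coordinates of \<open>free_module A es\<close> are indexed by natural numbers from 0, the vectors of the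
linear algebra above by the type \<open>3\<close>.\<close>

definition idx :: "3 \<Rightarrow> nat" where "idx i = (if i = 1 then 0 else if i = 2 then 1 else 2)"

definition jdx :: "nat \<Rightarrow> 3" where "jdx n = (if n = 0 then 1 else if n = 1 then 2 else 3)"

lemma idx_simps [simp]: "idx 1 = 0" "idx 2 = 1" "idx 3 = 2"
  by (simp_all add: idx_def)

lemma jdx_simps [simp]: "jdx 0 = 1" "jdx 1 = 2" "jdx (Suc 0) = 2" "jdx 2 = 3"
  by (simp_all add: jdx_def)

lemma jdx_idx [simp]: "jdx (idx i) = i"
  using exhaust_3[of i] by auto

lemma idx_less [simp]: "idx i < 3"
  by (simp add: idx_def)

lemma sum_idx: "(\<Sum>n<3. f n) = (\<Sum>i\<in>UNIV. f (idx i))"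
  by (simp add: sum_3 numeral_3_eq_3 add.assoc) (simp add: numeral_2_eq_2)

lemma less3_idx: "n < 3 \<Longrightarrow> \<exists>i. n = idx i"
proof -
  assume "n < 3"
  then have "n = 0 \<or> n = 1 \<or> n = 2" by auto
  then show ?thesis using idx_simps by metis
qed

locale type_13431 = connected_algebra A
  for A :: "('k::field, 'a::ring_1) gralg" +
  fixes P :: "nat \<Rightarrow> ('a, nat \<Rightarrow> 'a) grmod" and d :: "nat \<Rightarrow> (nat \<Rightarrow> 'a) \<Rightarrow> (nat \<Rightarrow> 'a)"
    and e :: "(nat \<Rightarrow> 'a) \<Rightarrow> 'k"
  assumes res: "resolution A K P d e"
    and P0: "P 0 = free_module A [0]" and P1: "P 1 = free_module A [1, 1, 1]"
    and P2: "P 2 = free_module A [2, 2, 3, 3]" and P3: "P 3 = free_module A [4, 4, 4]"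
    and P4: "P 4 = free_module A [5]" and P5: "\<And>n. n \<ge> 5 \<Longrightarrow> P n = free_module A []"
begin

lemmas gradedP = resolutionD(2)[OF res] and homd = resolutionD(3)[OF res] and home = resolutionD(4)[OF res]

lemmas P1' = P1[unfolded One_nat_def]

lemma P_free: "\<exists>es. P n = free_module A es"
proof -
  consider "n = 0" | "n = 1" | "n = 2" | "n = 3" | "n = 4" | "n \<ge> 5" by linarith
  then show ?thesis using P0 P1 P2 P3 P4 P5 by cases blast+
qed

lemma act_P: "act (P n) a f = (\<lambda>i. a * f i)"
  using P_free[of n] act_free by auto

lemma hP0: "p \<in> hcomp (P 0) k \<longleftrightarrow> p 0 \<in> gri k \<and> (\<forall>i\<ge>1. p i = 0)"
  unfolding P0 hcomp_free by simp

lemma hP1: "p \<in> hcomp (P (Suc 0)) k \<longleftrightarrow> (\<forall>i<3. p i \<in> gri (k - 1)) \<and> (\<forall>i\<ge>3. p i = 0)"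
  unfolding P1' hcomp_free by (simp add: numeral_3_eq_3 All_less_Suc)

lemma hP2: "p \<in> hcomp (P 2) k \<longleftrightarrow>
   p 0 \<in> gri (k - 2) \<and> p 1 \<in> gri (k - 2) \<and> p 2 \<in> gri (k - 3) \<and> p 3 \<in> gri (k - 3) \<and> (\<forall>i\<ge>4. p i = 0)"
  unfolding P2 hcomp_free by (simp add: numeral_2_eq_2 numeral_3_eq_3 All_less_Suc numeral_nat(2) conj_ac)

lemma hP3: "p \<in> hcomp (P 3) k \<longleftrightarrow> (\<forall>i<3. p i \<in> gri (k - 4)) \<and> (\<forall>i\<ge>3. p i = 0)"
  unfolding P3 hcomp_free by (simp add: numeral_3_eq_3 All_less_Suc)

lemma hP4: "p \<in> hcomp (P 4) k \<longleftrightarrow> p 0 \<in> gri (k - 5) \<and> (\<forall>i\<ge>1. p i = 0)"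
  unfolding P4 hcomp_free by simp

lemma carrierP: "p \<in> hcomp (P n) k \<Longrightarrow> p \<in> mcarrier (P n)"
  by (rule hcomp_carrier[OF gradedP])

lemma d_hcomp: "p \<in> hcomp (P (Suc n)) k \<Longrightarrow> d n p \<in> hcomp (P n) k"
  using gr_hom_deg[OF homd, of p n k] by simp

lemmas d0_hcomp = d_hcomp[of _ 0] and d1_hcomp = d_hcomp[of _ "Suc 0", folded numeral_2_eq_2]
  and d2_hcomp = d_hcomp[of _ 2, folded eval_nat_numeral(3)] and d3_hcomp = d_hcomp[of _ 3, simplified]

lemma d_exact: "p \<in> hcomp (P (Suc n)) k \<Longrightarrow> d n p = 0 \<Longrightarrow> \<exists>q\<in>hcomp (P (Suc (Suc n))) k. d (Suc n) q = p"
  using exact_homogeneous[OF res, of p "Suc n" k] by (simp add: cycle_def)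

lemma d_exact1: "p \<in> hcomp (P (Suc 0)) k \<Longrightarrow> d 0 p = 0 \<Longrightarrow> \<exists>q\<in>hcomp (P 2) k. d (Suc 0) q = p"
  and d_exact2: "p \<in> hcomp (P 2) k \<Longrightarrow> d (Suc 0) p = 0 \<Longrightarrow> \<exists>q\<in>hcomp (P 3) k. d 2 q = p"
  and d_exact3: "p \<in> hcomp (P 3) k \<Longrightarrow> d 2 p = 0 \<Longrightarrow> \<exists>q\<in>hcomp (P 4) k. d 3 q = p"
  and d_exact4: "p \<in> hcomp (P 4) k \<Longrightarrow> d 3 p = 0 \<Longrightarrow> \<exists>q\<in>hcomp (P 5) k. d 4 q = p"
  using d_exact[of p 0 k] d_exact[of p 1 k] d_exact[of p 2 k] d_exact[of p 3 k]
  by (simp_all add: eval_nat_numeral)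

lemma d_zero [simp]: "d n 0 = 0"
  by (rule gr_hom_zero[OF gradedP homd])

lemma expand:
  assumes "P n = free_module A es" "gr_hom k (P n) N f" "p \<in> mcarrier (P n)"
  shows "f p = (\<Sum>i<length es. act N (p i) (f (\<epsilon> i)))"
  using free_hom_expand[of es k N f p] gradedP[of n] assms by simp

lemma basisP: "P n = free_module A es \<Longrightarrow> i < length es \<Longrightarrow> \<epsilon> i \<in> hcomp (P n) (es ! i)"
  using basis_hcomp by simp

lemma d0_expand: "p \<in> mcarrier (P (Suc 0)) \<Longrightarrow> d 0 p = (\<lambda>k. \<Sum>i<3. p i * d 0 (\<epsilon> i) k)"
  using expand[OF P1', of 0 "P 0" "d 0" p] homd[of 0] by (simp add: act_P sum_fun_apply fun_eq_iff eval_nat_numeral)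

lemma d1_expand: "p \<in> mcarrier (P 2) \<Longrightarrow> d (Suc 0) p = (\<lambda>k. \<Sum>i<4. p i * d (Suc 0) (\<epsilon> i) k)"
  using expand[OF P2, of 0 "P (Suc 0)" "d (Suc 0)" p] homd[of "Suc 0"]
  by (simp add: act_P sum_fun_apply fun_eq_iff eval_nat_numeral)

lemma d2_expand: "p \<in> mcarrier (P 3) \<Longrightarrow> d 2 p = (\<lambda>k. \<Sum>i<3. p i * d 2 (\<epsilon> i) k)"
  using expand[OF P3, of 0 "P 2" "d 2" p] homd[of 2]
  by (simp add: act_P sum_fun_apply fun_eq_iff eval_nat_numeral)

lemma d3_expand: "p \<in> mcarrier (P 4) \<Longrightarrow> d 3 p = (\<lambda>k. p 0 * d 3 (\<epsilon> 0) k)"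
  using expand[OF P4, of 0 "P 3" "d 3" p] homd[of 3]
  by (simp add: act_P sum_fun_apply fun_eq_iff eval_nat_numeral)

lemma basis1: "i < 3 \<Longrightarrow> \<epsilon> i \<in> hcomp (P (Suc 0)) 1"
  by (auto simp: hP1 unit_vec_def)

lemma basis2: "\<epsilon> 0 \<in> hcomp (P 2) 2" "\<epsilon> (Suc 0) \<in> hcomp (P 2) 2" "\<epsilon> 2 \<in> hcomp (P 2) 3" "\<epsilon> 3 \<in> hcomp (P 2) 3"
  by (auto simp: hP2 unit_vec_def)

lemma basis3: "i < 3 \<Longrightarrow> \<epsilon> i \<in> hcomp (P 3) 4"
  by (auto simp: hP3 unit_vec_def)

lemma basis4: "\<epsilon> 0 \<in> hcomp (P 4) 5"
  by (auto simp: hP4 unit_vec_def)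

text \<open>The entries of the differential \<open>P 1 \<rightarrow> P 0\<close>. Exactness makes them a basis of \<open>A\<^sub>1\<close>.\<close>

definition x :: "3 \<Rightarrow> 'a" where "x i = d 0 (\<epsilon> (idx i)) 0"

sublocale generators kap x ..

lemma d0_at_0: "p \<in> mcarrier (P (Suc 0)) \<Longrightarrow> d 0 p 0 = (\<Sum>i\<in>UNIV. p (idx i) * x i)"
  unfolding x_def by (simp only: d0_expand sum_idx)

lemma x_gr: "x i \<in> gr A 1"
  using d0_hcomp[of "\<epsilon> (idx i)" 1] basis1[OF idx_less, of i] by (simp add: hP0 gri_1 x_def)

lemma lin_gr: "lin v \<in> gr A 1"
  unfolding lin_def by (intro gr_sum gr_kap x_gr)

lemma P0_zero_iff: "p \<in> hcomp (P 0) k \<Longrightarrow> p = 0 \<longleftrightarrow> p 0 = 0"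
proof -
  assume "p \<in> hcomp (P 0) k"
  then have "p i = 0" if "i \<ge> 1" for i using that by (simp add: hP0)
  then have "p i = 0" if "p 0 = 0" for i using that by (cases i) auto
  then show ?thesis by auto
qed

lemma e_formula: "p \<in> mcarrier (P 0) \<Longrightarrow> e p = aug A (p 0) * e (\<epsilon> 0)"
  using expand[OF P0 home, of p] by (simp add: act_trivial)

lemma e_nonzero: "e (\<epsilon> 0) \<noteq> 0"
proof
  assume "e (\<epsilon> 0) = 0"
  then have "e ` mcarrier (P 0) \<subseteq> {0}" using e_formula by auto
  then have "mcarrier K \<subseteq> {0}" using resolutionD(5)[OF res] by simp
  moreover have "1 \<in> mcarrier K"
    by (rule hcomp_carrier[OF graded_trivial, of _ 0]) (simp add: hcomp_trivial)
  ultimately show False by auto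
qed

text \<open>The combination of three generators with scalar coefficients; used for \<open>P 1\<close> and for \<open>P 3\<close>.\<close>

definition vec1 :: "(3 \<Rightarrow> 'k) \<Rightarrow> nat \<Rightarrow> 'a" where
  "vec1 v = (\<lambda>i. if i < 3 then kap (v (jdx i)) else 0)"

lemma vec1_hP1: "vec1 v \<in> hcomp (P (Suc 0)) 1" and vec1_hP3: "vec1 v \<in> hcomp (P 3) 4"
  by (auto simp: hP1 hP3 vec1_def)

lemma d0_vec1: "d 0 (vec1 v) 0 = lin v"
  using d0_at_0[OF carrierP[OF vec1_hP1]] by (simp add: vec1_def lin_def)

lemma lin_inj: "lin v = 0 \<Longrightarrow> v = (\<lambda>_. 0)"
proof -
  assume "lin v = 0"
  then have "d 0 (vec1 v) = 0"
    using P0_zero_iff[OF d0_hcomp[of "vec1 v" 1]] vec1_hP1 d0_vec1[of v] by simp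
  then obtain q where q: "q \<in> hcomp (P 2) 1" "d (Suc 0) q = vec1 v"
    using d_exact1[OF vec1_hP1] by blast
  have "q i = 0" for i
  proof -
    have "i = 0 \<or> i = 1 \<or> i = 2 \<or> i = 3 \<or> i \<ge> 4" by auto
    then show ?thesis using q(1) by (auto simp: hP2 gri_neg)
  qed
  then have "q = 0" by auto
  then have vz: "vec1 v = 0" using q(2) by simp
  have "kap (v i) = 0" for i using fun_cong[OF vz, of "idx i"] by (simp add: vec1_def)
  then have "v i = 0" for i using kap_cancel[of "v i" 1] by simp
  then show ?thesis by auto
qed

lemma lin_surj: "a \<in> gr A 1 \<Longrightarrow> \<exists>v. a = lin v"
proof -
  assume a: "a \<in> gr A 1"
  define p where "p = (\<lambda>i::nat. if i = 0 then a else 0)"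
  have p: "p \<in> hcomp (P 0) 1" using a by (simp add: hP0 p_def gri_1)
  have "e p \<in> hcomp K (1 + 0)" by (rule gr_hom_deg[OF home p])
  then have "cycle d e 0 p" by (simp add: hcomp_trivial cycle_def)
  then obtain q where q: "q \<in> hcomp (P (Suc 0)) 1" "d 0 q = p" using exact_homogeneous[OF res p] by auto
  have "q (idx i) = kap (aug A (q (idx i)))" for i
    by (rule gri_0_aug) (use q(1) in \<open>simp add: hP1\<close>)
  then have "d 0 q 0 = lin (\<lambda>i. aug A (q (idx i)))"
    unfolding d0_at_0[OF carrierP[OF q(1)]] lin_def by simp
  then show ?thesis unfolding q(2) p_def by auto
qed

lemma ex_relations: "\<exists>F. \<forall>n<2. \<forall>k. d (Suc 0) (\<epsilon> n) (idx k) = lin (col (F n) k)"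
proof -
  have "\<exists>v. d (Suc 0) (\<epsilon> n) (idx k) = lin v" if "n < 2" for n k
  proof (rule lin_surj)
    have "\<epsilon> n \<in> hcomp (P 2) 2" using that basis2(1,2) by (auto simp: less_2_cases_iff)
    then have "d (Suc 0) (\<epsilon> n) \<in> hcomp (P (Suc 0)) 2" by (rule d1_hcomp)
    then show "d (Suc 0) (\<epsilon> n) (idx k) \<in> gr A 1" by (simp add: hP1 gri_1)
  qed
  then obtain v where "\<And>n k. n < 2 \<Longrightarrow> d (Suc 0) (\<epsilon> n) (idx k) = lin (v n k)" by metis
  then show ?thesis by (intro exI[of _ "\<lambda>n i k. v n k i"]) simp
qed

text \<open>The rows of the differential \<open>P 2 \<rightarrow> P 1\<close> at the two generators of degree 2 are the quadratic
relations, written as tensors.\<close>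

definition FF :: "nat \<Rightarrow> 3 \<Rightarrow> 3 \<Rightarrow> 'k" where
  "FF = (SOME F. \<forall>n<2. \<forall>k. d (Suc 0) (\<epsilon> n) (idx k) = lin (col (F n) k))"

abbreviation "F \<equiv> FF 0"
abbreviation "G \<equiv> FF (Suc 0)"

lemma rows: "d (Suc 0) (\<epsilon> 0) (idx k) = lin (col F k)" "d (Suc 0) (\<epsilon> (Suc 0)) (idx k) = lin (col G k)"
  using someI_ex[OF ex_relations] unfolding FF_def[symmetric] by auto

definition two :: "'a \<Rightarrow> 'a \<Rightarrow> nat \<Rightarrow> 'a" where
  "two a b = (\<lambda>i. if i = 0 then a else if i = 1 then b else 0)"

lemma two_hP2: "a \<in> gri (k - 2) \<Longrightarrow> b \<in> gri (k - 2) \<Longrightarrow> two a b \<in> hcomp (P 2) k"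
  by (simp add: hP2 two_def)

lemma two_carrier: "a \<in> gri n \<Longrightarrow> b \<in> gri n \<Longrightarrow> two a b \<in> mcarrier (P 2)"
  by (rule carrierP[OF two_hP2, of a "n + 2"]) simp_all

lemma two_zero: "two a b = 0 \<Longrightarrow> a = 0 \<and> b = 0"
proof -
  assume eq: "two a b = 0"
  show ?thesis using fun_cong[OF eq, of 0] fun_cong[OF eq, of 1] by (simp add: two_def)
qed

lemma d1_two:
  assumes "a \<in> gri n" "b \<in> gri n"
  shows "d (Suc 0) (two a b) (idx k) = a * lin (col F k) + b * lin (col G k)"
  using d1_expand[OF two_carrier[OF assms]]
  by (simp add: two_def rows[symmetric] lessThan_nat_numeral lessThan_Suc)

lemma d1_zero_iff:
  assumes "p \<in> hcomp (P 2) k"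
  shows "d (Suc 0) p = 0 \<longleftrightarrow> (\<forall>i. d (Suc 0) p (idx i) = 0)"
proof
  assume *: "\<forall>i. d (Suc 0) p (idx i) = 0"
  have "d (Suc 0) p \<in> hcomp (P (Suc 0)) k" by (rule d1_hcomp[OF assms])
  then have "d (Suc 0) p n = 0" for n using * less3_idx[of n] by (cases "n < 3") (auto simp: hP1)
  then show "d (Suc 0) p = 0" by auto
qed simp

lemma P3_low: "q \<in> hcomp (P 3) k \<Longrightarrow> k < 4 \<Longrightarrow> q = 0"
proof
  fix i assume "q \<in> hcomp (P 3) k" "k < 4"
  then show "q i = 0 i" by (cases "i < 3") (auto simp: hP3 gri_neg)
qed

text \<open>In degrees below 4 the two quadratic relations have no syzygies, as \<open>P 3\<close> starts in degree 4. Degree 2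
gives their independence, and degree 3 the vanishing of \<open>Tor\<^sub>3\<^sub>,\<^sub>3(K, K)\<close>.\<close>

lemma two_injective:
  assumes "a \<in> gri (k - 2)" "b \<in> gri (k - 2)" "k < 4"
    and "\<And>i. a * lin (col F i) + b * lin (col G i) = 0"
  shows "a = 0 \<and> b = 0"
proof -
  have t: "two a b \<in> hcomp (P 2) k" by (rule two_hP2[OF assms(1,2)])
  have "d (Suc 0) (two a b) = 0" unfolding d1_zero_iff[OF t] using d1_two[OF assms(1,2)] assms(4) by simp
  then obtain q where "q \<in> hcomp (P 3) k" "d 2 q = two a b"
    using d_exact2[OF t] by blast
  then have "two a b = 0" using P3_low[OF _ assms(3)] d_zero by metis
  then show ?thesis by (rule two_zero)
qed

lemma quad_columns: "quad T = (\<Sum>k\<in>UNIV. lin (col T k) * x k)"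
  unfolding quad_def lin_def sum_distrib_right by (subst sum.swap) (simp add: mult.assoc)

sublocale two_relations kap x F G
proof
  fix s t assume eq: "(\<lambda>i k. s * F i k + t * G i k) = (\<lambda>_ _. 0)"
  have "kap s * lin (col F i) + kap t * lin (col G i) = 0" for i
  proof -
    have "(\<lambda>j. s * F j i + t * G j i) = (\<lambda>_. 0)" using eq by meson
    then show ?thesis using lin_comb[of s "\<lambda>j. F j i" t "\<lambda>j. G j i"] by simp
  qed
  from two_injective[OF _ _ _ this, of 2] have "kap s = 0" "kap t = 0" by auto
  then show "s = 0 \<and> t = 0" using kap_cancel[of _ 1] by simp
next
  fix T :: "3 \<Rightarrow> 3 \<Rightarrow> 'k"
  show "quad T = 0 \<longleftrightarrow> (\<exists>s t. T = (\<lambda>i k. s * F i k + t * G i k))"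
  proof
    assume q0: "quad T = 0"
    define p where "p = (\<lambda>n. if n < 3 then lin (\<lambda>i. T i (jdx n)) else 0)"
    have p: "p \<in> hcomp (P (Suc 0)) 2" using lin_gr by (simp add: hP1 p_def gri_1)
    have "d 0 p 0 = quad T" using d0_at_0[OF carrierP[OF p]] by (simp add: p_def quad_columns)
    then have "d 0 p = 0" using q0 P0_zero_iff[OF d0_hcomp[of p 2]] p by simp
    then obtain q where q: "q \<in> hcomp (P 2) 2" "d (Suc 0) q = p"
      using d_exact1[OF p] by blast
    define s t where "s = aug A (q 0)" and "t = aug A (q 1)"
    have q01: "q 0 = kap s" "q 1 = kap t"
      using q(1) gri_0_aug unfolding s_def t_def by (auto simp: hP2)
    have "q = two (kap s) (kap t)"
    proof
      fix i :: nat
      have "i = 0 \<or> i = 1 \<or> i = 2 \<or> i = 3 \<or> i \<ge> 4" by auto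
      then show "q i = two (kap s) (kap t) i" using q(1) q01 by (auto simp: hP2 gri_neg two_def)
    qed
    then have "p (idx k) = kap s * lin (col F k) + kap t * lin (col G k)" for k
      using q(2) d1_two[of "kap s" 0 "kap t" k] by simp
    then have "lin (\<lambda>i. 1 * T i k + (- 1) * (s * F i k + t * G i k)) = 0" for k
      unfolding lin_comb by (simp add: p_def lin_comb kap_uminus)
    then have "\<And>k. (\<lambda>i. 1 * T i k + (- 1) * (s * F i k + t * G i k)) = (\<lambda>_. 0)" by (rule lin_inj)
    then have "1 * T i k + (- 1) * (s * F i k + t * G i k) = 0" for i k by meson
    then have "T i k - (s * F i k + t * G i k) = 0" for i k by (metis mult_1 mult_minus1 uminus_add_conv_diff add.commute)
    then have "T i k = s * F i k + t * G i k" for i k by (simp only: right_minus_eq)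
    then show "\<exists>s t. T = (\<lambda>i k. s * F i k + t * G i k)" by (intro exI ext)
  next
    assume "\<exists>s t. T = (\<lambda>i k. s * F i k + t * G i k)"
    then obtain s t where T: "T = (\<lambda>i k. s * F i k + t * G i k)" by (elim exE)
    have dd: "d 0 (d (Suc 0) (\<epsilon> n)) = 0" if "\<epsilon> n \<in> hcomp (P 2) 2" for n
      using dd_zero[OF res, of "\<epsilon> n" 0] carrierP[OF that] by (simp add: numeral_2_eq_2)
    have c: "d (Suc 0) (\<epsilon> n) \<in> mcarrier (P (Suc 0))" if "\<epsilon> n \<in> hcomp (P 2) 2" for n
      by (rule carrierP[OF d1_hcomp[OF that]])
    have "quad F = d 0 (d (Suc 0) (\<epsilon> 0)) 0" "quad G = d 0 (d (Suc 0) (\<epsilon> (Suc 0))) 0"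
      unfolding d0_at_0[OF c[OF basis2(1)]] d0_at_0[OF c[OF basis2(2)]] rows by (rule quad_columns)+
    then show "quad T = 0" unfolding T quad_comb by (simp add: dd[OF basis2(1)] dd[OF basis2(2)])
  qed
next
  fix v w assume "\<And>k. lin v * lin (col F k) + lin w * lin (col G k) = 0"
  from two_injective[OF _ _ _ this, of 3] have "lin v = 0" "lin w = 0"
    using lin_gr by (auto simp: gri_1)
  then show "v = (\<lambda>_. 0) \<and> w = (\<lambda>_. 0)" using lin_inj by blast
qed

end

context type_13431
begin

section \<open>The Gorenstein condition\<close>

lemma vec1_zero: "vec1 c = 0 \<Longrightarrow> c = (\<lambda>_. 0)"
proof -
  assume eq: "vec1 c = 0"
  have "kap (c i) = 0" for i using fun_cong[OF eq, of "idx i"] by (simp add: vec1_def)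
  then have "c i = 0" for i using kap_cancel[of "c i" 1] by simp
  then show ?thesis by auto
qed

lemma scalar_coordinates:
  assumes "\<forall>n<3. p n \<in> gri 0" "\<forall>n\<ge>3. p n = 0"
  shows "p = vec1 (\<lambda>i. aug A (p (idx i)))"
proof
  fix n
  show "p n = vec1 (\<lambda>i. aug A (p (idx i))) n"
  proof (cases "n < 3")
    case True
    then obtain i where n: "n = idx i" using less3_idx by blast
    have "p n \<in> gri 0" using assms True by simp
    from gri_0_aug[OF this] show ?thesis by (simp add: n vec1_def)
  next
    case False
    then show ?thesis using assms by (simp add: vec1_def)
  qed
qed

lemma P3_vec1: "q \<in> hcomp (P 3) 4 \<Longrightarrow> q = vec1 (\<lambda>i. aug A (q (idx i)))"
  by (rule scalar_coordinates) (simp_all add: hP3)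

lemma P1_vec1: "p \<in> hcomp (P (Suc 0)) 1 \<Longrightarrow> p = vec1 (\<lambda>i. aug A (p (idx i)))"
  by (rule scalar_coordinates) (simp_all add: hP1)

lemma d2_vec1: "d 2 (vec1 c) j = (\<Sum>m\<in>UNIV. kap (c m) * d 2 (\<epsilon> (idx m)) j)"
  unfolding d2_expand[OF carrierP[OF vec1_hP3]] sum_idx by (simp add: vec1_def)

lemma d2_vec1_inj: "d 2 (vec1 c) = 0 \<Longrightarrow> c = (\<lambda>_. 0)"
proof -
  assume "d 2 (vec1 c) = 0"
  then obtain q where q: "q \<in> hcomp (P 4) 4" "d 3 q = vec1 c" using d_exact3[OF vec1_hP3] by blast
  have "q i = 0" for i using q(1) by (cases i) (auto simp: hP4 gri_neg)
  then have "q = 0" by auto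
  then show ?thesis using q(2) vec1_zero d_zero by metis
qed

text \<open>The coefficients of the entries of \<open>P 4 \<rightarrow> P 3\<close>, and of the linear part of \<open>P 3 \<rightarrow> P 2\<close>, whose entries
lie in the columns \<open>j = 2, 3\<close>.\<close>

definition Y :: "3 \<Rightarrow> 3 \<Rightarrow> 'k" where
  "Y m = (SOME v. d 3 (\<epsilon> 0) (idx m) = lin v)"

definition L :: "nat \<Rightarrow> 3 \<Rightarrow> 3 \<Rightarrow> 'k" where
  "L j m = (SOME v. d 2 (\<epsilon> (idx m)) j = lin v)"

lemma Y: "d 3 (\<epsilon> 0) (idx m) = lin (Y m)"
proof -
  have "d 3 (\<epsilon> 0) (idx m) \<in> gr A 1"
    using d3_hcomp[OF basis4] by (simp add: hP3 gri_1)
  from someI_ex[OF lin_surj[OF this]] show ?thesis unfolding Y_def .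
qed

lemma L:
  assumes "j \<in> {2, 3}" shows "d 2 (\<epsilon> (idx m)) j = lin (L j m)"
proof -
  have "d 2 (\<epsilon> (idx m)) j \<in> gr A 1"
    using d2_hcomp[OF basis3[OF idx_less[of m]]] assms by (auto simp: hP2 gri_1)
  from someI_ex[OF lin_surj[OF this]] show ?thesis unfolding L_def .
qed

lemma vec1_linear_part:
  assumes "j \<in> {2, 3}"
  shows "d 2 (vec1 c) j = lin (\<lambda>k. \<Sum>m\<in>UNIV. c m * L j m k)"
  unfolding d2_vec1 L[OF assms] lin_sum ..

text \<open>Since \<open>P 4 \<rightarrow> P 3 \<rightarrow> P 2\<close> is zero, \<open>Y\<close> and \<open>L\<close> combine to two more quadratic relations, the relations
from the point of view of right modules.\<close>

definition \<Phi> :: "nat \<Rightarrow> 3 \<Rightarrow> 3 \<Rightarrow> 'k" where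
  "\<Phi> j = (\<lambda>i k. \<Sum>m\<in>UNIV. Y m i * L j m k)"

lemma quad_\<Phi>:
  assumes "j \<in> {2, 3}" shows "quad (\<Phi> j) = 0"
proof -
  have "quad (\<lambda>i k. \<Sum>m\<in>M. outer (u m) (w m) i k) = (\<Sum>m\<in>M. lin (u m) * lin (w m))"
    for M :: "3 set" and u w
  proof (induction M rule: infinite_finite_induct)
    case (insert m M)
    then show ?case using quad_comb[of 1 "outer (u m) (w m)" 1] by (simp add: quad_outer)
  qed (simp_all add: quad_def)
  from this[where M = UNIV and u = Y and w = "L j"]
  have "quad (\<Phi> j) = (\<Sum>m\<in>UNIV. lin (Y m) * lin (L j m))" by (simp add: \<Phi>_def outer_def)
  also have "\<dots> = d 2 (d 3 (\<epsilon> 0)) j"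
    unfolding d2_expand[OF carrierP[OF d3_hcomp[OF basis4]]] sum_idx Y L[OF assms] ..
  also have "\<dots> = 0"
    using dd_zero[OF res, of "\<epsilon> 0" 2] carrierP[OF basis4] by (simp add: eval_nat_numeral)
  finally show ?thesis .
qed

end

locale type_13431_gorenstein = type_13431 +
  assumes ext2: "cocycles P d (regular_module A) 2 k \<subseteq> coboundaries P d (regular_module A) 2 k"
    and ext3: "cocycles P d (regular_module A) 3 k \<subseteq> coboundaries P d (regular_module A) 3 k"
begin

text \<open>A linear dependence of the entries of \<open>P 4 \<rightarrow> P 3\<close> is a cocycle \<open>P 3 \<rightarrow> A\<close> of degree \<open>-4\<close>. It is a
coboundary, but a map \<open>P 2 \<rightarrow> A\<close> of degree \<open>-4\<close> is zero, as \<open>P 2\<close> is generated in degrees 2 and 3.\<close>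

lemma Y_indep:
  assumes "\<And>i. (\<Sum>m\<in>UNIV. b m * Y m i) = 0"
  shows "b = (\<lambda>_. 0)"
proof -
  define h where "h = (\<lambda>p. \<Sum>i<length [4, 4, 4::int]. p i * kap (b (jdx i)))"
  have h: "gr_hom (- 4) (P 3) (regular_module A) h"
    unfolding h_def P3 by (rule row_hom) (auto simp: less_Suc_eq numeral_3_eq_3)
  have h_idx: "h p = (\<Sum>m\<in>UNIV. p (idx m) * kap (b m))" for p
    unfolding h_def using sum_idx[of "\<lambda>i. p i * kap (b (jdx i))"] by (simp add: numeral_3_eq_3)
  have "h (d 3 p) = 0" if p: "p \<in> mcarrier (P 4)" for p
  proof -
    have "h (d 3 p) = p 0 * (\<Sum>m\<in>UNIV. lin (Y m) * kap (b m))"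
      unfolding h_idx d3_expand[OF p] Y by (simp add: sum_distrib_left mult.assoc)
    also have "(\<Sum>m\<in>UNIV. lin (Y m) * kap (b m)) = lin (\<lambda>i. \<Sum>m\<in>UNIV. b m * Y m i)"
      unfolding lin_sum by (simp add: kap_central)
    also have "\<dots> = 0" by (simp add: assms)
    finally show ?thesis by simp
  qed
  then have "h \<in> cocycles P d (regular_module A) 3 (- 4)"
    using h by (simp add: cocycles_def eval_nat_numeral)
  then have "h \<in> coboundaries P d (regular_module A) 3 (- 4)" using ext3 by blast
  then obtain g where g: "gr_hom (- 4) (P 2) (regular_module A) g"
    "\<And>p. p \<in> mcarrier (P 3) \<Longrightarrow> h p = g (d 2 p)"
    unfolding coboundaries_def by (auto simp: eval_nat_numeral)
  have "g p = 0" if p: "p \<in> mcarrier (P 2)" for p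
  proof -
    have "g (\<epsilon> i) = 0" if i: "i < 4" for i
    proof -
      have "i = 0 \<or> i = 1 \<or> i = 2 \<or> i = 3" using i by auto
      then show ?thesis
        using gr_hom_deg[OF g(1) basis2(1)] gr_hom_deg[OF g(1) basis2(2)]
          gr_hom_deg[OF g(1) basis2(3)] gr_hom_deg[OF g(1) basis2(4)]
        by (auto simp: hcomp_regular gri_neg)
    qed
    then show ?thesis using expand[OF P2 g(1) p] by (simp add: act_regular)
  qed
  then have "h (\<epsilon> (idx m)) = 0" for m
    using g(2)[OF carrierP[OF basis3[OF idx_less]]] carrierP[OF d2_hcomp[OF basis3[OF idx_less]]] by simp
  moreover have "h (\<epsilon> (idx m)) = kap (b m)" for m
  proof -
    have "h (\<epsilon> (idx m)) = (\<Sum>m'\<in>UNIV. if m' = m then kap (b m') else 0)"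
      unfolding h_idx unit_vec_def by (rule sum.cong) (auto dest: arg_cong[of _ _ jdx])
    then show ?thesis by simp
  qed
  ultimately have "b m = 0" for m using kap_cancel[of "b m" 1] by simp
  then show ?thesis by auto
qed

text \<open>In the same way, a dependence of the columns of the linear part is a cocycle \<open>P 2 \<rightarrow> A\<close> of degree
\<open>-3\<close>, and \<open>P 1\<close> is generated in degree 1.\<close>

lemma L_indep:
  assumes "\<And>m k. s * L 2 m k + t * L 3 m k = 0"
  shows "s = 0 \<and> t = 0"
proof -
  define b where "b = (\<lambda>i::nat. if i = 2 then kap s else if i = 3 then kap t else 0)"
  define h where "h = (\<lambda>p. \<Sum>i<length [2, 2, 3, 3::int]. p i * b i)"
  have h: "gr_hom (- 3) (P 2) (regular_module A) h"
    unfolding h_def P2 by (rule row_hom) (auto simp: less_Suc_eq eval_nat_numeral b_def)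
  have h_eq: "h p = p 2 * kap s + p 3 * kap t" for p
    unfolding h_def b_def by (simp add: eval_nat_numeral)
  have "h (d 2 p) = 0" if p: "p \<in> mcarrier (P 3)" for p
  proof -
    have "lin (L 2 m) * kap s + lin (L 3 m) * kap t = lin (\<lambda>k. s * L 2 m k + t * L 3 m k)" for m
      unfolding lin_comb by (simp add: kap_central)
    then have z: "lin (L 2 m) * kap s + lin (L 3 m) * kap t = 0" for m by (simp add: assms)
    have "h (d 2 p) = (\<Sum>m\<in>UNIV. p (idx m) * (lin (L 2 m) * kap s + lin (L 3 m) * kap t))"
      unfolding h_eq d2_expand[OF p] sum_idx
      by (simp add: L sum_distrib_right sum.distrib distrib_left mult.assoc)
    then show ?thesis by (simp add: z)
  qed
  then have "h \<in> cocycles P d (regular_module A) 2 (- 3)"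
    using h by (simp add: cocycles_def eval_nat_numeral)
  then have "h \<in> coboundaries P d (regular_module A) 2 (- 3)" using ext2 by blast
  then obtain g where g: "gr_hom (- 3) (P (Suc 0)) (regular_module A) g"
    "\<And>p. p \<in> mcarrier (P 2) \<Longrightarrow> h p = g (d (Suc 0) p)"
    unfolding coboundaries_def by (auto simp: eval_nat_numeral)
  have "g p = 0" if p: "p \<in> mcarrier (P (Suc 0))" for p
  proof -
    have "g (\<epsilon> i) = 0" if i: "i < 3" for i
      using gr_hom_deg[OF g(1) basis1[OF i]] by (auto simp: hcomp_regular gri_neg)
    then show ?thesis using expand[OF P1' g(1) p] by (simp add: act_regular eval_nat_numeral)
  qed
  then have h0: "h p = 0" if "p \<in> hcomp (P 2) k" for p k
    using g(2)[OF carrierP[OF that]] carrierP[OF d1_hcomp[OF that]] by simp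
  have "kap s = 0" "kap t = 0"
    using h0[OF basis2(3)] h0[OF basis2(4)] unfolding h_eq by (simp_all add: unit_vec_def)
  then show ?thesis using kap_cancel[of s 1] kap_cancel[of t 1] by simp
qed

lemma functional_exists: "\<exists>\<alpha>. \<forall>m. dot \<alpha> (Y m) = c m"
proof -
  have "\<exists>s\<in>range (\<lambda>\<alpha> m. dot \<alpha> (Y m)). \<forall>m\<in>UNIV. s m = c m"
  proof (rule coordinates_span)
    show "finite (UNIV :: 3 set)" by simp
    show "(\<lambda>i. s i + t i) \<in> range (\<lambda>\<alpha> m. dot \<alpha> (Y m))"
      if s: "s \<in> range (\<lambda>\<alpha> m. dot \<alpha> (Y m))" and t: "t \<in> range (\<lambda>\<alpha> m. dot \<alpha> (Y m))" for s t
    proof -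
      obtain \<alpha> where "s = (\<lambda>m. dot \<alpha> (Y m))" using s by (elim rangeE)
      moreover obtain \<beta> where "t = (\<lambda>m. dot \<beta> (Y m))" using t by (elim rangeE)
      ultimately show ?thesis using dot_comb_left[of 1 \<alpha> 1 \<beta>] by (intro range_eqI[of _ _ "\<lambda>i. \<alpha> i + \<beta> i"]) simp
    qed
    show "(\<lambda>i. b * s i) \<in> range (\<lambda>\<alpha> m. dot \<alpha> (Y m))" if s: "s \<in> range (\<lambda>\<alpha> m. dot \<alpha> (Y m))" for s b
    proof -
      obtain \<alpha> where "s = (\<lambda>m. dot \<alpha> (Y m))" using s by (elim rangeE)
      then show ?thesis using dot_scale(1)[of b \<alpha>] by (intro range_eqI[of _ _ "\<lambda>i. b * \<alpha> i"]) simp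
    qed
    show "(\<lambda>_. 0) \<in> range (\<lambda>\<alpha> m. dot \<alpha> (Y m))" by (rule range_eqI[of _ _ "\<lambda>_. 0"]) simp
    fix b :: "3 \<Rightarrow> 'a" assume "\<exists>i\<in>UNIV. b i \<noteq> 0"
    then have "b \<noteq> (\<lambda>_. 0)" by auto
    then obtain i where i: "(\<Sum>m\<in>UNIV. b m * Y m i) \<noteq> 0" using Y_indep by blast
    show "\<exists>s\<in>range (\<lambda>\<alpha> m. dot \<alpha> (Y m)). (\<Sum>m\<in>UNIV. b m * s m) \<noteq> 0"
      by (rule bexI[of _ "\<lambda>m. dot (unit_vec i) (Y m)"]) (use i in simp, rule rangeI)
  qed
  then obtain \<alpha> where "\<forall>m. dot \<alpha> (Y m) = c m" by auto
  then show ?thesis by blast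
qed

text \<open>The two relations \<open>\<Phi> 2\<close> and \<open>\<Phi> 3\<close> are independent, and the space of quadratic relations has dimension 2.\<close>

lemma relations_from_\<Phi>:
  assumes "lcontr \<alpha> (\<Phi> 2) = (\<lambda>_. 0)" "lcontr \<alpha> (\<Phi> 3) = (\<lambda>_. 0)"
  shows "lcontr \<alpha> F = (\<lambda>_. 0)" "lcontr \<alpha> G = (\<lambda>_. 0)"
proof -
  obtain a b where ab: "\<Phi> 2 = (\<lambda>i k. a * F i k + b * G i k)" using quad_\<Phi>[of 2] relations by auto
  obtain c f where cf: "\<Phi> 3 = (\<lambda>i k. c * F i k + f * G i k)" using quad_\<Phi>[of 3] relations by auto
  have \<Phi>_indep: "s = 0 \<and> t = 0" if st: "\<And>i k. s * \<Phi> 2 i k + t * \<Phi> 3 i k = 0" for s t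
  proof (rule L_indep)
    fix m k
    have "(\<Sum>m\<in>UNIV. (s * L 2 m k + t * L 3 m k) * Y m i) = 0" for i
      using st[of i k] unfolding \<Phi>_def
      by (simp add: sum_distrib_left sum.distrib[symmetric] algebra_simps)
    from Y_indep[OF this] show "s * L 2 m k + t * L 3 m k = 0" by meson
  qed
  have det: "a * f - b * c \<noteq> 0"
  proof
    assume D: "a * f - b * c = 0"
    have "f * \<Phi> 2 i k + (- b) * \<Phi> 3 i k = (a * f - b * c) * F i k" for i k
      unfolding ab cf by (simp add: algebra_simps)
    then have "f = 0" "b = 0" using \<Phi>_indep[of f "- b"] D by auto
    have "c * \<Phi> 2 i k + (- a) * \<Phi> 3 i k = - (a * f - b * c) * G i k" for i k
      unfolding ab cf by (simp add: algebra_simps)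
    then have "c = 0" "a = 0" using \<Phi>_indep[of c "- a"] D by auto
    then show False using \<Phi>_indep[of 1 0] ab \<open>b = 0\<close> by simp
  qed
  have 1: "a * lcontr \<alpha> F k + b * lcontr \<alpha> G k = 0" and 2: "c * lcontr \<alpha> F k + f * lcontr \<alpha> G k = 0" for k
    using assms unfolding ab cf lcontr_comb by meson+
  have "(a * f - b * c) * lcontr \<alpha> F k = f * (a * lcontr \<alpha> F k + b * lcontr \<alpha> G k) - b * (c * lcontr \<alpha> F k + f * lcontr \<alpha> G k)" for k
    by (simp add: algebra_simps)
  then show "lcontr \<alpha> F = (\<lambda>_. 0)" unfolding 1 2 using det by auto
  have "(a * f - b * c) * lcontr \<alpha> G k = a * (c * lcontr \<alpha> F k + f * lcontr \<alpha> G k) - c * (a * lcontr \<alpha> F k + b * lcontr \<alpha> G k)" for k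
    by (simp add: algebra_simps)
  then show "lcontr \<alpha> G = (\<lambda>_. 0)" unfolding 1 2 using det by auto
qed

lemma lcontr_\<Phi>: "lcontr \<alpha> (\<Phi> j) = (\<lambda>k. \<Sum>m\<in>UNIV. dot \<alpha> (Y m) * L j m k)"
proof
  fix k
  have "lcontr \<alpha> (\<Phi> j) k = (\<Sum>i\<in>UNIV. \<Sum>m\<in>UNIV. \<alpha> i * Y m i * L j m k)"
    by (simp add: lcontr_def \<Phi>_def sum_distrib_left mult.assoc)
  also have "\<dots> = (\<Sum>m\<in>UNIV. \<Sum>i\<in>UNIV. \<alpha> i * Y m i * L j m k)" by (rule sum.swap)
  finally show "lcontr \<alpha> (\<Phi> j) k = (\<Sum>m\<in>UNIV. dot \<alpha> (Y m) * L j m k)"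
    by (simp add: dot_def sum_distrib_right)
qed

text \<open>A combination \<open>c\<close> of the generators of \<open>P 3\<close> whose image has no linear entries is a dependence of the rows of
\<open>L\<close>. As the entries of \<open>P 4 \<rightarrow> P 3\<close> form a basis of \<open>A\<^sub>1\<close>, it defines a functional on \<open>A\<^sub>1\<close>, which
annihilates the left factors of \<open>\<Phi> 2\<close> and \<open>\<Phi> 3\<close>.\<close>

lemma annihilator:
  assumes "d 2 (vec1 c) 2 = 0" "d 2 (vec1 c) 3 = 0" and \<alpha>: "\<And>m. dot \<alpha> (Y m) = c m"
  shows "lcontr \<alpha> F = (\<lambda>_. 0)" "lcontr \<alpha> G = (\<lambda>_. 0)"
proof -
  have "lin (\<lambda>k. \<Sum>m\<in>UNIV. c m * L j m k) = 0" if "j \<in> {2, 3}" for j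
    using vec1_linear_part[OF that, of c] assms(1,2) that by auto
  then have "lcontr \<alpha> (\<Phi> j) = (\<lambda>_. 0)" if "j \<in> {2, 3}" for j
    unfolding lcontr_\<Phi> \<alpha> using lin_inj that by blast
  then show "lcontr \<alpha> F = (\<lambda>_. 0)" "lcontr \<alpha> G = (\<lambda>_. 0)" by (intro relations_from_\<Phi>; simp)+
qed

lemma syzygy:
  assumes "q \<in> gr A 2" "r \<in> gr A 2" "\<And>k. q * lin (col F k) + r * lin (col G k) = 0"
  shows "\<exists>c. d 2 (vec1 c) = two q r"
proof -
  have qr: "q \<in> gri (4 - 2)" "r \<in> gri (4 - 2)" using assms(1,2) by (simp_all add: gri_2)
  have t: "two q r \<in> hcomp (P 2) 4" by (rule two_hP2[OF qr])
  have "d (Suc 0) (two q r) = 0" unfolding d1_zero_iff[OF t] using d1_two[OF qr] assms(3) by simp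
  then obtain \<gamma> where \<gamma>: "\<gamma> \<in> hcomp (P 3) 4" "d 2 \<gamma> = two q r" using d_exact2[OF t] by blast
  have "d 2 (vec1 (\<lambda>i. aug A (\<gamma> (idx i)))) = two q r"
    unfolding P3_vec1[OF \<gamma>(1), symmetric] by (rule \<gamma>(2))
  then show ?thesis by (intro exI[of _ "\<lambda>i. aug A (\<gamma> (idx i))"])
qed

lemma two_annihilators_of_square:
  assumes p: "lin u * lin u \<noteq> 0" "\<And>k. lin u * lin u * lin (col F k) = 0" "\<And>k. lin u * lin u * lin (col G k) = 0"
  shows "\<exists>b c. \<not> lindep b c \<and> lcontr b F = (\<lambda>_. 0) \<and> lcontr b G = (\<lambda>_. 0) \<and>
            lcontr c F = (\<lambda>_. 0) \<and> lcontr c G = (\<lambda>_. 0)"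
proof -
  define q where "q = lin u * lin u"
  have q2: "q \<in> gr A 2" using gr_mult[OF lin_gr lin_gr, of u u] by (simp add: q_def numeral_2_eq_2)
  obtain c where c: "d 2 (vec1 c) = two q 0"
    using syzygy[OF q2 gr_zero] p(2) by (auto simp: q_def)
  obtain b where b: "d 2 (vec1 b) = two 0 q"
    using syzygy[OF gr_zero q2] p(3) by (auto simp: q_def)
  obtain \<alpha> where \<alpha>: "\<And>m. dot \<alpha> (Y m) = c m" using functional_exists by blast
  obtain \<beta> where \<beta>: "\<And>m. dot \<beta> (Y m) = b m" using functional_exists by blast
  have A: "lcontr \<alpha> F = (\<lambda>_. 0)" "lcontr \<alpha> G = (\<lambda>_. 0)"
    by (rule annihilator[OF _ _ \<alpha>]; simp add: c two_def)+
  have B: "lcontr \<beta> F = (\<lambda>_. 0)" "lcontr \<beta> G = (\<lambda>_. 0)"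
    by (rule annihilator[OF _ _ \<beta>]; simp add: b two_def)+
  have "\<not> lindep \<alpha> \<beta>"
  proof
    assume "lindep \<alpha> \<beta>"
    then obtain s t where st: "(s, t) \<noteq> (0, 0)" "(\<lambda>i. s * \<alpha> i + t * \<beta> i) = (\<lambda>_. 0)"
      unfolding lindep_def by (elim exE conjE)
    have "s * c m + t * b m = 0" for m
      using dot_comb_left[of s \<alpha> t \<beta> "Y m"] unfolding st(2) \<alpha> \<beta> by simp
    then have "vec1 (\<lambda>i. s * c i + t * b i) = 0" by (auto simp: vec1_def)
    then have "d 2 (vec1 (\<lambda>i. s * c i + t * b i)) j = 0" for j using d_zero[of 2] by simp
    moreover have "d 2 (vec1 (\<lambda>i. s * c i + t * b i)) j = kap s * d 2 (vec1 c) j + kap t * d 2 (vec1 b) j" for j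
      unfolding d2_vec1 by (simp add: kap_add kap_mult distrib_right sum.distrib sum_distrib_left mult.assoc)
    ultimately have 0: "kap s * two q 0 j + kap t * two 0 q j = 0" for j unfolding c b by simp
    have "kap s * q = 0" "kap t * q = 0" using 0[of 0] 0[of "Suc 0"] by (simp_all add: two_def)
    then show False using st(1) p(1) kap_cancel unfolding q_def by auto
  qed
  then show ?thesis using A B by blast
qed

end

context type_13431
begin

section \<open>Generation of the Yoneda algebra\<close>

text \<open>A cocycle of internal degree \<open>-m\<close> vanishes on generators of degrees other than \<open>m\<close>.\<close>

lemma hom_K_zero:
  assumes es: "P n = free_module A es" and f: "gr_hom k (P n) K f" and p: "p \<in> mcarrier (P n)"
    and deg: "\<And>i. i < length es \<Longrightarrow> es ! i + k \<noteq> 0"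
  shows "f p = 0"
proof -
  have "f (\<epsilon> i) = 0" if "i < length es" for i
    using gr_hom_deg[OF f basisP[OF es that]] deg[OF that] by (simp add: hcomp_trivial)
  then show ?thesis using expand[OF es f p] by (simp add: act_trivial)
qed

lemma coordinate_cocycle:
  assumes n: "P n = free_module A es" and Suc: "P (Suc n) = free_module A fs" and j: "j < length es"
    and deg: "\<And>i. i < length fs \<Longrightarrow> fs ! i \<noteq> es ! j"
  shows "(\<lambda>p. aug A (p j)) \<in> cocycles P d K n (- (es ! j))"
proof -
  have f: "gr_hom (- (es ! j)) (P n) K (\<lambda>p. aug A (p j))" using coordinate_hom[OF j] n by simp
  have "gr_hom (0 + - (es ! j)) (P (Suc n)) K (\<lambda>p. aug A (d n p j))"
    by (rule gr_hom_comp[OF gradedP gradedP homd f])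
  then have "aug A (d n p j) = 0" if "p \<in> mcarrier (P (Suc n))" for p
    by (rule hom_K_zero[OF Suc _ that]) (use deg in auto)
  then show ?thesis using f by (simp add: cocycles_def)
qed

lemma nth_degrees:
  "i < 3 \<Longrightarrow> [a, a, a] ! i = a"
  "j \<in> {2, 3} \<Longrightarrow> [2, 2, 3, 3 :: int] ! j = 3"
  "i < 4 \<Longrightarrow> [2, 2, 3, 3 :: int] ! i \<in> {2, 3}"
  by (auto simp: less_Suc_eq eval_nat_numeral)

lemma coordinate1:
  assumes "i < 3" shows "(\<lambda>p. aug A (p i)) \<in> cocycles P d K 1 (- 1)"
  using coordinate_cocycle[OF P1', of "[2, 2, 3, 3]" i] P2 assms nth_degrees(1)[of i "1::int"] nth_degrees(3)
  by (force simp: eval_nat_numeral)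

lemma coordinate2:
  assumes "j \<in> {2, 3}" shows "(\<lambda>p. aug A (p j)) \<in> cocycles P d K 2 (- 3)"
proof -
  have "(\<lambda>p. aug A (p j)) \<in> cocycles P d K 2 (- ([2, 2, 3, 3] ! j))"
  proof (rule coordinate_cocycle[OF P2])
    show "P (Suc 2) = free_module A [4, 4, 4]" using P3 by (simp add: eval_nat_numeral)
    show "[4, 4, 4 :: int] ! i \<noteq> [2, 2, 3, 3] ! j" if "i < length [4, 4, 4 :: int]" for i
      using nth_degrees(1)[of i "4::int"] nth_degrees(2)[OF assms] that by simp
  qed (use assms in auto)
  then show ?thesis by (simp add: nth_degrees(2)[OF assms])
qed

lemma coordinate3:
  assumes "i < 3" shows "(\<lambda>p. aug A (p i)) \<in> cocycles P d K 3 (- 4)"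
proof -
  have "(\<lambda>p. aug A (p i)) \<in> cocycles P d K 3 (- ([4, 4, 4] ! i))"
  proof (rule coordinate_cocycle[OF P3])
    show "P (Suc 3) = free_module A [5]" using P4 by simp
    show "[5 :: int] ! k \<noteq> [4, 4, 4] ! i" if "k < length [5 :: int]" for k
      using nth_degrees(1)[of i "4::int"] assms that by simp
  qed (use assms in auto)
  then show ?thesis by (simp add: nth_degrees(1)[OF assms])
qed

lemma chain_liftE:
  assumes f: "f \<in> cocycles P d K n (- m)"
  obtains H where "chain_lift P d e n (- m) f H" "\<And>i. gr_hom (- m) (P (n + i)) (P i) (H i)"
    "\<And>p. p \<in> mcarrier (P n) \<Longrightarrow> e (H 0 p) = f p"
    "\<And>i p. p \<in> mcarrier (P (Suc (n + i))) \<Longrightarrow> d i (H (Suc i) p) = H i (d (n + i) p)"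
proof -
  obtain H where H: "\<And>i. gr_hom (- m) (P (n + i)) (P i) (H i)"
    "\<And>p. p \<in> mcarrier (P n) \<Longrightarrow> e (H 0 p) = f p"
    "\<And>i p. p \<in> mcarrier (P (Suc (n + i))) \<Longrightarrow> d i (H (Suc i) p) = H i (d (n + i) p)"
    by (rule chain_map_exists[OF res res f]) blast
  then have "chain_lift P d e n (- m) f H" unfolding chain_lift_def by blast
  then show ?thesis using H by (rule that)
qed

text \<open>A lift of a coordinate function starts with that coordinate, up to the scalar \<open>e (\<epsilon> 0)\<close>: on the other
generators it takes values of negative degree, or values of degree 0 in the kernel of \<open>e\<close>.\<close>

lemma lift_start:
  assumes es: "P n = free_module A es" and j: "j < length es"
    and deg: "\<And>i. i < length es \<Longrightarrow> es ! i \<le> es ! j"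
    and H: "gr_hom (- (es ! j)) (P n) (P 0) H"
    and eH: "\<And>p. p \<in> mcarrier (P n) \<Longrightarrow> e (H p) = aug A (p j)"
    and p: "p \<in> mcarrier (P n)"
  shows "H p 0 = p j * kap (1 / e (\<epsilon> 0))"
proof -
  have basis: "H (\<epsilon> i) 0 = (if i = j then kap (1 / e (\<epsilon> 0)) else 0)" if i: "i < length es" for i
  proof -
    have h: "H (\<epsilon> i) \<in> hcomp (P 0) (es ! i + - (es ! j))" by (rule gr_hom_deg[OF H basisP[OF es i]])
    have eq: "aug A (H (\<epsilon> i) 0) * e (\<epsilon> 0) = (if i = j then 1 else 0)"
      using eH[OF carrierP[OF basisP[OF es i]]] e_formula[OF carrierP[OF h]] by (auto simp: unit_vec_def)
    show ?thesis
    proof (cases "es ! i = es ! j")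
      case True
      then have "H (\<epsilon> i) 0 = kap (aug A (H (\<epsilon> i) 0))" using h by (intro gri_0_aug) (simp add: hP0)
      moreover have "aug A (H (\<epsilon> i) 0) = (if i = j then 1 / e (\<epsilon> 0) else 0)"
        using eq e_nonzero by (auto simp: nonzero_eq_divide_eq split: if_splits)
      ultimately show ?thesis by (metis (full_types) kap_zero)
    next
      case False
      then have "H (\<epsilon> i) 0 = 0" using h deg[OF i] by (simp add: hP0 gri_neg)
      then show ?thesis using False by auto
    qed
  qed
  have "H p 0 = (\<Sum>i<length es. p i * H (\<epsilon> i) 0)"
    using expand[OF es H p] by (simp add: act_P sum_fun_apply)
  also have "\<dots> = (\<Sum>i<length es. if i = j then p j * kap (1 / e (\<epsilon> 0)) else 0)"
    by (rule sum.cong) (use basis in auto)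
  finally show ?thesis using j by simp
qed

lemma yoneda_cocycle: "yoneda_gen A P d e n m f \<Longrightarrow> f \<in> cocycles P d K n (- m)"
  by (rule yoneda_gen_cocycle[OF res])

lemma hom_vec1: "gr_hom k (P 3) K f \<Longrightarrow> f (vec1 c) = (\<Sum>m\<in>UNIV. c m * f (\<epsilon> (idx m)))"
proof -
  assume f: "gr_hom k (P 3) K f"
  have "f (vec1 c) = (\<Sum>i<3. aug A (vec1 c i) * f (\<epsilon> i))"
    using expand[OF P3 f carrierP[OF vec1_hP3]] by (simp add: act_trivial eval_nat_numeral)
  then show ?thesis unfolding sum_idx by (simp add: vec1_def)
qed

end

context type_13431_gorenstein
begin

text \<open>This is \<open>E\<^sup>3 = E\<^sup>1 E\<^sup>2 + E\<^sup>2 E\<^sup>1\<close> in dual form. Products \<open>g f\<close> with \<open>f \<in> E\<^sup>2\<close>, \<open>g \<in> E\<^sup>1\<close> see the linear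
entries of the image of \<open>c\<close> in \<open>P 2\<close>; so these entries vanish and the image is \<open>(q, r, 0, 0)\<close>. Products
with \<open>f \<in> E\<^sup>1\<close>, \<open>g \<in> E\<^sup>2\<close> show that a lift \<open>H\<close> of the \<open>k\<close>-th coordinate of \<open>P 1\<close> maps \<open>c\<close> to a combination of
the two generators of degree 2. Applying the differential to it expresses \<open>H\<close> of \<open>(q, r, 0, 0)\<close>, the contraction
of \<open>q \<otimes> F + r \<otimes> G\<close> with the \<open>k\<close>-th coordinate, by the relations.\<close>

lemma no_invisible_syzygy:
  assumes kill: "\<And>f. yoneda_gen A P d e 3 4 f \<Longrightarrow> f (vec1 c) = 0"
  shows "c = (\<lambda>_. 0)"
proof (rule ccontr)
  assume c: "c \<noteq> (\<lambda>_. 0)"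
  define \<gamma> where "\<gamma> = vec1 c"
  have \<gamma>: "\<gamma> \<in> hcomp (P 3) 4" unfolding \<gamma>_def by (rule vec1_hP3)
  have d\<gamma>: "d 2 \<gamma> \<in> hcomp (P 2) 4" by (rule d2_hcomp[OF \<gamma>])
  have prod: "g (H n' \<gamma>) = 0"
    if "yoneda_gen A P d e n m f" "yoneda_gen A P d e n' m' g" "chain_lift P d e n (- m) f H"
      "n + n' = 3" "m + m' = 4" for n n' m m' f g H
    using kill[of "\<lambda>p. g (H n' p)"] yoneda_gen.prod[OF that(1-3)] that(4,5) unfolding \<gamma>_def by simp
  have lin0: "d 2 \<gamma> j = 0" if j: "j \<in> {2, 3}" for j
  proof -
    let ?f = "\<lambda>p. aug A (p j)"
    have f: "?f \<in> cocycles P d K 2 (- 3)" by (rule coordinate2[OF j])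
    obtain H where H: "chain_lift P d e 2 (- 3) ?f H" "\<And>i. gr_hom (- 3) (P (2 + i)) (P i) (H i)"
      "\<And>p. p \<in> mcarrier (P 2) \<Longrightarrow> e (H 0 p) = ?f p"
      "\<And>i p. p \<in> mcarrier (P (Suc (2 + i))) \<Longrightarrow> d i (H (Suc i) p) = H i (d (2 + i) p)"
      using chain_liftE[OF f] by blast
    have h1: "H (Suc 0) \<gamma> \<in> hcomp (P (Suc 0)) 1"
      using gr_hom_deg[OF H(2)[of "Suc 0"], of \<gamma> 4] \<gamma> by (simp add: eval_nat_numeral)
    have "aug A (H (Suc 0) \<gamma> (idx k)) = 0" for k
      using prod[of 2 3 ?f 1 1 "\<lambda>p. aug A (p (idx k))" H] H(1)
        yoneda_gen.gen[of 2 ?f P d A 3 e, OF _ f] yoneda_gen.gen[of 1 "\<lambda>p. aug A (p (idx k))" P d A 1 e, OF _ coordinate1[OF idx_less]]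
      by simp
    then have "H (Suc 0) \<gamma> = vec1 (\<lambda>_. 0)" using P1_vec1[OF h1] by simp
    then have "H (Suc 0) \<gamma> = 0" by (auto simp: vec1_def)
    then have "H 0 (d 2 \<gamma>) = 0"
      using H(4)[of \<gamma> 0] carrierP[OF \<gamma>] by (simp add: eval_nat_numeral)
    moreover have "H 0 (d 2 \<gamma>) 0 = d 2 \<gamma> j * kap (1 / e (\<epsilon> 0))"
    proof (rule lift_start[where H = "H 0" and j = j, OF P2 _ _ _ _ carrierP[OF d\<gamma>]])
      show "gr_hom (- ([2, 2, 3, 3] ! j)) (P 2) (P 0) (H 0)" using H(2)[of 0] j by auto
      show "e (H 0 p) = aug A (p j)" if "p \<in> mcarrier (P 2)" for p using H(3)[OF that] .
    qed (use j in \<open>auto simp: less_Suc_eq eval_nat_numeral\<close>)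
    ultimately have "kap (1 / e (\<epsilon> 0)) * d 2 \<gamma> j = 0" by (simp add: kap_central)
    then show ?thesis using kap_cancel e_nonzero by simp
  qed
  define q r where "q = d 2 \<gamma> 0" and "r = d 2 \<gamma> (Suc 0)"
  have qr: "q \<in> gr A 2" "r \<in> gr A 2" using d\<gamma> by (simp_all add: hP2 q_def r_def gri_2)
  have d\<gamma>_two: "d 2 \<gamma> = two q r"
  proof
    fix i :: nat
    have "i = 0 \<or> i = 1 \<or> i = 2 \<or> i = 3 \<or> i \<ge> 4" by auto
    then show "d 2 \<gamma> i = two q r i" using lin0 d\<gamma> by (auto simp: hP2 two_def q_def r_def)
  qed
  have contr: "contracts q r"
  proof (rule contractsI)
    fix k
    let ?f = "\<lambda>p. aug A (p (idx k))"
    have f: "?f \<in> cocycles P d K 1 (- 1)" by (rule coordinate1[OF idx_less])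
    obtain H where H: "chain_lift P d e 1 (- 1) ?f H" "\<And>i. gr_hom (- 1) (P (1 + i)) (P i) (H i)"
      "\<And>p. p \<in> mcarrier (P 1) \<Longrightarrow> e (H 0 p) = ?f p"
      "\<And>i p. p \<in> mcarrier (P (Suc (1 + i))) \<Longrightarrow> d i (H (Suc i) p) = H i (d (1 + i) p)"
      using chain_liftE[OF f] by blast
    have H0: "gr_hom (- 1) (P (Suc 0)) (P 0) (H 0)" and H1: "gr_hom (- 1) (P 2) (P (Suc 0)) (H (Suc 0))"
      and H2: "gr_hom (- 1) (P 3) (P 2) (H 2)"
      using H(2)[of 0] H(2)[of 1] H(2)[of 2] by (simp_all add: eval_nat_numeral)
    have dH1: "d 0 (H (Suc 0) p) = H 0 (d (Suc 0) p)" if "p \<in> mcarrier (P 2)" for p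
      using H(4)[of p 0] that by (simp add: eval_nat_numeral)
    have dH2: "d (Suc 0) (H 2 p) = H (Suc 0) (d 2 p)" if "p \<in> mcarrier (P 3)" for p
      using H(4)[of p 1] that by (simp add: eval_nat_numeral)
    have h2: "H 2 \<gamma> \<in> hcomp (P 2) 3" using gr_hom_deg[OF H2 \<gamma>] by simp
    have "aug A (H 2 \<gamma> j) = 0" if j: "j \<in> {2, 3}" for j
      using prod[of 1 1 ?f 2 3 "\<lambda>p. aug A (p j)" H] H(1)
        yoneda_gen.gen[of 1 ?f P d A 1 e, OF _ f]
        yoneda_gen.gen[of 2 "\<lambda>p. aug A (p j)" P d A 3 e, OF _ coordinate2[OF j]]
      by simp
    then have z: "H 2 \<gamma> 2 = 0" "H 2 \<gamma> 3 = 0"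
      using h2 gri_0_aug[of "H 2 \<gamma> 2"] gri_0_aug[of "H 2 \<gamma> 3"] by (simp_all add: hP2)
    have "H 2 \<gamma> 0 \<in> gr A 1" "H 2 \<gamma> (Suc 0) \<in> gr A 1" using h2 by (simp_all add: hP2 gri_1)
    then obtain v w where vw: "H 2 \<gamma> 0 = lin v" "H 2 \<gamma> (Suc 0) = lin w" using lin_surj by meson
    have H2\<gamma>: "H 2 \<gamma> = two (lin v) (lin w)"
    proof
      fix i :: nat
      have "i = 0 \<or> i = 1 \<or> i = 2 \<or> i = 3 \<or> i \<ge> 4" by auto
      then show "H 2 \<gamma> i = two (lin v) (lin w) i" using z h2 vw by (auto simp: hP2 two_def)
    qed
    have lhs: "d (Suc 0) (H 2 \<gamma>) (idx i) = lin v * lin (col F i) + lin w * lin (col G i)" for i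
      unfolding H2\<gamma> by (rule d1_two[of _ 1]) (simp_all add: gri_1 lin_gr[unfolded One_nat_def])
    define \<epsilon>0 where "\<epsilon>0 = e (\<epsilon> 0)"
    have scal: "H (Suc 0) (\<epsilon> n) (idx i) = kap (1 / \<epsilon>0 * FF n i k)" if n: "n < 2" for n i
    proof -
      have en: "\<epsilon> n \<in> hcomp (P 2) 2" using basis2(1,2) n by (auto simp: less_2_cases_iff)
      have h: "H (Suc 0) (\<epsilon> n) \<in> hcomp (P (Suc 0)) 1" using gr_hom_deg[OF H1 en] by simp
      define u where "u = (\<lambda>i. aug A (H (Suc 0) (\<epsilon> n) (idx i)))"
      have hu: "H (Suc 0) (\<epsilon> n) = vec1 u" using P1_vec1[OF h] by (simp only: u_def)
      have "lin u = d 0 (H (Suc 0) (\<epsilon> n)) 0" unfolding hu by (rule d0_vec1[symmetric])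
      also have "\<dots> = H 0 (d (Suc 0) (\<epsilon> n)) 0" by (simp only: dH1[OF carrierP[OF en]])
      also have "\<dots> = d (Suc 0) (\<epsilon> n) (idx k) * kap (1 / e (\<epsilon> 0))"
      proof (rule lift_start[where H = "H 0" and j = "idx k", OF P1' _ _ _ _ carrierP[OF d1_hcomp[OF en]]])
        show "gr_hom (- ([1, 1, 1] ! idx k)) (P (Suc 0)) (P 0) (H 0)"
          using H0 idx_less[of k] by (auto simp: less_Suc_eq eval_nat_numeral)
        show "e (H 0 p) = aug A (p (idx k))" if "p \<in> mcarrier (P (Suc 0))" for p using H(3)[of p] that by simp
      qed (use idx_less[of k] in \<open>auto simp: less_Suc_eq eval_nat_numeral\<close>)
      also have "d (Suc 0) (\<epsilon> n) (idx k) = lin (col (FF n) k)"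
        using n rows[of k] by (auto simp: less_2_cases_iff)
      finally have "lin u = kap (1 / \<epsilon>0) * lin (col (FF n) k)" by (simp add: kap_central \<epsilon>0_def)
      then have "lin (\<lambda>i. 1 * u i + (- 1) * (1 / \<epsilon>0 * FF n i k)) = 0"
        unfolding lin_comb lin_scale by (simp add: kap_uminus)
      from fun_cong[OF lin_inj[OF this], of i] have "u i = 1 / \<epsilon>0 * FF n i k" by simp
      then show ?thesis unfolding hu by (simp add: vec1_def)
    qed
    have rhs: "H (Suc 0) (d 2 \<gamma>) (idx i) = kap (1 / \<epsilon>0) * (kap (F i k) * q + kap (G i k) * r)" for i
    proof -
      have "H (Suc 0) (d 2 \<gamma>) (idx i) = q * H (Suc 0) (\<epsilon> 0) (idx i) + r * H (Suc 0) (\<epsilon> (Suc 0)) (idx i)"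
        using expand[OF P2 H1 carrierP[OF d\<gamma>]] unfolding d\<gamma>_two
        by (simp add: act_P sum_fun_apply two_def)
      also have "\<dots> = q * kap (1 / \<epsilon>0 * F i k) + r * kap (1 / \<epsilon>0 * G i k)"
        using scal[of 0 i] scal[of "Suc 0" i] by simp
      also have "\<dots> = kap (1 / \<epsilon>0) * (kap (F i k) * q + kap (G i k) * r)"
        by (simp only: kap_central[where y = q, symmetric] kap_central[where y = r, symmetric])
          (simp only: kap_mult mult.assoc distrib_left)
      finally show ?thesis .
    qed
    have \<epsilon>0: "\<epsilon>0 \<noteq> 0" using e_nonzero by (simp add: \<epsilon>0_def)
    show "\<exists>v w. \<forall>i. kap (F i k) * q + kap (G i k) * r = lin v * lin (col F i) + lin w * lin (col G i)"
    proof (intro exI allI)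
      fix i
      have eq: "kap (1 / \<epsilon>0) * (kap (F i k) * q + kap (G i k) * r) =
          lin v * lin (col F i) + lin w * lin (col G i)"
        using lhs[of i] rhs[of i] dH2[OF carrierP[OF \<gamma>]] by simp
      have "kap (F i k) * q + kap (G i k) * r = kap (\<epsilon>0 * (1 / \<epsilon>0)) * (kap (F i k) * q + kap (G i k) * r)"
        using \<epsilon>0 by simp
      also have "\<dots> = kap \<epsilon>0 * (lin v * lin (col F i) + lin w * lin (col G i))"
        unfolding kap_mult mult.assoc eq ..
      finally show "kap (F i k) * q + kap (G i k) * r =
          lin (\<lambda>i. \<epsilon>0 * v i) * lin (col F i) + lin (\<lambda>i. \<epsilon>0 * w i) * lin (col G i)"
        by (simp add: lin_scale distrib_left mult.assoc)
    qed
  qed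
  obtain \<alpha> where \<alpha>: "\<And>m. dot \<alpha> (Y m) = c m" using functional_exists by blast
  have \<alpha>0: "\<alpha> \<noteq> (\<lambda>_. 0)"
  proof
    assume "\<alpha> = (\<lambda>_. 0)"
    then have "c m = 0" for m using \<alpha>[of m] by simp
    then show False using c by auto
  qed
  interpret T: two_relations3 kap x F G \<alpha>
  proof
    show "\<alpha> \<noteq> (\<lambda>_. 0)" by (rule \<alpha>0)
    have l: "d 2 (vec1 c) 2 = 0" "d 2 (vec1 c) 3 = 0" using lin0 unfolding \<gamma>_def by simp_all
    show "lcontr \<alpha> F = (\<lambda>_. 0)" "lcontr \<alpha> G = (\<lambda>_. 0)" by (rule annihilator[OF l \<alpha>])+
  qed (rule two_annihilators_of_square)
  have "q = 0 \<and> r = 0" by (rule T.contracts_trivial[OF contr])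
  then have "d 2 (vec1 c) = 0" using d\<gamma>_two unfolding \<gamma>_def by (auto simp: two_def)
  then show False using d2_vec1_inj c by blast
qed

lemma generated_3:
  assumes f: "f \<in> cocycles P d K 3 (- 4)" shows "yoneda_gen A P d e 3 4 f"
proof -
  let ?S = "{\<lambda>m. g (\<epsilon> (idx m)) | g. yoneda_gen A P d e 3 4 g}"
  have "\<exists>s\<in>?S. \<forall>m\<in>UNIV. s m = f (\<epsilon> (idx m))"
  proof (rule coordinates_span)
    show "finite (UNIV :: 3 set)" by simp
    show "(\<lambda>i. s i + t i) \<in> ?S" if "s \<in> ?S" "t \<in> ?S" for s t
    proof -
      from that obtain g h where "s = (\<lambda>m. g (\<epsilon> (idx m)))" "t = (\<lambda>m. h (\<epsilon> (idx m)))"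
        "yoneda_gen A P d e 3 4 g" "yoneda_gen A P d e 3 4 h" by auto
      then show ?thesis by (intro CollectI exI[of _ "\<lambda>p. g p + h p"]) (auto intro: yoneda_gen.add)
    qed
    show "(\<lambda>i. b * s i) \<in> ?S" if "s \<in> ?S" for s b
    proof -
      from that obtain g where "s = (\<lambda>m. g (\<epsilon> (idx m)))" "yoneda_gen A P d e 3 4 g" by auto
      then show ?thesis by (intro CollectI exI[of _ "\<lambda>p. b * g p"]) (auto intro: yoneda_gen.scale)
    qed
    show "(\<lambda>_. 0) \<in> ?S" by (intro CollectI exI[of _ "\<lambda>_. 0"]) (auto intro: yoneda_gen.zero)
    fix c :: "3 \<Rightarrow> 'a" assume "\<exists>i\<in>UNIV. c i \<noteq> 0"
    then have "c \<noteq> (\<lambda>_. 0)" by auto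
    then obtain g where g: "yoneda_gen A P d e 3 4 g" "g (vec1 c) \<noteq> 0" using no_invisible_syzygy by blast
    have "(\<Sum>m\<in>UNIV. c m * g (\<epsilon> (idx m))) \<noteq> 0"
      using g(2) hom_vec1[OF cocyclesD(1)[OF yoneda_cocycle[OF g(1)]]] by simp
    then show "\<exists>s\<in>?S. (\<Sum>m\<in>UNIV. c m * s m) \<noteq> 0"
      using g(1) by (intro bexI[of _ "\<lambda>m. g (\<epsilon> (idx m))"]) auto
  qed
  then obtain g where g: "yoneda_gen A P d e 3 4 g" "\<And>m. g (\<epsilon> (idx m)) = f (\<epsilon> (idx m))" by auto
  show ?thesis
  proof (rule yoneda_gen_cong[OF res g(1) f])
    fix p assume p: "p \<in> mcarrier (P 3)"
    have "h p = (\<Sum>m\<in>UNIV. aug A (p (idx m)) * h (\<epsilon> (idx m)))" if h: "gr_hom (- 4) (P 3) K h" for h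
      using expand[OF P3 h p] sum_idx[of "\<lambda>i. aug A (p i) * h (\<epsilon> i)"]
      by (simp add: act_trivial eval_nat_numeral)
    from this[OF cocyclesD(1)[OF f]] this[OF cocyclesD(1)[OF yoneda_cocycle[OF g(1)]]]
    show "f p = g p" by (simp only: g(2))
  qed
qed

text \<open>The differential \<open>P 4 \<rightarrow> P 3\<close> is injective, so it has a nonzero entry, a linear form. The product of
the corresponding coordinate of \<open>P 3\<close> with a suitable element of \<open>E\<^sup>1\<close> is therefore nonzero, and \<open>E\<^sup>4\<close> is
one-dimensional.\<close>

lemma generated_4:
  assumes f: "f \<in> cocycles P d K 4 (- 5)" shows "yoneda_gen A P d e 4 5 f"
proof -
  have "\<exists>i. d 3 (\<epsilon> 0) (idx i) \<noteq> 0"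
  proof (rule ccontr)
    assume "\<not> ?thesis"
    then have "d 3 (\<epsilon> 0) n = 0" for n
      using d3_hcomp[OF basis4] less3_idx[of n] by (cases "n < 3") (auto simp: hP3)
    then have "d 3 (\<epsilon> 0) = 0" by auto
    then obtain z where z: "z \<in> hcomp (P 5) 5" "d 4 z = \<epsilon> 0" using d_exact4[OF basis4] by blast
    have "z = 0" using z(1) P5[of 5] by (auto simp: hcomp_free)
    then have "\<epsilon> 0 = (0 :: nat \<Rightarrow> 'b)" using z(2) by simp
    from fun_cong[OF this, of 0] show False by (simp add: unit_vec_def)
  qed
  then obtain i where i: "d 3 (\<epsilon> 0) (idx i) \<noteq> 0" by blast
  let ?f = "\<lambda>p. aug A (p (idx i))"
  have fc: "?f \<in> cocycles P d K 3 (- 4)" by (rule coordinate3[OF idx_less])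
  obtain H where H: "chain_lift P d e 3 (- 4) ?f H" "\<And>i. gr_hom (- 4) (P (3 + i)) (P i) (H i)"
    "\<And>p. p \<in> mcarrier (P 3) \<Longrightarrow> e (H 0 p) = ?f p"
    "\<And>i p. p \<in> mcarrier (P (Suc (3 + i))) \<Longrightarrow> d i (H (Suc i) p) = H i (d (3 + i) p)"
    using chain_liftE[OF fc] by blast
  have h1: "H (Suc 0) (\<epsilon> 0) \<in> hcomp (P (Suc 0)) 1"
    using gr_hom_deg[OF H(2)[of 1], of "\<epsilon> 0" 5] basis4 by (simp add: eval_nat_numeral)
  have "d 0 (H (Suc 0) (\<epsilon> 0)) 0 = H 0 (d 3 (\<epsilon> 0)) 0"
    using H(4)[of "\<epsilon> 0" 0] carrierP[OF basis4] by (simp add: eval_nat_numeral)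
  also have "\<dots> = d 3 (\<epsilon> 0) (idx i) * kap (1 / e (\<epsilon> 0))"
  proof (rule lift_start[where H = "H 0" and j = "idx i", OF P3 _ _ _ _ carrierP[OF d3_hcomp[OF basis4]]])
    show "gr_hom (- ([4, 4, 4] ! idx i)) (P 3) (P 0) (H 0)"
      using H(2)[of 0] idx_less[of i] by (auto simp: less_Suc_eq eval_nat_numeral)
    show "e (H 0 p) = aug A (p (idx i))" if "p \<in> mcarrier (P 3)" for p using H(3)[OF that] .
  qed (use idx_less[of i] in \<open>auto simp: less_Suc_eq eval_nat_numeral\<close>)
  also have "\<dots> = kap (1 / e (\<epsilon> 0)) * d 3 (\<epsilon> 0) (idx i)" by (simp add: kap_central)
  finally have nz: "d 0 (H (Suc 0) (\<epsilon> 0)) 0 \<noteq> 0" using i kap_cancel e_nonzero by simp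
  obtain k where k: "aug A (H (Suc 0) (\<epsilon> 0) (idx k)) \<noteq> 0"
  proof (rule ccontr)
    assume "\<not> thesis"
    then have "aug A (H (Suc 0) (\<epsilon> 0) (idx k)) = 0" for k using that by blast
    then have "H (Suc 0) (\<epsilon> 0) = vec1 (\<lambda>_. 0)" using P1_vec1[OF h1] by simp
    then show False using nz d0_vec1[of "\<lambda>_. 0"] by simp
  qed
  define g where "g = (\<lambda>p. aug A (H (Suc 0) p (idx k)))"
  have g: "yoneda_gen A P d e 4 5 g"
    using yoneda_gen.prod[OF generated_3[OF fc] yoneda_gen.gen[of 1 "\<lambda>p. aug A (p (idx k))" P d A 1 e, OF _ coordinate1[OF idx_less]] H(1)]
    by (simp add: g_def)
  have g0: "g (\<epsilon> 0) \<noteq> 0" using k by (simp add: g_def)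
  show ?thesis
  proof (rule yoneda_gen_cong[OF res yoneda_gen.scale[OF g, of "f (\<epsilon> 0) / g (\<epsilon> 0)"] f])
    fix p assume p: "p \<in> mcarrier (P 4)"
    have "h p = aug A (p 0) * h (\<epsilon> 0)" if h: "gr_hom (- 5) (P 4) K h" for h
      using expand[OF P4 h p] by (simp add: act_trivial)
    from this[OF cocyclesD(1)[OF f]] this[OF cocyclesD(1)[OF yoneda_cocycle[OF g]]]
    show "f p = f (\<epsilon> 0) / g (\<epsilon> 0) * g p" using g0 by simp
  qed
qed

lemma generated_zero:
  assumes f: "f \<in> cocycles P d K n (- m)" and z: "\<And>p. p \<in> mcarrier (P n) \<Longrightarrow> f p = 0"
  shows "yoneda_gen A P d e n m f"
  by (rule yoneda_gen_cong[OF res yoneda_gen.zero f]) (rule z)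

theorem generated:
  assumes f: "f \<in> cocycles P d K n (- m)" shows "yoneda_gen A P d e n m f"
proof -
  note fh = cocyclesD(1)[OF f]
  consider "n = 0" | "n \<in> {1, 2}" | "n = 3" | "n = 4" | "n \<ge> 5" by (cases "n \<ge> 5") (auto simp: less_Suc_eq not_le eval_nat_numeral)
  then show ?thesis
  proof cases
    case 1
    show ?thesis
    proof (cases "m = 0")
      case True
      have "yoneda_gen A P d e 0 0 (\<lambda>p. f (\<epsilon> 0) / e (\<epsilon> 0) * e p)"
        by (rule yoneda_gen.scale[OF yoneda_gen.unit])
      then have "yoneda_gen A P d e 0 0 f"
      proof (rule yoneda_gen_cong[OF res])
        show "f \<in> cocycles P d K 0 (- 0)" using f 1 True by simp
        fix p assume p: "p \<in> mcarrier (P 0)"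
        have "f p = aug A (p 0) * f (\<epsilon> 0)"
          using expand[OF P0, of "- m" K f p] fh p 1 by (simp add: act_trivial)
        then show "f p = f (\<epsilon> 0) / e (\<epsilon> 0) * e p" using e_formula[OF p] e_nonzero by simp
      qed
      then show ?thesis using 1 True by simp
    next
      case False
      show ?thesis
        by (rule generated_zero[OF f], rule hom_K_zero[of n "[0]", OF _ fh]) (use 1 P0 False in auto)
    qed
  next
    case 2
    then show ?thesis by (rule yoneda_gen.gen[OF _ f])
  next
    case 3
    show ?thesis
    proof (cases "m = 4")
      case True
      then show ?thesis using generated_3 f 3 by simp
    next
      case False
      show ?thesis
        by (rule generated_zero[OF f], rule hom_K_zero[of n "[4, 4, 4]", OF _ fh])
          (use 3 P3 False in \<open>auto simp: less_Suc_eq\<close>)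
    qed
  next
    case 4
    show ?thesis
    proof (cases "m = 5")
      case True
      then show ?thesis using generated_4 f 4 by simp
    next
      case False
      show ?thesis
        by (rule generated_zero[OF f], rule hom_K_zero[of n "[5]", OF _ fh]) (use 4 P4 False in auto)
    qed
  next
    case 5
    show ?thesis
      by (rule generated_zero[OF f], rule hom_K_zero[of n "[]", OF _ fh]) (use 5 P5 in auto)
  qed
qed

end

theorem theorem4p7:
  fixes A :: "('k::field, 'a::ring_1) gralg"
    and x :: "'x::finite \<Rightarrow> 'a"
    and R :: "('x word \<Rightarrow>\<^sub>0 'k) set"
    and P :: "nat \<Rightarrow> ('a, nat \<Rightarrow> 'a) grmod"
    and d :: "nat \<Rightarrow> (nat \<Rightarrow> 'a) \<Rightarrow> (nat \<Rightarrow> 'a)"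
    and e :: "(nat \<Rightarrow> 'a) \<Rightarrow> 'k"
  assumes alg: "connected_graded_algebra A"
    and pres: "presentation A x R"
    and three_generators: "CARD('x) = 3" "vector_space.dim (scal A) (gr A 1) = 3"
    and AS_reg: "AS_regular A 4"
    and relations: "R \<subseteq> tensor_deg 2 \<union> tensor_deg 3"
      "card (R \<inter> tensor_deg 2) = 2" "card (R \<inter> tensor_deg 3) = 2"
    and min_res: "minimal_resolution A (trivial_module A) P d e"
    and res_shape: "P 0 = free_module A [0]" "P 1 = free_module A [1, 1, 1]"
      "P 2 = free_module A [2, 2, 3, 3]" "P 3 = free_module A [4, 4, 4]"
      "P 4 = free_module A [5]" "\<And>n. n \<ge> 5 \<Longrightarrow> P n = free_module A []"
  shows "K2_algebra A"
proof -
  have res: "resolution A (trivial_module A) P d e"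
    using min_res unfolding minimal_resolution_def by (rule conjunct1)
  have "gorenstein_condition A 4" using AS_reg unfolding AS_regular_def by blast
  then have ext: "cocycles P d (regular_module A) i k \<subseteq> coboundaries P d (regular_module A) i k"
    if "i \<noteq> 4" for i k
    using res that unfolding gorenstein_condition_def Let_def by blast
  interpret type_13431_gorenstein A P d e
    by unfold_locales (use alg res res_shape ext in auto)
  show ?thesis
    unfolding K2_algebra_def using generation_independent[OF res _ generated] by blast
qed

end
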